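(* Let $R$ be a coherent ring and let $P$ be any exact chain complex of projective $R$-modules. Then $\operatorname{Ext}^1_R(Z_nP,A)=0$ for every integer $n$ and every absolutely pure $R$-module $A$.
   Context: "Coherent" means left and right coherent; modules are left $R$-modules. $Z_nP=\ker(P_n\to P_{n-1})$. A module $A$ is absolutely pure (= FP-injective) if $\operatorname{Ext}^1_R(N,A)=0$ for every finitely presented module $N$. *)

theory Defs
  imports "HOL-Algebra.Module" "HOL-Algebra.AbelCoset" "HOL-Algebra.Elementary_Groups"
begin

section \<open>Left modules over a not necessarily commutative ring\<close>

text \<open>The locale \<^locale>\<open>module\<close> of the library requires a commutative ring of scalars.  As there, the
  multiplication and the unit stored in the record of a module are irrelevant.\<close>

locale left_module = R?: ring R + M?: abelian_group M
  for R :: "('r, 'x) ring_scheme" (structure) and M :: "('r, 'm) module" (structure) +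
  assumes smult_closed [simp, intro]:
      "\<lbrakk>a \<in> carrier R; x \<in> carrier M\<rbrakk> \<Longrightarrow> a \<odot>\<^bsub>M\<^esub> x \<in> carrier M"
    and smult_l_distr:
      "\<lbrakk>a \<in> carrier R; b \<in> carrier R; x \<in> carrier M\<rbrakk> \<Longrightarrow>
      (a \<oplus> b) \<odot>\<^bsub>M\<^esub> x = a \<odot>\<^bsub>M\<^esub> x \<oplus>\<^bsub>M\<^esub> b \<odot>\<^bsub>M\<^esub> x"
    and smult_r_distr:
      "\<lbrakk>a \<in> carrier R; x \<in> carrier M; y \<in> carrier M\<rbrakk> \<Longrightarrow>
      a \<odot>\<^bsub>M\<^esub> (x \<oplus>\<^bsub>M\<^esub> y) = a \<odot>\<^bsub>M\<^esub> x \<oplus>\<^bsub>M\<^esub> a \<odot>\<^bsub>M\<^esub> y"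
    and smult_assoc1:
      "\<lbrakk>a \<in> carrier R; b \<in> carrier R; x \<in> carrier M\<rbrakk> \<Longrightarrow>
      (a \<otimes> b) \<odot>\<^bsub>M\<^esub> x = a \<odot>\<^bsub>M\<^esub> (b \<odot>\<^bsub>M\<^esub> x)"
    and smult_one [simp]:
      "x \<in> carrier M \<Longrightarrow> \<one> \<odot>\<^bsub>M\<^esub> x = x"

definition mod_hom ::
    "('r, 'x) ring_scheme \<Rightarrow> ('r, 'm) module \<Rightarrow> ('r, 'n) module \<Rightarrow> ('m \<Rightarrow> 'n) set" where
  "mod_hom R M N = {f \<in> hom (add_monoid M) (add_monoid N).
     \<forall>a\<in>carrier R. \<forall>x\<in>carrier M. f (a \<odot>\<^bsub>M\<^esub> x) = a \<odot>\<^bsub>N\<^esub> f x}"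

definition kernel_module ::
    "('r, 'm) module \<Rightarrow> ('r, 'n) module \<Rightarrow> ('m \<Rightarrow> 'n) \<Rightarrow> ('r, 'm) module" where
  "kernel_module M N f = M\<lparr>carrier := a_kernel M N f\<rparr>"

definition left_regular :: "('r, 'x) ring_scheme \<Rightarrow> ('r, 'r) module" where
  "left_regular R = \<lparr>carrier = carrier R, mult = mult R, one = one R, zero = zero R, add = add R,
     smult = mult R\<rparr>"

definition opposite_ring :: "('r, 'x) ring_scheme \<Rightarrow> ('r, 'x) ring_scheme" where
  "opposite_ring R = R\<lparr>mult := \<lambda>x y. y \<otimes>\<^bsub>R\<^esub> x\<rparr>"


section \<open>Free modules\<close>

text \<open>The free module on \<open>B\<close> consists of the finitely supported functions from \<open>B\<close> to \<open>R\<close>, extended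
  by zero outside \<open>B\<close>; \<open>lin_ext R M \<phi>\<close> is the linear map from it to \<open>M\<close> that
  sends the basis element at \<open>b\<close> to \<open>\<phi> b\<close>.\<close>

definition free_module :: "('r, 'x) ring_scheme \<Rightarrow> 'b set \<Rightarrow> ('r, 'b \<Rightarrow> 'r) module" where
  "free_module R B = \<lparr>carrier = {f. range f \<subseteq> carrier R \<and> finite {b. f b \<noteq> \<zero>\<^bsub>R\<^esub>} \<and> {b. f b \<noteq> \<zero>\<^bsub>R\<^esub>} \<subseteq> B},
     mult = undefined, one = undefined,
     zero = (\<lambda>b. \<zero>\<^bsub>R\<^esub>), add = (\<lambda>f g b. f b \<oplus>\<^bsub>R\<^esub> g b), smult = (\<lambda>a f b. a \<otimes>\<^bsub>R\<^esub> f b)\<rparr>"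

definition lin_ext ::
    "('r, 'x) ring_scheme \<Rightarrow> ('r, 'm) module \<Rightarrow> ('b \<Rightarrow> 'm) \<Rightarrow> ('b \<Rightarrow> 'r) \<Rightarrow> 'm" where
  "lin_ext R M \<phi> f = (\<Oplus>\<^bsub>M\<^esub>b\<in>{b. f b \<noteq> \<zero>\<^bsub>R\<^esub>}. f b \<odot>\<^bsub>M\<^esub> \<phi> b)"

definition free_cover :: "('r, 'x) ring_scheme \<Rightarrow> ('r, 'm) module \<Rightarrow> ('r, 'm \<Rightarrow> 'r) module" where
  "free_cover R M = free_module R (carrier M)"

definition cover_map :: "('r, 'x) ring_scheme \<Rightarrow> ('r, 'm) module \<Rightarrow> ('m \<Rightarrow> 'r) \<Rightarrow> 'm" where
  "cover_map R M = lin_ext R M (\<lambda>x. x)"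

definition syzygy :: "('r, 'x) ring_scheme \<Rightarrow> ('r, 'm) module \<Rightarrow> ('r, 'm \<Rightarrow> 'r) module" where
  "syzygy R M = kernel_module (free_cover R M) M (cover_map R M)"


section \<open>Finiteness conditions and coherent rings\<close>

definition finitely_generated :: "('r, 'x) ring_scheme \<Rightarrow> ('r, 'm) module \<Rightarrow> bool" where
  "finitely_generated R M \<longleftrightarrow> left_module R M \<and>
     (\<exists>S. finite S \<and> S \<subseteq> carrier M \<and>
       (\<forall>x\<in>carrier M. \<exists>c\<in>S \<rightarrow> carrier R. x = (\<Oplus>\<^bsub>M\<^esub>s\<in>S. c s \<odot>\<^bsub>M\<^esub> s)))"

definition finitely_presented :: "('r, 'x) ring_scheme \<Rightarrow> ('r, 'm) module \<Rightarrow> bool" where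
  "finitely_presented R M \<longleftrightarrow> left_module R M \<and>
     (\<exists>(n::nat). \<exists>\<phi>\<in>mod_hom R (free_module R {..<n}) M.
        \<phi> ` carrier (free_module R {..<n}) = carrier M \<and>
        finitely_generated R (kernel_module (free_module R {..<n}) M \<phi>))"

definition left_coherent :: "('r, 'x) ring_scheme \<Rightarrow> bool" where
  "left_coherent R \<longleftrightarrow> ring R \<and>
     (\<forall>I. submodule I R (left_regular R) \<and> finitely_generated R ((left_regular R)\<lparr>carrier := I\<rparr>)
        \<longrightarrow> finitely_presented R ((left_regular R)\<lparr>carrier := I\<rparr>))"

definition coherent_ring :: "('r, 'x) ring_scheme \<Rightarrow> bool" where
  "coherent_ring R \<longleftrightarrow> left_coherent R \<and> left_coherent (opposite_ring R)"


section \<open>Projective modules\<close>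

text \<open>A definition cannot quantify over all types, so the lifting property is only required for
  surjections between modules on the two types occurring in the free cover of \<open>P\<close>.  This implies the
  lifting property for modules on arbitrary types: see \<open>projective_lift\<close> below.\<close>

definition projective :: "('r, 'x) ring_scheme \<Rightarrow> ('r, 'p) module \<Rightarrow> bool" where
  "projective R P \<longleftrightarrow> left_module R P \<and>
     (\<forall>(M :: ('r, 'p \<Rightarrow> 'r) module) (N :: ('r, 'p) module).
        left_module R M \<and> left_module R N \<longrightarrow>
        (\<forall>g\<in>mod_hom R M N. \<forall>f\<in>mod_hom R P N. g ` carrier M = carrier N \<longrightarrow>
           (\<exists>h\<in>mod_hom R P M. \<forall>x\<in>carrier P. g (h x) = f x)))"


section \<open>The functor \<open>Ext\<^sup>1\<close>\<close>

text \<open>Elements of Hom are made extensional so that equality in the group is equality of maps on the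
  carrier.\<close>

definition Hom_group ::
    "('r, 'x) ring_scheme \<Rightarrow> ('r, 'm) module \<Rightarrow> ('r, 'a) module \<Rightarrow> ('m \<Rightarrow> 'a) monoid" where
  "Hom_group R M A = \<lparr>carrier = mod_hom R M A \<inter> extensional (carrier M),
     mult = (\<lambda>f g. \<lambda>x\<in>carrier M. f x \<oplus>\<^bsub>A\<^esub> g x), one = (\<lambda>x\<in>carrier M. \<zero>\<^bsub>A\<^esub>)\<rparr>"

text \<open>First cohomology of \<open>Hom(F\<^sub>0, A) \<rightarrow> Hom(F\<^sub>1, A) \<rightarrow> Hom(F\<^sub>2, A)\<close>, where
  \<open>F\<^sub>2 \<rightarrow> F\<^sub>1 \<rightarrow> F\<^sub>0 \<rightarrow> N \<rightarrow> 0\<close> is the beginning of the canonical free resolution of \<open>N\<close>: \<open>F\<^sub>0\<close> is the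
  free module on the underlying set of \<open>N\<close>, \<open>F\<^sub>1\<close> the one on the underlying set of the kernel of
  \<open>F\<^sub>0 \<rightarrow> N\<close>, and so on.\<close>

definition Ext1 ::
    "('r, 'x) ring_scheme \<Rightarrow> ('r, 'n) module \<Rightarrow> ('r, 'a) module \<Rightarrow> ((('n \<Rightarrow> 'r) \<Rightarrow> 'r) \<Rightarrow> 'a) set monoid"
  where "Ext1 R N A =
    (let F0 = free_cover R N;
         F1 = free_cover R (syzygy R N);
         F2 = free_cover R (syzygy R (syzygy R N));
         d1 = cover_map R (syzygy R N);
         d2 = cover_map R (syzygy R (syzygy R N));
         cocycles = kernel (Hom_group R F1 A) (Hom_group R F2 A) (\<lambda>f. compose (carrier F2) f d2);
         coboundaries = (\<lambda>f. compose (carrier F1) f d1) ` carrier (Hom_group R F0 A)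
     in (Hom_group R F1 A)\<lparr>carrier := cocycles\<rparr> Mod coboundaries)"

text \<open>Every finitely presented module is isomorphic to a quotient of some \<open>R\<^sup>n\<close>, so that it is enough to
  let \<open>N\<close> range over the modules whose elements are sets of functions from \<^typ>\<open>nat\<close> to \<open>R\<close>;
  see \<open>absolutely_pure_Ext1\<close> below for finitely presented modules on arbitrary types.\<close>

definition absolutely_pure :: "('r, 'x) ring_scheme \<Rightarrow> ('r, 'a) module \<Rightarrow> bool" where
  "absolutely_pure R A \<longleftrightarrow> left_module R A \<and>
     (\<forall>N :: ('r, (nat \<Rightarrow> 'r) set) module. finitely_presented R N \<longrightarrow> trivial_group (Ext1 R N A))"


section \<open>Chain complexes\<close>

definition chain_complex ::
    "('r, 'x) ring_scheme \<Rightarrow> (int \<Rightarrow> ('r, 'p) module) \<Rightarrow> (int \<Rightarrow> 'p \<Rightarrow> 'p) \<Rightarrow> bool" where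
  "chain_complex R P d \<longleftrightarrow> (\<forall>n. left_module R (P n)) \<and>
     (\<forall>n. d n \<in> mod_hom R (P n) (P (n - 1))) \<and>
     (\<forall>n. \<forall>x\<in>carrier (P (n + 1)). d n (d (n + 1) x) = \<zero>\<^bsub>P (n - 1)\<^esub>)"

definition exact_complex ::
    "('r, 'x) ring_scheme \<Rightarrow> (int \<Rightarrow> ('r, 'p) module) \<Rightarrow> (int \<Rightarrow> 'p \<Rightarrow> 'p) \<Rightarrow> bool" where
  "exact_complex R P d \<longleftrightarrow> chain_complex R P d \<and>
     (\<forall>n. d (n + 1) ` carrier (P (n + 1)) = a_kernel (P n) (P (n - 1)) (d n))"

definition cycles :: "(int \<Rightarrow> ('r, 'p) module) \<Rightarrow> (int \<Rightarrow> 'p \<Rightarrow> 'p) \<Rightarrow> int \<Rightarrow> ('r, 'p) module" where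
  "cycles P d n = kernel_module (P n) (P (n - 1)) (d n)"


section \<open>The definitions are independent of the types chosen\<close>

text \<open>The theorems \<open>projective_lift\<close> and \<open>absolutely_pure_Ext1\<close> justify the two definitions whose
  quantifiers are bound to particular types.  Along the way, \<open>Ext\<^sup>1\<close> is seen to be an abelian group,
  and its vanishing is characterised by the extension of maps from the kernel of \<open>F\<^sub>0 \<rightarrow> N\<close>.\<close>

lemma mod_hom_closed: "f \<in> mod_hom R M N \<Longrightarrow> x \<in> carrier M \<Longrightarrow> f x \<in> carrier N"
  by (auto simp: mod_hom_def hom_def)

lemma mod_hom_add: "f \<in> mod_hom R M N \<Longrightarrow> x \<in> carrier M \<Longrightarrow> y \<in> carrier M \<Longrightarrow>
    f (x \<oplus>\<^bsub>M\<^esub> y) = f x \<oplus>\<^bsub>N\<^esub> f y"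
  by (auto simp: mod_hom_def hom_def)

lemma mod_hom_smult: "f \<in> mod_hom R M N \<Longrightarrow> a \<in> carrier R \<Longrightarrow> x \<in> carrier M \<Longrightarrow>
    f (a \<odot>\<^bsub>M\<^esub> x) = a \<odot>\<^bsub>N\<^esub> f x"
  by (auto simp: mod_hom_def hom_def)

lemma mod_homI:
  assumes "\<And>x. x \<in> carrier M \<Longrightarrow> f x \<in> carrier N"
    and "\<And>x y. x \<in> carrier M \<Longrightarrow> y \<in> carrier M \<Longrightarrow> f (x \<oplus>\<^bsub>M\<^esub> y) = f x \<oplus>\<^bsub>N\<^esub> f y"
    and "\<And>a x. a \<in> carrier R \<Longrightarrow> x \<in> carrier M \<Longrightarrow> f (a \<odot>\<^bsub>M\<^esub> x) = a \<odot>\<^bsub>N\<^esub> f x"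
  shows "f \<in> mod_hom R M N"
  using assms by (auto simp: mod_hom_def hom_def)

lemma mod_hom_zero:
  assumes "left_module R M" "left_module R N" "f \<in> mod_hom R M N"
  shows "f \<zero>\<^bsub>M\<^esub> = \<zero>\<^bsub>N\<^esub>"
proof -
  interpret M: left_module R M by fact
  interpret N: left_module R N by fact
  have "f \<zero>\<^bsub>M\<^esub> \<oplus>\<^bsub>N\<^esub> f \<zero>\<^bsub>M\<^esub> = f \<zero>\<^bsub>M\<^esub>"
    using mod_hom_add[OF assms(3), of "\<zero>\<^bsub>M\<^esub>" "\<zero>\<^bsub>M\<^esub>"] by simp
  then show ?thesis
    using mod_hom_closed[OF assms(3), of "\<zero>\<^bsub>M\<^esub>"] by (metis M.M.zero_closed N.M.add.r_cancel_one')
qed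

lemma mod_hom_diff_zero:
  assumes "left_module R M" "left_module R N" "f \<in> mod_hom R M N"
    "x \<in> carrier M" "y \<in> carrier M" "f x = f y"
  shows "f (x \<ominus>\<^bsub>M\<^esub> y) = \<zero>\<^bsub>N\<^esub>"
proof -
  interpret M: left_module R M by fact
  interpret N: left_module R N by fact
  have "f (x \<ominus>\<^bsub>M\<^esub> y) \<oplus>\<^bsub>N\<^esub> f y = f (x \<ominus>\<^bsub>M\<^esub> y \<oplus>\<^bsub>M\<^esub> y)"
    using mod_hom_add[OF assms(3)] assms(4,5) by simp
  also have "\<dots> = f y"
    using assms(4-6) by (simp add: a_minus_def M.M.a_assoc M.M.l_neg)
  finally show ?thesis
    using mod_hom_closed[OF assms(3), of "x \<ominus>\<^bsub>M\<^esub> y"] mod_hom_closed[OF assms(3), of y] assms(4,5)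
    by (simp add: N.M.add.r_cancel_one)
qed

lemma mod_hom_comp:
  "f \<in> mod_hom R M N \<Longrightarrow> g \<in> mod_hom R N K \<Longrightarrow> (\<lambda>x. g (f x)) \<in> mod_hom R M K"
  by (rule mod_homI) (auto simp: mod_hom_closed mod_hom_add mod_hom_smult)

lemma (in left_module) smult_l_zero [simp]:
  assumes "x \<in> carrier M" shows "\<zero>\<^bsub>R\<^esub> \<odot>\<^bsub>M\<^esub> x = \<zero>\<^bsub>M\<^esub>"
proof -
  have "\<zero>\<^bsub>R\<^esub> \<odot>\<^bsub>M\<^esub> x \<oplus>\<^bsub>M\<^esub> \<zero>\<^bsub>R\<^esub> \<odot>\<^bsub>M\<^esub> x = \<zero>\<^bsub>R\<^esub> \<odot>\<^bsub>M\<^esub> x"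
    using smult_l_distr[of "\<zero>\<^bsub>R\<^esub>" "\<zero>\<^bsub>R\<^esub>" x] assms by simp
  then show ?thesis using assms by (metis M.add.r_cancel_one' R.zero_closed smult_closed)
qed

lemma (in left_module) smult_r_zero [simp]:
  assumes "a \<in> carrier R" shows "a \<odot>\<^bsub>M\<^esub> \<zero>\<^bsub>M\<^esub> = \<zero>\<^bsub>M\<^esub>"
proof -
  have "a \<odot>\<^bsub>M\<^esub> \<zero>\<^bsub>M\<^esub> \<oplus>\<^bsub>M\<^esub> a \<odot>\<^bsub>M\<^esub> \<zero>\<^bsub>M\<^esub> = a \<odot>\<^bsub>M\<^esub> \<zero>\<^bsub>M\<^esub>"
    using smult_r_distr[of a "\<zero>\<^bsub>M\<^esub>" "\<zero>\<^bsub>M\<^esub>"] assms by simp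
  then show ?thesis using assms by (metis M.add.r_cancel_one' M.zero_closed smult_closed)
qed

lemma (in left_module) left_module_self: "left_module R M" ..

lemma (in left_module) submodule_left_module:
  assumes "K \<subseteq> carrier M" "\<zero>\<^bsub>M\<^esub> \<in> K"
    "\<And>x y. x \<in> K \<Longrightarrow> y \<in> K \<Longrightarrow> x \<oplus>\<^bsub>M\<^esub> y \<in> K" "\<And>a x. a \<in> carrier R \<Longrightarrow> x \<in> K \<Longrightarrow> a \<odot>\<^bsub>M\<^esub> x \<in> K"
  shows "left_module R (M\<lparr>carrier := K\<rparr>)"
proof -
  have neg: "\<exists>y\<in>K. y \<oplus>\<^bsub>M\<^esub> x = \<zero>\<^bsub>M\<^esub>" if "x \<in> K" for x
  proof
    have x: "x \<in> carrier M" using that assms(1) by auto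
    show "(\<ominus>\<^bsub>R\<^esub> \<one>\<^bsub>R\<^esub>) \<odot>\<^bsub>M\<^esub> x \<in> K" using assms(4) that by simp
    show "(\<ominus>\<^bsub>R\<^esub> \<one>\<^bsub>R\<^esub>) \<odot>\<^bsub>M\<^esub> x \<oplus>\<^bsub>M\<^esub> x = \<zero>\<^bsub>M\<^esub>"
      using smult_l_distr[of "\<ominus>\<^bsub>R\<^esub> \<one>\<^bsub>R\<^esub>" "\<one>\<^bsub>R\<^esub>" x] x by (simp add: R.l_neg)
  qed
  have "abelian_group (M\<lparr>carrier := K\<rparr>)"
    using assms neg by (intro abelian_groupI) (auto simp: M.a_ac subset_iff)
  moreover have "left_module_axioms R (M\<lparr>carrier := K\<rparr>)"
    by unfold_locales
      (use assms in \<open>auto simp: subset_iff smult_l_distr smult_r_distr smult_assoc1\<close>)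
  ultimately show ?thesis
    by (intro left_module.intro R.ring_axioms)
qed

lemma carrier_kernel_module:
  "carrier (kernel_module M N f) = {x \<in> carrier M. f x = \<zero>\<^bsub>N\<^esub>}"
  by (simp add: kernel_module_def a_kernel_def')

lemma kernel_module_simps [simp]:
  "add (kernel_module M N f) = add M" "zero (kernel_module M N f) = zero M"
  "smult (kernel_module M N f) = smult M"
  by (simp_all add: kernel_module_def)

lemma left_module_kernel:
  assumes "left_module R M" "left_module R N" "f \<in> mod_hom R M N"
  shows "left_module R (kernel_module M N f)"
proof -
  interpret M: left_module R M by fact
  interpret N: left_module R N by fact
  show ?thesis
    unfolding kernel_module_def
    by (rule M.submodule_left_module)
      (use assms mod_hom_zero[OF assms] in \<open>auto simp: a_kernel_def' mod_hom_add mod_hom_smult\<close>)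
qed

lemma left_module_free:
  assumes "ring R" shows "left_module R (free_module R B)"
proof -
  interpret ring R by fact
  let ?F = "free_module R B"
  have cl: "(\<lambda>b. f b \<oplus>\<^bsub>R\<^esub> g b) \<in> carrier ?F" if "f \<in> carrier ?F" "g \<in> carrier ?F" for f g
  proof -
    have "{b. f b \<oplus>\<^bsub>R\<^esub> g b \<noteq> \<zero>\<^bsub>R\<^esub>} \<subseteq> {b. f b \<noteq> \<zero>\<^bsub>R\<^esub>} \<union> {b. g b \<noteq> \<zero>\<^bsub>R\<^esub>}" by auto
    moreover have "finite ({b. f b \<noteq> \<zero>\<^bsub>R\<^esub>} \<union> {b. g b \<noteq> \<zero>\<^bsub>R\<^esub>})"
      "{b. f b \<noteq> \<zero>\<^bsub>R\<^esub>} \<union> {b. g b \<noteq> \<zero>\<^bsub>R\<^esub>} \<subseteq> B"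
      using that by (auto simp: free_module_def)
    ultimately have "finite {b. f b \<oplus>\<^bsub>R\<^esub> g b \<noteq> \<zero>\<^bsub>R\<^esub>} \<and> {b. f b \<oplus>\<^bsub>R\<^esub> g b \<noteq> \<zero>\<^bsub>R\<^esub>} \<subseteq> B"
      by (meson finite_subset subset_trans)
    moreover have "range (\<lambda>b. f b \<oplus>\<^bsub>R\<^esub> g b) \<subseteq> carrier R" using that by (auto simp: free_module_def)
    ultimately show ?thesis by (simp add: free_module_def)
  qed
  have sm: "(\<lambda>b. a \<otimes>\<^bsub>R\<^esub> f b) \<in> carrier ?F" if "f \<in> carrier ?F" "a \<in> carrier R" for f a
  proof -
    have "{b. a \<otimes>\<^bsub>R\<^esub> f b \<noteq> \<zero>\<^bsub>R\<^esub>} \<subseteq> {b. f b \<noteq> \<zero>\<^bsub>R\<^esub>}" using that by auto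
    then have "finite {b. a \<otimes>\<^bsub>R\<^esub> f b \<noteq> \<zero>\<^bsub>R\<^esub>} \<and> {b. a \<otimes>\<^bsub>R\<^esub> f b \<noteq> \<zero>\<^bsub>R\<^esub>} \<subseteq> B"
      using that by (auto simp: free_module_def intro: finite_subset)
    moreover have "range (\<lambda>b. a \<otimes>\<^bsub>R\<^esub> f b) \<subseteq> carrier R" using that by (auto simp: free_module_def)
    ultimately show ?thesis by (simp add: free_module_def)
  qed
  have in_R: "f b \<in> carrier R" if "f \<in> carrier ?F" for f b
    using that by (auto simp: free_module_def)
  have ops [simp]: "add ?F = (\<lambda>f g b. f b \<oplus>\<^bsub>R\<^esub> g b)" "zero ?F = (\<lambda>b. \<zero>\<^bsub>R\<^esub>)"
    "smult ?F = (\<lambda>a f b. a \<otimes>\<^bsub>R\<^esub> f b)"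
    by (simp_all add: free_module_def)
  have z: "(\<lambda>b. \<zero>\<^bsub>R\<^esub>) \<in> carrier ?F" by (auto simp: free_module_def)
  have "abelian_group ?F"
  proof (rule abelian_groupI)
    fix f assume f: "f \<in> carrier ?F"
    show "\<exists>g\<in>carrier ?F. g \<oplus>\<^bsub>?F\<^esub> f = \<zero>\<^bsub>?F\<^esub>"
    proof
      show "(\<lambda>b. (\<ominus>\<^bsub>R\<^esub> \<one>\<^bsub>R\<^esub>) \<otimes>\<^bsub>R\<^esub> f b) \<in> carrier ?F" using sm[OF f] by simp
      show "(\<lambda>b. (\<ominus>\<^bsub>R\<^esub> \<one>\<^bsub>R\<^esub>) \<otimes>\<^bsub>R\<^esub> f b) \<oplus>\<^bsub>?F\<^esub> f = \<zero>\<^bsub>?F\<^esub>"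
        using in_R[OF f] by (simp add: l_minus l_neg)
    qed
  qed (use cl z in_R in \<open>auto simp: a_ac fun_eq_iff\<close>)
  moreover have "left_module_axioms R ?F"
    by unfold_locales (use sm in_R in \<open>auto simp: fun_eq_iff l_distr r_distr m_assoc\<close>)
  ultimately show ?thesis by (intro left_module.intro ring_axioms)
qed

lemma free_module_simps [simp]:
  "add (free_module R B) = (\<lambda>f g b. f b \<oplus>\<^bsub>R\<^esub> g b)" "zero (free_module R B) = (\<lambda>b. \<zero>\<^bsub>R\<^esub>)"
  "smult (free_module R B) = (\<lambda>a f b. a \<otimes>\<^bsub>R\<^esub> f b)"
  by (simp_all add: free_module_def)

lemma free_moduleD:
  assumes "f \<in> carrier (free_module R B)"
  shows "f b \<in> carrier R" "finite {b. f b \<noteq> \<zero>\<^bsub>R\<^esub>}" "{b. f b \<noteq> \<zero>\<^bsub>R\<^esub>} \<subseteq> B" "f b \<noteq> \<zero>\<^bsub>R\<^esub> \<Longrightarrow> b \<in> B"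
  using assms by (auto simp: free_module_def)

definition free_unit :: "('r, 'x) ring_scheme \<Rightarrow> 'b \<Rightarrow> 'b \<Rightarrow> 'r" where
  "free_unit R b = (\<lambda>x. if x = b then \<one>\<^bsub>R\<^esub> else \<zero>\<^bsub>R\<^esub>)"

lemma free_unit_closed:
  assumes "ring R" "b \<in> B" shows "free_unit R b \<in> carrier (free_module R B)"
proof -
  interpret ring R by fact
  have "{x. free_unit R b x \<noteq> \<zero>\<^bsub>R\<^esub>} \<subseteq> {b}" by (auto simp: free_unit_def)
  then have "finite {x. free_unit R b x \<noteq> \<zero>\<^bsub>R\<^esub>} \<and> {x. free_unit R b x \<noteq> \<zero>\<^bsub>R\<^esub>} \<subseteq> B"
    using assms(2) by (meson empty_subsetI finite.emptyI finite.insertI finite_subset insert_subset subset_trans)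
  then show ?thesis by (auto simp: free_module_def free_unit_def)
qed

context left_module
begin

lemma lin_ext_eq:
  assumes f: "f \<in> carrier (free_module R B)" and phi: "\<phi> \<in> B \<rightarrow> carrier M"
    and S: "finite S" "{b. f b \<noteq> \<zero>\<^bsub>R\<^esub>} \<subseteq> S" "S \<subseteq> B"
  shows "lin_ext R M \<phi> f = (\<Oplus>\<^bsub>M\<^esub>b\<in>S. f b \<odot>\<^bsub>M\<^esub> \<phi> b)"
  unfolding lin_ext_def
  by (rule M.add.finprod_mono_neutral_cong_left)
    (use S phi free_moduleD[OF f] in \<open>auto simp: Pi_iff subset_iff\<close>)

lemma lin_ext_hom:
  assumes phi: "\<phi> \<in> B \<rightarrow> carrier M"
  shows "lin_ext R M \<phi> \<in> mod_hom R (free_module R B) M"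
proof (rule mod_homI)
  interpret F: left_module R "free_module R B" by (rule left_module_free) (rule R.ring_axioms)
  show "lin_ext R M \<phi> f \<in> carrier M" if "f \<in> carrier (free_module R B)" for f
    unfolding lin_ext_def
    by (rule M.finsum_closed) (use phi free_moduleD[OF that] in \<open>auto simp: Pi_iff\<close>)
  show "lin_ext R M \<phi> (f \<oplus>\<^bsub>free_module R B\<^esub> g) = lin_ext R M \<phi> f \<oplus>\<^bsub>M\<^esub> lin_ext R M \<phi> g"
    if f: "f \<in> carrier (free_module R B)" and g: "g \<in> carrier (free_module R B)" for f g
  proof -
    let ?S = "{b. f b \<noteq> \<zero>\<^bsub>R\<^esub>} \<union> {b. g b \<noteq> \<zero>\<^bsub>R\<^esub>}"
    have S: "finite ?S" "?S \<subseteq> B" using free_moduleD[OF f] free_moduleD[OF g] by auto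
    have phi': "b \<in> ?S \<Longrightarrow> \<phi> b \<in> carrier M" for b using phi S by (meson Pi_mem subsetD)
    have fg: "f \<oplus>\<^bsub>free_module R B\<^esub> g \<in> carrier (free_module R B)" using f g by (rule F.M.a_closed)
    have "lin_ext R M \<phi> (f \<oplus>\<^bsub>free_module R B\<^esub> g)
        = (\<Oplus>\<^bsub>M\<^esub>b\<in>?S. (f \<oplus>\<^bsub>free_module R B\<^esub> g) b \<odot>\<^bsub>M\<^esub> \<phi> b)"
      by (rule lin_ext_eq[OF fg phi S(1) _ S(2)]) auto
    also have "\<dots> = (\<Oplus>\<^bsub>M\<^esub>b\<in>?S. f b \<odot>\<^bsub>M\<^esub> \<phi> b \<oplus>\<^bsub>M\<^esub> g b \<odot>\<^bsub>M\<^esub> \<phi> b)"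
      by (rule M.finsum_cong')
        (use phi' free_moduleD(1)[OF f] free_moduleD(1)[OF g] in \<open>auto simp: smult_l_distr\<close>)
    also have "\<dots> = (\<Oplus>\<^bsub>M\<^esub>b\<in>?S. f b \<odot>\<^bsub>M\<^esub> \<phi> b) \<oplus>\<^bsub>M\<^esub> (\<Oplus>\<^bsub>M\<^esub>b\<in>?S. g b \<odot>\<^bsub>M\<^esub> \<phi> b)"
      by (rule M.finsum_addf) (use phi' free_moduleD(1)[OF f] free_moduleD(1)[OF g] in auto)
    also have "\<dots> = lin_ext R M \<phi> f \<oplus>\<^bsub>M\<^esub> lin_ext R M \<phi> g"
      by (subst (1 2) lin_ext_eq[where S = ?S and B = B]) (use f g phi S in auto)
    finally show ?thesis .
  qed
  show "lin_ext R M \<phi> (a \<odot>\<^bsub>free_module R B\<^esub> f) = a \<odot>\<^bsub>M\<^esub> lin_ext R M \<phi> f"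
    if a: "a \<in> carrier R" and f: "f \<in> carrier (free_module R B)" for a f
  proof -
    let ?S = "{b. f b \<noteq> \<zero>\<^bsub>R\<^esub>}"
    have S: "finite ?S" "?S \<subseteq> B" using free_moduleD[OF f] by auto
    have phi': "b \<in> ?S \<Longrightarrow> \<phi> b \<in> carrier M" for b using phi S by (meson Pi_mem subsetD)
    have af: "a \<odot>\<^bsub>free_module R B\<^esub> f \<in> carrier (free_module R B)" using a f by (rule F.smult_closed)
    have hom: "(\<lambda>x. a \<odot>\<^bsub>M\<^esub> x) \<in> hom (add_monoid M) (add_monoid M)"
      using a by (auto simp: hom_def smult_r_distr)
    have dist: "T \<subseteq> ?S \<Longrightarrow> a \<odot>\<^bsub>M\<^esub> (\<Oplus>\<^bsub>M\<^esub>b\<in>T. f b \<odot>\<^bsub>M\<^esub> \<phi> b) = (\<Oplus>\<^bsub>M\<^esub>b\<in>T. a \<odot>\<^bsub>M\<^esub> (f b \<odot>\<^bsub>M\<^esub> \<phi> b))" if "finite T" for T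
      using that
    proof (induction T)
      case (insert t T)
      have 1: "(\<lambda>b. f b \<odot>\<^bsub>M\<^esub> \<phi> b) \<in> T \<rightarrow> carrier M" "f t \<odot>\<^bsub>M\<^esub> \<phi> t \<in> carrier M"
        using insert phi' free_moduleD(1)[OF f] by auto
      have 2: "(\<lambda>b. a \<odot>\<^bsub>M\<^esub> (f b \<odot>\<^bsub>M\<^esub> \<phi> b)) \<in> T \<rightarrow> carrier M" using 1 a by auto
      show ?case
        using insert 1 2 a M.finsum_closed[OF 1(1)] by (simp add: smult_r_distr)
    qed (use a in auto)
    have "lin_ext R M \<phi> (a \<odot>\<^bsub>free_module R B\<^esub> f)
        = (\<Oplus>\<^bsub>M\<^esub>b\<in>?S. (a \<odot>\<^bsub>free_module R B\<^esub> f) b \<odot>\<^bsub>M\<^esub> \<phi> b)"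
      by (rule lin_ext_eq[OF af phi S(1) _ S(2)]) (use a in auto)
    also have "\<dots> = (\<Oplus>\<^bsub>M\<^esub>b\<in>?S. a \<odot>\<^bsub>M\<^esub> (f b \<odot>\<^bsub>M\<^esub> \<phi> b))"
      by (rule M.finsum_cong') (use phi' a free_moduleD(1)[OF f] in \<open>auto simp: smult_assoc1\<close>)
    also have "\<dots> = a \<odot>\<^bsub>M\<^esub> lin_ext R M \<phi> f"
      using dist[OF S(1)] by (simp add: lin_ext_def)
    finally show ?thesis .
  qed
qed

lemma lin_ext_unit:
  assumes "\<phi> \<in> B \<rightarrow> carrier M" "b \<in> B"
  shows "lin_ext R M \<phi> (free_unit R b) = \<phi> b"
proof -
  have "lin_ext R M \<phi> (free_unit R b) = (\<Oplus>\<^bsub>M\<^esub>x\<in>{b}. free_unit R b x \<odot>\<^bsub>M\<^esub> \<phi> x)"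
    by (rule lin_ext_eq[OF free_unit_closed[OF R.ring_axioms assms(2)] assms(1)])
      (use assms in \<open>auto simp: free_unit_def\<close>)
  then show ?thesis using assms by (simp add: free_unit_def Pi_iff)
qed

lemma hom_free_eq_lin_ext:
  assumes h: "h \<in> mod_hom R (free_module R B) M" and f: "f \<in> carrier (free_module R B)"
  shows "h f = lin_ext R M (\<lambda>b. h (free_unit R b)) f"
proof -
  let ?F = "free_module R B" and ?\<phi> = "\<lambda>b. h (free_unit R b)"
  have F: "left_module R ?F" by (rule left_module_free) (rule R.ring_axioms)
  interpret F: left_module R ?F by fact
  have phi: "?\<phi> \<in> B \<rightarrow> carrier M" by (rule Pi_I) (rule mod_hom_closed[OF h free_unit_closed[OF R.ring_axioms]])
  note L = lin_ext_hom[OF phi]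
  have "\<forall>f\<in>carrier ?F. {b. f b \<noteq> \<zero>\<^bsub>R\<^esub>} \<subseteq> S \<longrightarrow> h f = lin_ext R M ?\<phi> f" if "finite S" for S
    using that
  proof (induction S)
    case empty
    show ?case
    proof (intro ballI impI)
      fix f assume "f \<in> carrier ?F" "{b. f b \<noteq> \<zero>\<^bsub>R\<^esub>} \<subseteq> {}"
      then have "f = \<zero>\<^bsub>?F\<^esub>" by auto
      then show "h f = lin_ext R M ?\<phi> f"
        using mod_hom_zero[OF F left_module_self h] mod_hom_zero[OF F left_module_self L] by metis
    qed
  next
    case (insert s S)
    show ?case
    proof (intro ballI impI)
      fix f assume f: "f \<in> carrier ?F" and sup: "{b. f b \<noteq> \<zero>\<^bsub>R\<^esub>} \<subseteq> insert s S"
      show "h f = lin_ext R M ?\<phi> f"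
      proof (cases "f s = \<zero>\<^bsub>R\<^esub>")
        case True
        then have "{b. f b \<noteq> \<zero>\<^bsub>R\<^esub>} \<subseteq> S" using sup by auto
        then show ?thesis using insert f by blast
      next
        case False
        then have s: "s \<in> B" using free_moduleD[OF f] by auto
        define g where "g = f(s := \<zero>\<^bsub>R\<^esub>)"
        have "{b. g b \<noteq> \<zero>\<^bsub>R\<^esub>} \<subseteq> {b. f b \<noteq> \<zero>\<^bsub>R\<^esub>}" by (auto simp: g_def)
        then have g: "g \<in> carrier ?F" using f
          by (auto simp: free_module_def g_def intro: finite_subset)
        have gS: "{b. g b \<noteq> \<zero>\<^bsub>R\<^esub>} \<subseteq> S" using sup by (auto simp: g_def)
        have u: "free_unit R s \<in> carrier ?F" by (rule free_unit_closed[OF R.ring_axioms s])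
        have a: "f s \<in> carrier R" using free_moduleD[OF f] by auto
        have eq: "f = g \<oplus>\<^bsub>?F\<^esub> (f s \<odot>\<^bsub>?F\<^esub> free_unit R s)"
          using free_moduleD(1)[OF f] by (auto simp: g_def free_unit_def fun_eq_iff)
        have *: "k f = k g \<oplus>\<^bsub>M\<^esub> f s \<odot>\<^bsub>M\<^esub> k (free_unit R s)" if "k \<in> mod_hom R ?F M" for k
        proof -
          have "k f = k (g \<oplus>\<^bsub>?F\<^esub> (f s \<odot>\<^bsub>?F\<^esub> free_unit R s))" using eq by (rule arg_cong)
          also have "\<dots> = k g \<oplus>\<^bsub>M\<^esub> k (f s \<odot>\<^bsub>?F\<^esub> free_unit R s)"
            by (rule mod_hom_add[OF that g F.smult_closed[OF a u]])
          also have "k (f s \<odot>\<^bsub>?F\<^esub> free_unit R s) = f s \<odot>\<^bsub>M\<^esub> k (free_unit R s)"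
            by (rule mod_hom_smult[OF that a u])
          finally show ?thesis .
        qed
        have "h g = lin_ext R M ?\<phi> g" using insert g gS by blast
        then show ?thesis using *[OF h] *[OF L] lin_ext_unit[OF phi s] by simp
      qed
    qed
  qed
  then show ?thesis using f free_moduleD(2)[OF f] by blast
qed

end

lemma hom_free_eqI:
  assumes "left_module R M" "h \<in> mod_hom R (free_module R B) M" "k \<in> mod_hom R (free_module R B) M"
    and "\<And>b. b \<in> B \<Longrightarrow> h (free_unit R b) = k (free_unit R b)"
    and "f \<in> carrier (free_module R B)"
  shows "h f = k f"
proof -
  interpret left_module R M by fact
  have 1: "b \<in> B \<Longrightarrow> k (free_unit R b) \<in> carrier M" for b
    by (rule mod_hom_closed[OF assms(3) free_unit_closed[OF R.ring_axioms]])
  have "lin_ext R M (\<lambda>b. h (free_unit R b)) f = lin_ext R M (\<lambda>b. k (free_unit R b)) f"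
    unfolding lin_ext_def
    by (rule M.finsum_cong') (use 1 assms(4) free_moduleD[OF assms(5)] in auto)
  then show ?thesis
    using hom_free_eq_lin_ext[OF assms(2) assms(5)] hom_free_eq_lin_ext[OF assms(3) assms(5)] by simp
qed

subsection \<open>The canonical free resolution\<close>

lemma free_cover_module: "left_module R M \<Longrightarrow> left_module R (free_cover R M)"
  unfolding free_cover_def by (rule left_module_free) (simp add: left_module_def)

lemma cover_map_hom: "left_module R M \<Longrightarrow> cover_map R M \<in> mod_hom R (free_cover R M) M"
  unfolding free_cover_def cover_map_def by (rule left_module.lin_ext_hom) auto

lemma cover_map_unit:
  "left_module R M \<Longrightarrow> x \<in> carrier M \<Longrightarrow> cover_map R M (free_unit R x) = x"
  unfolding cover_map_def by (rule left_module.lin_ext_unit[where B = "carrier M"]) auto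

lemma cover_map_onto:
  assumes "left_module R M" shows "cover_map R M ` carrier (free_cover R M) = carrier M"
proof -
  have "ring R" using assms by (simp add: left_module_def)
  have "x \<in> cover_map R M ` carrier (free_cover R M)" if "x \<in> carrier M" for x
    using cover_map_unit[OF assms that] free_unit_closed[OF \<open>ring R\<close> that]
    unfolding free_cover_def by (metis imageI)
  then show ?thesis using mod_hom_closed[OF cover_map_hom[OF assms]] by auto
qed

lemma syzygy_module: "left_module R M \<Longrightarrow> left_module R (syzygy R M)"
  unfolding syzygy_def by (intro left_module_kernel free_cover_module cover_map_hom)

lemma carrier_syzygy: "carrier (syzygy R M) = {x \<in> carrier (free_cover R M). cover_map R M x = \<zero>\<^bsub>M\<^esub>}"
  by (simp add: syzygy_def carrier_kernel_module)

lemma syzygy_simps [simp]: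
  "add (syzygy R M) = add (free_cover R M)" "zero (syzygy R M) = zero (free_cover R M)"
  "smult (syzygy R M) = smult (free_cover R M)"
  by (simp_all add: syzygy_def)

lemma syzygy_incl: "f \<in> mod_hom R K (syzygy R M) \<Longrightarrow> f \<in> mod_hom R K (free_cover R M)"
  by (rule mod_homI) (auto dest: mod_hom_closed mod_hom_add mod_hom_smult simp: carrier_syzygy)

lemma syzygy_restrict: "f \<in> mod_hom R (free_cover R M) K \<Longrightarrow> f \<in> mod_hom R (syzygy R M) K"
  by (rule mod_homI) (auto dest: mod_hom_closed mod_hom_add mod_hom_smult simp: carrier_syzygy)

subsection \<open>Projective modules\<close>

lemma lift_free:
  assumes M: "left_module R M" and N: "left_module R N" and g: "g \<in> mod_hom R M N"
    and onto: "g ` carrier M = carrier N" and f: "f \<in> mod_hom R (free_module R B) N"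
  shows "\<exists>h\<in>mod_hom R (free_module R B) M. \<forall>x\<in>carrier (free_module R B). g (h x) = f x"
proof -
  interpret M: left_module R M by fact
  have "\<exists>m\<in>carrier M. g m = f (free_unit R b)" if "b \<in> B" for b
    using mod_hom_closed[OF f free_unit_closed[OF M.R.ring_axioms that]] onto by (metis imageE)
  then obtain m where m: "\<And>b. b \<in> B \<Longrightarrow> m b \<in> carrier M \<and> g (m b) = f (free_unit R b)" by metis
  have mB: "m \<in> B \<rightarrow> carrier M" using m by auto
  have h: "lin_ext R M m \<in> mod_hom R (free_module R B) M" by (rule M.lin_ext_hom[OF mB])
  show ?thesis
  proof (intro bexI[OF _ h] ballI)
    fix x assume x: "x \<in> carrier (free_module R B)"
    show "g (lin_ext R M m x) = f x"
      by (rule hom_free_eqI[OF N mod_hom_comp[OF h g] f _ x])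
        (simp add: M.lin_ext_unit[OF mB] m)
  qed
qed

theorem projective_lift:
  fixes R :: "('r, 'x) ring_scheme" and P :: "('r, 'p) module"
    and M :: "('r, 'm) module" and N :: "('r, 'n) module"
  assumes P: "projective R P" and M: "left_module R M" and N: "left_module R N"
    and g: "g \<in> mod_hom R M N" and f: "f \<in> mod_hom R P N" and onto: "g ` carrier M = carrier N"
  shows "\<exists>h\<in>mod_hom R P M. \<forall>x\<in>carrier P. g (h x) = f x"
proof -
  have lP: "left_module R P" using P by (simp add: projective_def)
  have id: "(\<lambda>x. x) \<in> mod_hom R P P" by (rule mod_homI) auto
  obtain s where s: "s \<in> mod_hom R P (free_cover R P)" "\<forall>x\<in>carrier P. cover_map R P (s x) = x"
    using P[unfolded projective_def, THEN conjunct2, rule_format, OF conjI[OF free_cover_module[OF lP] lP]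
      cover_map_hom[OF lP] id cover_map_onto[OF lP]] by blast
  obtain h where h: "h \<in> mod_hom R (free_cover R P) M"
    "\<forall>x\<in>carrier (free_cover R P). g (h x) = f (cover_map R P x)"
    using lift_free[OF M N g onto mod_hom_comp[OF cover_map_hom[OF lP] f, unfolded free_cover_def],
      folded free_cover_def] by blast
  show ?thesis
    by (rule bexI[OF _ mod_hom_comp[OF s(1) h(1)]]) (use s h mod_hom_closed[OF s(1)] in auto)
qed

subsection \<open>\<open>Ext\<^sup>1\<close> is a group, and a criterion for its vanishing\<close>

lemma Hom_group_carrier: "f \<in> carrier (Hom_group R M A) \<longleftrightarrow> f \<in> mod_hom R M A \<and> f \<in> extensional (carrier M)"
  by (simp add: Hom_group_def)

lemma mod_hom_restrict:
  assumes M: "left_module R M" and f: "f \<in> mod_hom R M A"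
  shows "(\<lambda>x\<in>carrier M. f x) \<in> mod_hom R M A"
proof -
  interpret left_module R M by fact
  show ?thesis
    by (rule mod_homI) (simp_all add: mod_hom_closed[OF f] mod_hom_add[OF f] mod_hom_smult[OF f])
qed

lemma Hom_group_comm_group:
  assumes M: "left_module R M" and A: "left_module R A"
  shows "comm_group (Hom_group R M A)"
proof -
  interpret M: left_module R M by fact
  interpret A: left_module R A by fact
  let ?G = "Hom_group R M A"
  have mem: "f \<in> carrier ?G \<longleftrightarrow> f \<in> mod_hom R M A \<and> f \<in> extensional (carrier M)" for f
    by (rule Hom_group_carrier)
  have mult: "f \<otimes>\<^bsub>?G\<^esub> g = (\<lambda>x\<in>carrier M. f x \<oplus>\<^bsub>A\<^esub> g x)" for f g
    by (simp add: Hom_group_def)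
  have one: "\<one>\<^bsub>?G\<^esub> = (\<lambda>x\<in>carrier M. \<zero>\<^bsub>A\<^esub>)" by (simp add: Hom_group_def)
  have restr: "(\<lambda>x\<in>carrier M. f x) \<in> carrier ?G" if "f \<in> mod_hom R M A" for f
    unfolding mem using mod_hom_restrict[OF M that] by simp
  have neg: "(\<lambda>x. (\<ominus>\<^bsub>R\<^esub> \<one>\<^bsub>R\<^esub>) \<odot>\<^bsub>A\<^esub> f x) \<in> mod_hom R M A" if f: "f \<in> mod_hom R M A" for f
  proof (rule mod_homI)
    fix a x assume a: "a \<in> carrier R" and x: "x \<in> carrier M"
    have fx: "f x \<in> carrier A" using mod_hom_closed[OF f x] .
    have "(\<ominus>\<^bsub>R\<^esub> \<one>\<^bsub>R\<^esub>) \<odot>\<^bsub>A\<^esub> (a \<odot>\<^bsub>A\<^esub> f x) = ((\<ominus>\<^bsub>R\<^esub> \<one>\<^bsub>R\<^esub>) \<otimes>\<^bsub>R\<^esub> a) \<odot>\<^bsub>A\<^esub> f x"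
      using a fx by (simp add: A.smult_assoc1)
    also have "(\<ominus>\<^bsub>R\<^esub> \<one>\<^bsub>R\<^esub>) \<otimes>\<^bsub>R\<^esub> a = a \<otimes>\<^bsub>R\<^esub> (\<ominus>\<^bsub>R\<^esub> \<one>\<^bsub>R\<^esub>)"
      using a by (simp add: M.R.l_minus M.R.r_minus)
    also have "(a \<otimes>\<^bsub>R\<^esub> (\<ominus>\<^bsub>R\<^esub> \<one>\<^bsub>R\<^esub>)) \<odot>\<^bsub>A\<^esub> f x = a \<odot>\<^bsub>A\<^esub> ((\<ominus>\<^bsub>R\<^esub> \<one>\<^bsub>R\<^esub>) \<odot>\<^bsub>A\<^esub> f x)"
      using a fx by (simp add: A.smult_assoc1)
    finally show "(\<ominus>\<^bsub>R\<^esub> \<one>\<^bsub>R\<^esub>) \<odot>\<^bsub>A\<^esub> f (a \<odot>\<^bsub>M\<^esub> x) = a \<odot>\<^bsub>A\<^esub> ((\<ominus>\<^bsub>R\<^esub> \<one>\<^bsub>R\<^esub>) \<odot>\<^bsub>A\<^esub> f x)"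
      using mod_hom_smult[OF f a x] by simp
  qed (use mod_hom_closed[OF f] mod_hom_add[OF f] in \<open>auto simp: A.smult_r_distr\<close>)
  show ?thesis
  proof (rule comm_groupI)
    fix f g assume f: "f \<in> carrier ?G" and g: "g \<in> carrier ?G"
    have fA: "f x \<in> carrier A" and gA: "g x \<in> carrier A" if "x \<in> carrier M" for x
      using f g that by (auto simp: mem dest: mod_hom_closed)
    have "(\<lambda>x. f x \<oplus>\<^bsub>A\<^esub> g x) \<in> mod_hom R M A"
      using f g fA gA
      by (intro mod_homI) (auto simp: mem mod_hom_add mod_hom_smult A.smult_r_distr A.M.a_ac)
    then show "f \<otimes>\<^bsub>?G\<^esub> g \<in> carrier ?G" unfolding mult by (rule restr)
    show "f \<otimes>\<^bsub>?G\<^esub> g = g \<otimes>\<^bsub>?G\<^esub> f"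
      unfolding mult by (rule restrict_ext) (simp add: fA gA A.M.a_comm)
    fix h assume h: "h \<in> carrier ?G"
    have hA: "h x \<in> carrier A" if "x \<in> carrier M" for x
      using h that by (auto simp: mem dest: mod_hom_closed)
    show "f \<otimes>\<^bsub>?G\<^esub> g \<otimes>\<^bsub>?G\<^esub> h = f \<otimes>\<^bsub>?G\<^esub> (g \<otimes>\<^bsub>?G\<^esub> h)"
      unfolding mult by (rule restrict_ext) (simp add: fA gA hA A.M.a_assoc)
  next
    show "\<one>\<^bsub>?G\<^esub> \<in> carrier ?G" unfolding one by (rule restr) (auto intro!: mod_homI)
  next
    fix f assume f: "f \<in> carrier ?G"
    have fA: "f x \<in> carrier A" if "x \<in> carrier M" for x
      using f that by (auto simp: mem dest: mod_hom_closed)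
    show "\<one>\<^bsub>?G\<^esub> \<otimes>\<^bsub>?G\<^esub> f = f"
      unfolding mult one using f fA by (auto simp: mem fun_eq_iff extensional_def)
    have f': "f \<in> mod_hom R M A" using f by (simp add: mem)
    show "\<exists>g\<in>carrier ?G. g \<otimes>\<^bsub>?G\<^esub> f = \<one>\<^bsub>?G\<^esub>"
    proof (rule bexI[OF _ restr[OF neg[OF f']]])
      have "(\<ominus>\<^bsub>R\<^esub> \<one>\<^bsub>R\<^esub>) \<odot>\<^bsub>A\<^esub> f x \<oplus>\<^bsub>A\<^esub> f x = \<zero>\<^bsub>A\<^esub>" if "x \<in> carrier M" for x
        using A.smult_l_distr[of "\<ominus>\<^bsub>R\<^esub> \<one>\<^bsub>R\<^esub>" "\<one>\<^bsub>R\<^esub>" "f x"] fA[OF that] by (simp add: M.R.l_neg)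
      then show "(\<lambda>x\<in>carrier M. (\<ominus>\<^bsub>R\<^esub> \<one>\<^bsub>R\<^esub>) \<odot>\<^bsub>A\<^esub> f x) \<otimes>\<^bsub>?G\<^esub> f = \<one>\<^bsub>?G\<^esub>"
        unfolding mult one by (intro restrict_ext) simp
    qed
  qed
qed

lemma Hom_group_precomp:
  assumes M: "left_module R M" and K: "left_module R K" and A: "left_module R A"
    and d: "d \<in> mod_hom R K M"
  shows "group_hom (Hom_group R M A) (Hom_group R K A) (\<lambda>f. compose (carrier K) f d)"
proof -
  interpret K: left_module R K by fact
  interpret G: comm_group "Hom_group R M A" by (rule Hom_group_comm_group[OF M A])
  interpret H: comm_group "Hom_group R K A" by (rule Hom_group_comm_group[OF K A])
  have "(\<lambda>f. compose (carrier K) f d) \<in> hom (Hom_group R M A) (Hom_group R K A)"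
  proof (rule homI)
    fix f assume "f \<in> carrier (Hom_group R M A)"
    then have f: "f \<in> mod_hom R M A" by (simp add: Hom_group_carrier)
    show "compose (carrier K) f d \<in> carrier (Hom_group R K A)"
      using mod_hom_restrict[OF K mod_hom_comp[OF d f]] by (simp add: Hom_group_carrier compose_def)
  qed (auto simp: Hom_group_def compose_def mod_hom_closed[OF d] fun_eq_iff)
  then show ?thesis
    by (simp add: group_hom_def group_hom_axioms_def G.is_group H.is_group)
qed

lemma trivial_quotient_iff:
  assumes G: "comm_group G" and Z: "subgroup Z G" and B: "subgroup B G" and BZ: "B \<subseteq> Z"
  shows "comm_group (G\<lparr>carrier := Z\<rparr> Mod B)" "trivial_group (G\<lparr>carrier := Z\<rparr> Mod B) \<longleftrightarrow> Z \<subseteq> B"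
proof -
  interpret G: comm_group G by fact
  let ?Z = "G\<lparr>carrier := Z\<rparr>"
  interpret Z: comm_group ?Z
    using subgroup.subgroup_is_group[OF Z G.is_group]
    by (rule group.group_comm_groupI) (simp add: G.m_comm subgroup.mem_carrier[OF Z])
  have B': "subgroup B ?Z" by (rule G.subgroup_incl[OF B Z BZ])
  interpret N: normal B ?Z by (rule Z.subgroup_imp_normal[OF B'])
  show cg: "comm_group (?Z Mod B)" by (rule Z.abelian_FactGroup[OF B'])
  have gr: "group (?Z Mod B)" by (rule N.factorgroup_is_group)
  show "trivial_group (?Z Mod B) \<longleftrightarrow> Z \<subseteq> B"
  proof
    assume t: "trivial_group (?Z Mod B)"
    show "Z \<subseteq> B"
    proof
      fix z assume z: "z \<in> Z"
      then have "B #>\<^bsub>?Z\<^esub> z \<in> carrier (?Z Mod B)"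
        by (auto simp: FactGroup_def RCOSETS_def)
      then have "B #>\<^bsub>?Z\<^esub> z = B" using t by (simp add: trivial_group_def FactGroup_def)
      moreover have "z \<in> B #>\<^bsub>?Z\<^esub> z" using z by (intro Z.rcos_self[OF _ B']) simp
      ultimately show "z \<in> B" by simp
    qed
  next
    assume "Z \<subseteq> B"
    then have "carrier (?Z Mod B) \<subseteq> {B}"
      using Z.coset_join2[OF _ B'] by (auto simp: FactGroup_def RCOSETS_def)
    then show "trivial_group (?Z Mod B)"
      using gr group.is_monoid[OF gr, THEN monoid.one_closed]
      by (auto simp: trivial_group_def FactGroup_def)
  qed
qed

lemma mod_hom_eq_on_fibres:
  assumes M: "left_module R M" and K: "left_module R K" and A: "left_module R A"
    and d: "d \<in> mod_hom R M K" and f: "f \<in> mod_hom R M A"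
    and zero: "\<And>x. x \<in> carrier M \<Longrightarrow> d x = \<zero>\<^bsub>K\<^esub> \<Longrightarrow> f x = \<zero>\<^bsub>A\<^esub>"
    and x: "x \<in> carrier M" and y: "y \<in> carrier M" and eq: "d x = d y"
  shows "f x = f y"
proof -
  interpret M: left_module R M by fact
  interpret A: left_module R A by fact
  have "f x = f ((x \<ominus>\<^bsub>M\<^esub> y) \<oplus>\<^bsub>M\<^esub> y)"
    using x y by (simp add: a_minus_def M.M.a_assoc M.M.l_neg)
  also have "\<dots> = f (x \<ominus>\<^bsub>M\<^esub> y) \<oplus>\<^bsub>A\<^esub> f y"
    using x y by (intro mod_hom_add[OF f]) auto
  also have "f (x \<ominus>\<^bsub>M\<^esub> y) = \<zero>\<^bsub>A\<^esub>"
    using x y mod_hom_diff_zero[OF M K d x y eq] by (intro zero) auto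
  finally show ?thesis using mod_hom_closed[OF f y] by simp
qed

lemma
  assumes N: "left_module R N" and A: "left_module R A"
  shows Ext1_comm_group: "comm_group (Ext1 R N A)"
    and Ext1_trivial_iff: "trivial_group (Ext1 R N A) \<longleftrightarrow>
      (\<forall>\<kappa>\<in>mod_hom R (syzygy R N) A. \<exists>g\<in>mod_hom R (free_cover R N) A.
         \<forall>x\<in>carrier (syzygy R N). g x = \<kappa> x)"
proof -
  define S1 S2 where "S1 = syzygy R N" and "S2 = syzygy R S1"
  define F0 F1 F2 where "F0 = free_cover R N" and "F1 = free_cover R S1" and "F2 = free_cover R S2"
  define d1 d2 where "d1 = cover_map R S1" and "d2 = cover_map R S2"
  have R: "ring R" using N by (simp add: left_module_def)
  have S1: "left_module R S1" unfolding S1_def by (rule syzygy_module[OF N])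
  have S2: "left_module R S2" unfolding S2_def by (rule syzygy_module[OF S1])
  have F0: "left_module R F0" unfolding F0_def by (rule free_cover_module[OF N])
  have F1: "left_module R F1" unfolding F1_def by (rule free_cover_module[OF S1])
  have F2: "left_module R F2" unfolding F2_def by (rule free_cover_module[OF S2])
  have d1S: "d1 \<in> mod_hom R F1 S1" unfolding d1_def F1_def by (rule cover_map_hom[OF S1])
  have d1: "d1 \<in> mod_hom R F1 F0"
    using syzygy_incl[OF d1S[unfolded S1_def]] unfolding F0_def .
  have d2S: "d2 \<in> mod_hom R F2 S2" unfolding d2_def F2_def by (rule cover_map_hom[OF S2])
  have d2: "d2 \<in> mod_hom R F2 F1"
    using syzygy_incl[OF d2S[unfolded S2_def]] unfolding F1_def .
  have onto2: "d2 ` carrier F2 = carrier S2"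
    unfolding d2_def F2_def by (rule cover_map_onto[OF S2])
  have S2_eq: "carrier S2 = {x \<in> carrier F1. d1 x = \<zero>\<^bsub>S1\<^esub>}"
    unfolding S2_def F1_def d1_def by (rule carrier_syzygy)
  interpret G1: comm_group "Hom_group R F1 A" by (rule Hom_group_comm_group[OF F1 A])
  interpret h1: group_hom "Hom_group R F0 A" "Hom_group R F1 A" "\<lambda>f. compose (carrier F1) f d1"
    by (rule Hom_group_precomp[OF F0 F1 A d1])
  interpret h2: group_hom "Hom_group R F1 A" "Hom_group R F2 A" "\<lambda>f. compose (carrier F2) f d2"
    by (rule Hom_group_precomp[OF F1 F2 A d2])
  define Z B where "Z = kernel (Hom_group R F1 A) (Hom_group R F2 A) (\<lambda>f. compose (carrier F2) f d2)"
    and "B = (\<lambda>f. compose (carrier F1) f d1) ` carrier (Hom_group R F0 A)"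
  have Ext: "Ext1 R N A = (Hom_group R F1 A)\<lparr>carrier := Z\<rparr> Mod B"
    by (simp add: Ext1_def Let_def Z_def B_def F0_def F1_def F2_def d1_def d2_def S1_def S2_def)
  have Z_iff: "f \<in> Z \<longleftrightarrow> f \<in> mod_hom R F1 A \<and> f \<in> extensional (carrier F1) \<and> (\<forall>x\<in>carrier S2. f x = \<zero>\<^bsub>A\<^esub>)" for f
  proof -
    have "compose (carrier F2) f d2 = (\<lambda>x\<in>carrier F2. \<zero>\<^bsub>A\<^esub>) \<longleftrightarrow> (\<forall>x\<in>carrier F2. f (d2 x) = \<zero>\<^bsub>A\<^esub>)"
      by (auto simp: compose_def fun_eq_iff restrict_def)
    also have "\<dots> \<longleftrightarrow> (\<forall>x\<in>carrier S2. f x = \<zero>\<^bsub>A\<^esub>)" unfolding onto2[symmetric] by auto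
    finally show ?thesis by (simp add: Z_def kernel_def Hom_group_def)
  qed
  have subZ: "subgroup Z (Hom_group R F1 A)" unfolding Z_def by (rule h2.subgroup_kernel)
  have subB: "subgroup B (Hom_group R F1 A)" unfolding B_def by (rule h1.img_is_subgroup)
  have S1_zero: "\<zero>\<^bsub>S1\<^esub> = \<zero>\<^bsub>F0\<^esub>" by (simp add: S1_def F0_def)
  have S2F1: "x \<in> carrier F1" "d1 x = \<zero>\<^bsub>F0\<^esub>" if "x \<in> carrier S2" for x
    using that S1_zero by (auto simp: S2_eq)
  have BZ: "B \<subseteq> Z"
  proof
    fix f assume f: "f \<in> B"
    then obtain g where g: "g \<in> carrier (Hom_group R F0 A)" "f = compose (carrier F1) g d1"
      by (auto simp: B_def)
    have "f \<in> carrier (Hom_group R F1 A)" using subB f by (rule subgroup.mem_carrier)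
    moreover have "f x = \<zero>\<^bsub>A\<^esub>" if "x \<in> carrier S2" for x
      using S2F1[OF that] g mod_hom_zero[OF F0 A] by (simp add: Hom_group_carrier compose_def)
    ultimately show "f \<in> Z" by (simp add: Z_iff Hom_group_carrier)
  qed
  note quot = trivial_quotient_iff[OF G1.comm_group_axioms subZ subB BZ]
  show "comm_group (Ext1 R N A)" unfolding Ext by (rule quot(1))
  have unit: "free_unit R x \<in> carrier F1" "d1 (free_unit R x) = x" if "x \<in> carrier S1" for x
    using free_unit_closed[OF R that] cover_map_unit[OF S1 that]
    by (simp_all add: F1_def free_cover_def d1_def)
  have "Z \<subseteq> B \<longleftrightarrow> (\<forall>\<kappa>\<in>mod_hom R S1 A. \<exists>g\<in>mod_hom R F0 A. \<forall>x\<in>carrier S1. g x = \<kappa> x)"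
  proof
    assume ZB: "Z \<subseteq> B"
    show "\<forall>\<kappa>\<in>mod_hom R S1 A. \<exists>g\<in>mod_hom R F0 A. \<forall>x\<in>carrier S1. g x = \<kappa> x"
    proof
      fix \<kappa> assume k: "\<kappa> \<in> mod_hom R S1 A"
      define f where "f = (\<lambda>x\<in>carrier F1. \<kappa> (d1 x))"
      interpret F1: left_module R F1 by (rule F1)
      have "f \<in> mod_hom R F1 A"
        unfolding f_def by (rule mod_hom_restrict[OF F1 mod_hom_comp[OF d1S k]])
      moreover have "f x = \<zero>\<^bsub>A\<^esub>" if "x \<in> carrier S2" for x
        using S2F1[OF that] mod_hom_zero[OF S1 A k] S1_zero by (simp add: f_def)
      ultimately have "f \<in> Z" by (simp add: Z_iff f_def)
      then obtain g where g: "g \<in> carrier (Hom_group R F0 A)" "f = compose (carrier F1) g d1"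
        using ZB by (auto simp: B_def)
      have "g x = \<kappa> x" if "x \<in> carrier S1" for x
      proof -
        have "f (free_unit R x) = \<kappa> x" using unit[OF that] by (simp add: f_def)
        then show ?thesis using unit[OF that] g(2) by (simp add: compose_def)
      qed
      then show "\<exists>g\<in>mod_hom R F0 A. \<forall>x\<in>carrier S1. g x = \<kappa> x"
        using g(1) by (auto simp: Hom_group_carrier)
    qed
  next
    assume ext: "\<forall>\<kappa>\<in>mod_hom R S1 A. \<exists>g\<in>mod_hom R F0 A. \<forall>x\<in>carrier S1. g x = \<kappa> x"
    show "Z \<subseteq> B"
    proof
      fix f assume "f \<in> Z"
      then have f: "f \<in> mod_hom R F1 A" "f \<in> extensional (carrier F1)"
        and f0: "\<And>x. x \<in> carrier F1 \<Longrightarrow> d1 x = \<zero>\<^bsub>S1\<^esub> \<Longrightarrow> f x = \<zero>\<^bsub>A\<^esub>"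
        by (auto simp: Z_iff S2_eq)
      note fib = mod_hom_eq_on_fibres[OF F1 S1 A d1S f(1) f0]
      define \<kappa> where "\<kappa> = (\<lambda>x. f (free_unit R x))"
      interpret S1: left_module R S1 by (rule S1)
      interpret F1: left_module R F1 by (rule F1)
      have k: "\<kappa> \<in> mod_hom R S1 A"
      proof (rule mod_homI)
        fix x y assume x: "x \<in> carrier S1" and y: "y \<in> carrier S1"
        have xy: "x \<oplus>\<^bsub>S1\<^esub> y \<in> carrier S1" using x y by (rule S1.M.a_closed)
        have u: "free_unit R x \<oplus>\<^bsub>F1\<^esub> free_unit R y \<in> carrier F1"
          using unit(1)[OF x] unit(1)[OF y] by (rule F1.M.a_closed)
        have "d1 (free_unit R x \<oplus>\<^bsub>F1\<^esub> free_unit R y) = x \<oplus>\<^bsub>S1\<^esub> y"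
          using mod_hom_add[OF d1S unit(1)[OF x] unit(1)[OF y]] unit(2)[OF x] unit(2)[OF y] by simp
        then have "f (free_unit R (x \<oplus>\<^bsub>S1\<^esub> y)) = f (free_unit R x \<oplus>\<^bsub>F1\<^esub> free_unit R y)"
          using unit[OF xy] u by (intro fib) simp_all
        also have "\<dots> = f (free_unit R x) \<oplus>\<^bsub>A\<^esub> f (free_unit R y)"
          by (rule mod_hom_add[OF f(1) unit(1)[OF x] unit(1)[OF y]])
        finally show "\<kappa> (x \<oplus>\<^bsub>S1\<^esub> y) = \<kappa> x \<oplus>\<^bsub>A\<^esub> \<kappa> y" by (simp add: \<kappa>_def)
      next
        fix a x assume a: "a \<in> carrier R" and x: "x \<in> carrier S1"
        have ax: "a \<odot>\<^bsub>S1\<^esub> x \<in> carrier S1" using a x by (rule S1.smult_closed)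
        have u: "a \<odot>\<^bsub>F1\<^esub> free_unit R x \<in> carrier F1" using a unit(1)[OF x] by (rule F1.smult_closed)
        have "d1 (a \<odot>\<^bsub>F1\<^esub> free_unit R x) = a \<odot>\<^bsub>S1\<^esub> x"
          using mod_hom_smult[OF d1S a unit(1)[OF x]] unit(2)[OF x] by simp
        then have "f (free_unit R (a \<odot>\<^bsub>S1\<^esub> x)) = f (a \<odot>\<^bsub>F1\<^esub> free_unit R x)"
          using unit[OF ax] u by (intro fib) simp_all
        also have "\<dots> = a \<odot>\<^bsub>A\<^esub> f (free_unit R x)"
          by (rule mod_hom_smult[OF f(1) a unit(1)[OF x]])
        finally show "\<kappa> (a \<odot>\<^bsub>S1\<^esub> x) = a \<odot>\<^bsub>A\<^esub> \<kappa> x" by (simp add: \<kappa>_def)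
      qed (auto simp: \<kappa>_def intro: mod_hom_closed[OF f(1)] unit(1))
      obtain g where g: "g \<in> mod_hom R F0 A" "\<And>x. x \<in> carrier S1 \<Longrightarrow> g x = \<kappa> x" using ext k by blast
      define g' where "g' = (\<lambda>x\<in>carrier F0. g x)"
      interpret F0: left_module R F0 by (rule F0)
      have "g' \<in> carrier (Hom_group R F0 A)"
        using mod_hom_restrict[OF F0 g(1)] by (simp add: g'_def Hom_group_carrier)
      moreover have "f = compose (carrier F1) g' d1"
      proof (rule extensionalityI[OF f(2) compose_extensional])
        fix x assume x: "x \<in> carrier F1"
        have y: "d1 x \<in> carrier S1" by (rule mod_hom_closed[OF d1S x])
        have "f x = f (free_unit R (d1 x))"
          using unit[OF y] x by (intro fib) simp_all
        also have "\<dots> = g (d1 x)" using g(2)[OF y] by (simp add: \<kappa>_def)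
        finally show "f x = compose (carrier F1) g' d1 x"
          using x mod_hom_closed[OF d1 x] by (simp add: compose_def g'_def)
      qed
      ultimately show "f \<in> B" by (auto simp: B_def)
    qed
  qed
  then show "trivial_group (Ext1 R N A) \<longleftrightarrow>
      (\<forall>\<kappa>\<in>mod_hom R (syzygy R N) A. \<exists>g\<in>mod_hom R (free_cover R N) A.
         \<forall>x\<in>carrier (syzygy R N). g x = \<kappa> x)"
    unfolding Ext quot(2) S1_def F0_def .
qed

subsection \<open>Independence of the underlying type\<close>

lemma free_cover_eqI:
  assumes "left_module R M" "h \<in> mod_hom R (free_cover R N) M" "k \<in> mod_hom R (free_cover R N) M"
    and "\<And>b. b \<in> carrier N \<Longrightarrow> h (free_unit R b) = k (free_unit R b)"
    and "f \<in> carrier (free_cover R N)"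
  shows "h f = k f"
  using hom_free_eqI[OF assms(1) assms(2,3)[unfolded free_cover_def] assms(4) assms(5)[unfolded free_cover_def]] .

lemma mod_hom_id: "(\<lambda>x. x) \<in> mod_hom R M M"
  by (rule mod_homI) simp_all

lemma Ext1_trivial_iso:
  assumes N: "left_module R N" and N': "left_module R N'" and A: "left_module R A"
    and i: "\<iota> \<in> mod_hom R N N'" and p: "\<pi> \<in> mod_hom R N' N"
    and pi: "\<And>x. x \<in> carrier N \<Longrightarrow> \<pi> (\<iota> x) = x"
    and triv: "trivial_group (Ext1 R N' A)"
  shows "trivial_group (Ext1 R N A)"
  unfolding Ext1_trivial_iff[OF N A]
proof
  fix \<kappa> assume k: "\<kappa> \<in> mod_hom R (syzygy R N) A"
  interpret N: left_module R N by fact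
  interpret N': left_module R N' by fact
  have R: "ring R" using N by (simp add: left_module_def)
  have F: "left_module R (free_cover R N)" by (rule free_cover_module[OF N])
  have F': "left_module R (free_cover R N')" by (rule free_cover_module[OF N'])
  define \<psi> where "\<psi> = lin_ext R (free_cover R N) (\<lambda>b. free_unit R (\<pi> b))"
  define \<rho> where "\<rho> = lin_ext R (free_cover R N') (\<lambda>b. free_unit R (\<iota> b))"
  have psi0: "(\<lambda>b. free_unit R (\<pi> b)) \<in> carrier N' \<rightarrow> carrier (free_cover R N)"
    unfolding free_cover_def using free_unit_closed[OF R mod_hom_closed[OF p]] by blast
  have rho0: "(\<lambda>b. free_unit R (\<iota> b)) \<in> carrier N \<rightarrow> carrier (free_cover R N')"
    unfolding free_cover_def using free_unit_closed[OF R mod_hom_closed[OF i]] by blast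
  have psi: "\<psi> \<in> mod_hom R (free_cover R N') (free_cover R N)"
    unfolding \<psi>_def free_cover_def[of R N'] by (rule left_module.lin_ext_hom[OF F psi0])
  have rho: "\<rho> \<in> mod_hom R (free_cover R N) (free_cover R N')"
    unfolding \<rho>_def free_cover_def[of R N] by (rule left_module.lin_ext_hom[OF F' rho0])
  have psi_u: "\<psi> (free_unit R b) = free_unit R (\<pi> b)" if "b \<in> carrier N'" for b
    unfolding \<psi>_def by (rule left_module.lin_ext_unit[OF F psi0 that])
  have rho_u: "\<rho> (free_unit R b) = free_unit R (\<iota> b)" if "b \<in> carrier N" for b
    unfolding \<rho>_def by (rule left_module.lin_ext_unit[OF F' rho0 that])
  have 1: "\<psi> (\<rho> x) = x" if "x \<in> carrier (free_cover R N)" for x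
    by (rule free_cover_eqI[OF F mod_hom_comp[OF rho psi] mod_hom_id _ that])
      (simp add: rho_u psi_u pi mod_hom_closed[OF i])
  have 2: "cover_map R N (\<psi> x) = \<pi> (cover_map R N' x)" if "x \<in> carrier (free_cover R N')" for x
    by (rule free_cover_eqI[OF N mod_hom_comp[OF psi cover_map_hom[OF N]]
          mod_hom_comp[OF cover_map_hom[OF N'] p] _ that])
      (simp add: psi_u cover_map_unit[OF N] cover_map_unit[OF N'] mod_hom_closed[OF p])
  have 3: "cover_map R N' (\<rho> x) = \<iota> (cover_map R N x)" if "x \<in> carrier (free_cover R N)" for x
    by (rule free_cover_eqI[OF N' mod_hom_comp[OF rho cover_map_hom[OF N']]
          mod_hom_comp[OF cover_map_hom[OF N] i] _ that])
      (simp add: rho_u cover_map_unit[OF N] cover_map_unit[OF N'] mod_hom_closed[OF i])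
  have psi_S: "\<psi> \<in> mod_hom R (syzygy R N') (syzygy R N)"
  proof (rule mod_homI)
    fix x assume "x \<in> carrier (syzygy R N')"
    then show "\<psi> x \<in> carrier (syzygy R N)"
      using mod_hom_closed[OF psi] 2 mod_hom_zero[OF N' N p] by (simp add: carrier_syzygy)
  qed (auto simp: carrier_syzygy mod_hom_add[OF psi] mod_hom_smult[OF psi])
  obtain g where g: "g \<in> mod_hom R (free_cover R N') A"
    "\<And>x. x \<in> carrier (syzygy R N') \<Longrightarrow> g x = \<kappa> (\<psi> x)"
    using triv[unfolded Ext1_trivial_iff[OF N' A], rule_format, OF mod_hom_comp[OF psi_S k]] by blast
  show "\<exists>g\<in>mod_hom R (free_cover R N) A. \<forall>x\<in>carrier (syzygy R N). g x = \<kappa> x"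
  proof (rule bexI[OF _ mod_hom_comp[OF rho g(1)]], rule ballI)
    fix x assume x: "x \<in> carrier (syzygy R N)"
    then have xF: "x \<in> carrier (free_cover R N)" by (simp add: carrier_syzygy)
    have "\<rho> x \<in> carrier (syzygy R N')"
      using x mod_hom_closed[OF rho xF] 3[OF xF] mod_hom_zero[OF N N' i] by (simp add: carrier_syzygy)
    then show "g (\<rho> x) = \<kappa> x" using g(2) 1[OF xF] by simp
  qed
qed

theorem absolutely_pure_Ext1:
  fixes R :: "('r, 'x) ring_scheme" and N :: "('r, 'n) module"
  assumes AP: "absolutely_pure R A" and fp: "finitely_presented R N"
  shows "trivial_group (Ext1 R N A)"
proof -
  have A: "left_module R A" using AP by (simp add: absolutely_pure_def)
  have N: "left_module R N" using fp by (simp add: finitely_presented_def)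
  interpret N: left_module R N by fact
  obtain n :: nat and \<phi> where phi: "\<phi> \<in> mod_hom R (free_module R {..<n}) N"
    "\<phi> ` carrier (free_module R {..<n}) = carrier N"
    "finitely_generated R (kernel_module (free_module R {..<n}) N \<phi>)"
    using fp by (auto simp: finitely_presented_def)
  let ?F = "free_module R {..<n}"
  define \<iota> where "\<iota> = (\<lambda>x. {f \<in> carrier ?F. \<phi> f = x})"
  define \<pi> where "\<pi> = inv_into (carrier N) \<iota>"
  define N' :: "('r, (nat \<Rightarrow> 'r) set) module" where "N' = \<lparr>carrier = \<iota> ` carrier N, mult = undefined, one = undefined, zero = \<iota> \<zero>\<^bsub>N\<^esub>,
    add = (\<lambda>X Y. \<iota> (\<pi> X \<oplus>\<^bsub>N\<^esub> \<pi> Y)), smult = (\<lambda>a X. \<iota> (a \<odot>\<^bsub>N\<^esub> \<pi> X))\<rparr>"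
  have inj: "inj_on \<iota> (carrier N)"
  proof (rule inj_onI)
    fix x y assume x: "x \<in> carrier N" and eq: "\<iota> x = \<iota> y"
    obtain f where "f \<in> carrier ?F" "\<phi> f = x" using x phi(2) by (metis imageE)
    then have "f \<in> \<iota> x" by (simp add: \<iota>_def)
    then have "f \<in> \<iota> y" using eq by simp
    then show "x = y" using \<open>\<phi> f = x\<close> by (simp add: \<iota>_def)
  qed
  have pi: "\<pi> (\<iota> x) = x" if "x \<in> carrier N" for x
    unfolding \<pi>_def by (rule inv_into_f_f[OF inj that])
  have N'_simps: "carrier N' = \<iota> ` carrier N" "\<zero>\<^bsub>N'\<^esub> = \<iota> \<zero>\<^bsub>N\<^esub>"
    "X \<oplus>\<^bsub>N'\<^esub> Y = \<iota> (\<pi> X \<oplus>\<^bsub>N\<^esub> \<pi> Y)" "a \<odot>\<^bsub>N'\<^esub> X = \<iota> (a \<odot>\<^bsub>N\<^esub> \<pi> X)" for X Y a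
    by (simp_all add: N'_def)
  have "abelian_group N'"
  proof (rule abelian_groupI)
    fix X assume "X \<in> carrier N'"
    then obtain x where x: "x \<in> carrier N" "X = \<iota> x" by (auto simp: N'_simps)
    show "\<exists>Y\<in>carrier N'. Y \<oplus>\<^bsub>N'\<^esub> X = \<zero>\<^bsub>N'\<^esub>"
      by (rule bexI[of _ "\<iota> (\<ominus>\<^bsub>N\<^esub> x)"]) (use x in \<open>auto simp: N'_simps pi N.M.l_neg\<close>)
  qed (auto simp: N'_simps pi N.M.a_ac)
  moreover have "left_module_axioms R N'"
    by unfold_locales
      (auto simp: N'_simps pi N.smult_l_distr N.smult_r_distr N.smult_assoc1)
  ultimately have N': "left_module R N'" by (intro left_module.intro N.R.ring_axioms)
  have i: "\<iota> \<in> mod_hom R N N'" by (rule mod_homI) (auto simp: N'_simps pi)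
  have p: "\<pi> \<in> mod_hom R N' N" by (rule mod_homI) (auto simp: N'_simps pi)
  have i0: "\<iota> x = \<zero>\<^bsub>N'\<^esub> \<longleftrightarrow> x = \<zero>\<^bsub>N\<^esub>" if "x \<in> carrier N" for x
    using inj_on_eq_iff[OF inj that N.M.zero_closed] by (simp add: N'_simps)
  have "(\<lambda>f. \<iota> (\<phi> f)) \<in> mod_hom R ?F N'" by (rule mod_hom_comp[OF phi(1) i])
  moreover have "(\<lambda>f. \<iota> (\<phi> f)) ` carrier ?F = carrier N'"
    using phi(2) by (simp add: N'_simps flip: image_image)
  moreover have "kernel_module ?F N' (\<lambda>f. \<iota> (\<phi> f)) = kernel_module ?F N \<phi>"
  proof -
    have "a_kernel ?F N' (\<lambda>f. \<iota> (\<phi> f)) = a_kernel ?F N \<phi>"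
      using i0 mod_hom_closed[OF phi(1)] by (auto simp: a_kernel_def')
    then show ?thesis by (simp add: kernel_module_def)
  qed
  ultimately have "finitely_presented R N'"
    unfolding finitely_presented_def using N' phi(3) by metis
  then have triv: "trivial_group (Ext1 R N' A)" using AP by (simp add: absolutely_pure_def)
  show ?thesis by (rule Ext1_trivial_iso[OF N N' A i p _ triv]) (rule pi)
qed

end

theory Submission
  imports Defs
begin

text \<open>
  By dimension shifting it suffices to extend every map \<open>\<phi>\<close> from the cycles \<open>Z\<^sub>m P\<close> to \<open>A\<close> to all of \<open>P\<^sub>m\<close>.
  Starting from \<open>\<phi>\<close> one builds a coresolution \<open>A \<rightarrow> X\<^sub>1 \<rightarrow> X\<^sub>2 \<rightarrow> \<dots>\<close> by absolutely pure modules with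
  absolutely pure cycles, together with a chain map from \<open>P\<^sub>m \<rightarrow> P\<^sub>m\<^sub>-\<^sub>1 \<rightarrow> \<dots>\<close> to \<open>X\<^sub>1 \<rightarrow> X\<^sub>2 \<rightarrow> \<dots>\<close> that
  extends \<open>\<phi>\<close>: absolute purity extends every finite part of \<open>\<phi>\<close>, so \<open>\<phi>\<close> extends to a map into a reduced
  power of \<open>A\<close>, and coherence makes the cokernels absolutely pure again. A null homotopy of this
  chain map yields the extension of \<open>\<phi>\<close>.

  For the null homotopy, \<open>P\<close> may be replaced by a complex of free modules, no longer exact. A partial
  null homotopy lives on a set of basis elements closed under the differential. Adding
  one basis element enlarges this set by finitely many elements in each degree, and over a
  coherent ring the extension problem for a complex of finite free modules is solved degree by degree.
\<close>

section \<open>Homomorphisms, quotients and extension problems\<close>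

text \<open>The kernel of the map from P_m onto Z_n P is Z_m P for m = n + 1; hence the extension
  problem. Enlarging Z_m P by one element at a time fails: the scalars that carry the new element
  into the submodule reached so far need not form a finitely generated ideal, and absolute purity
  then gives nothing. Nor do the extensions of finite parts of \<open>\<phi>\<close> fit together,
  as they are not unique. A homotopy avoids both obstacles: on cycles only its component in degree m
  is visible, and the obstruction to enlarging its domain lives on finite free modules, where
  kernels are finitely generated. The whole tail P_m, P_{m-1}, ... must be treated at once, because
  the differential of a basis element involves basis elements of the next degree, which have to be
  added too. Exactness of P enters in the chain map, where a map on boundaries becomes a map on the
  next cycles. As reduced powers are formed infinitely often, the coresolution needs a type that
  contains a copy of its own power.\<close>

declare free_module_simps [simp del]

lemma mod_hom_plus:
  assumes "left_module R A" "f \<in> mod_hom R M A" "g \<in> mod_hom R M A" "left_module R M"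
  shows "(\<lambda>x. f x \<oplus>\<^bsub>A\<^esub> g x) \<in> mod_hom R M A"
proof -
  interpret A: left_module R A by fact
  interpret M: left_module R M by fact
  note cl = mod_hom_closed[OF assms(2)] mod_hom_closed[OF assms(3)]
  show ?thesis
    by (rule mod_homI)
      (simp_all add: cl mod_hom_add[OF assms(2)] mod_hom_add[OF assms(3)] mod_hom_smult[OF assms(2)]
        mod_hom_smult[OF assms(3)] A.smult_r_distr A.M.a_ac)
qed

lemma (in left_module) smult_minus_one:
  "x \<in> carrier M \<Longrightarrow> \<ominus>\<^bsub>M\<^esub> x = (\<ominus>\<^bsub>R\<^esub> \<one>\<^bsub>R\<^esub>) \<odot>\<^bsub>M\<^esub> x"
proof -
  assume x: "x \<in> carrier M"
  have "(\<ominus>\<^bsub>R\<^esub> \<one>\<^bsub>R\<^esub>) \<odot>\<^bsub>M\<^esub> x \<oplus>\<^bsub>M\<^esub> x = \<zero>\<^bsub>M\<^esub>"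
    using smult_l_distr[of "\<ominus>\<^bsub>R\<^esub> \<one>\<^bsub>R\<^esub>" "\<one>\<^bsub>R\<^esub>" x] x by (simp add: R.l_neg)
  then show ?thesis using x by (intro M.minus_equality) simp_all
qed

lemma mod_hom_uminus:
  assumes "left_module R M" "left_module R N" "f \<in> mod_hom R M N" "x \<in> carrier M"
  shows "f (\<ominus>\<^bsub>M\<^esub> x) = \<ominus>\<^bsub>N\<^esub> f x"
proof -
  interpret M: left_module R M by fact
  interpret N: left_module R N by fact
  show ?thesis
    using assms(4) mod_hom_closed[OF assms(3,4)]
    by (simp add: M.smult_minus_one N.smult_minus_one mod_hom_smult[OF assms(3)])
qed

lemma mod_hom_diff:
  assumes "left_module R M" "left_module R N" "f \<in> mod_hom R M N" "x \<in> carrier M" "y \<in> carrier M"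
  shows "f (x \<ominus>\<^bsub>M\<^esub> y) = f x \<ominus>\<^bsub>N\<^esub> f y"
proof -
  interpret M: left_module R M by fact
  interpret N: left_module R N by fact
  show ?thesis
    using assms by (simp add: a_minus_def mod_hom_add[OF assms(3)] mod_hom_uminus[OF assms(1-3)])
qed

lemma mod_hom_minus:
  assumes "left_module R A" "f \<in> mod_hom R M A" "g \<in> mod_hom R M A" "left_module R M"
  shows "(\<lambda>x. f x \<ominus>\<^bsub>A\<^esub> g x) \<in> mod_hom R M A"
proof -
  interpret A: left_module R A by fact
  interpret M: left_module R M by fact
  note cl = mod_hom_closed[OF assms(2)] mod_hom_closed[OF assms(3)]
  have "(\<lambda>x. \<ominus>\<^bsub>A\<^esub> g x) \<in> mod_hom R M A"
  proof (rule mod_homI)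
    fix a x assume a: "a \<in> carrier R" and x: "x \<in> carrier M"
    have "g (\<ominus>\<^bsub>M\<^esub> (a \<odot>\<^bsub>M\<^esub> x)) = a \<odot>\<^bsub>A\<^esub> g (\<ominus>\<^bsub>M\<^esub> x)"
      using mod_hom_smult[OF assms(3) a, of "\<ominus>\<^bsub>M\<^esub> x"] x a
      by (simp add: M.smult_minus_one M.smult_assoc1[symmetric] A.R.l_minus A.R.r_minus)
    then show "\<ominus>\<^bsub>A\<^esub> g (a \<odot>\<^bsub>M\<^esub> x) = a \<odot>\<^bsub>A\<^esub> (\<ominus>\<^bsub>A\<^esub> g x)"
      using mod_hom_uminus[OF assms(4,1,3)] a x by simp
  qed (simp_all add: cl mod_hom_add[OF assms(3)] A.M.minus_add A.M.a_comm)
  from mod_hom_plus[OF assms(1,2) this assms(4)] show ?thesis by (simp add: a_minus_def)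
qed

lemma mod_hom_const_zero:
  assumes "left_module R A"
  shows "(\<lambda>x. \<zero>\<^bsub>A\<^esub>) \<in> mod_hom R M A"
proof -
  interpret A: left_module R A by fact
  show ?thesis by (rule mod_homI) simp_all
qed

lemma mod_hom_kernelI:
  assumes "f \<in> mod_hom R K M" "\<And>x. x \<in> carrier K \<Longrightarrow> q (f x) = \<zero>\<^bsub>N\<^esub>"
  shows "f \<in> mod_hom R K (kernel_module M N q)"
  using assms
  by (intro mod_homI) (auto simp: carrier_kernel_module mod_hom_closed mod_hom_add mod_hom_smult)

lemma mod_hom_kernelD:
  assumes "f \<in> mod_hom R K (kernel_module M N q)"
  shows "f \<in> mod_hom R K M" "x \<in> carrier K \<Longrightarrow> q (f x) = \<zero>\<^bsub>N\<^esub>"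
  using mod_hom_closed[OF assms] mod_hom_add[OF assms] mod_hom_smult[OF assms]
  by (auto intro!: mod_homI simp: carrier_kernel_module)

lemma mod_hom_kernel_restrict:
  assumes "f \<in> mod_hom R M A"
  shows "f \<in> mod_hom R (kernel_module M N q) A"
  using assms
  by (intro mod_homI) (auto simp: carrier_kernel_module mod_hom_closed mod_hom_add mod_hom_smult)

section \<open>Images, quotients and independence of the chosen cover\<close>

lemma left_module_image:
  assumes M: "left_module R M" and N: "left_module R N" and f: "f \<in> mod_hom R M N"
  shows "left_module R (N\<lparr>carrier := f ` carrier M\<rparr>)"
proof -
  interpret M: left_module R M by fact
  interpret N: left_module R N by fact
  show ?thesis
  proof (rule N.submodule_left_module)
    show "f ` carrier M \<subseteq> carrier N" using mod_hom_closed[OF f] by auto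
    show "\<zero>\<^bsub>N\<^esub> \<in> f ` carrier M"
      using mod_hom_zero[OF M N f] M.M.zero_closed by (metis imageI)
    show "x \<oplus>\<^bsub>N\<^esub> y \<in> f ` carrier M" if "x \<in> f ` carrier M" "y \<in> f ` carrier M" for x y
      using that by (auto simp: mod_hom_add[OF f, symmetric])
    show "a \<odot>\<^bsub>N\<^esub> x \<in> f ` carrier M" if "a \<in> carrier R" "x \<in> f ` carrier M" for a x
      using that by (auto simp: mod_hom_smult[OF f, symmetric])
  qed
qed

lemma factor_through_image:
  assumes M: "left_module R M" and N: "left_module R N" and A: "left_module R A"
    and f: "f \<in> mod_hom R M N" and k: "\<kappa> \<in> mod_hom R M A"
    and ker: "\<And>x. x \<in> carrier M \<Longrightarrow> f x = \<zero>\<^bsub>N\<^esub> \<Longrightarrow> \<kappa> x = \<zero>\<^bsub>A\<^esub>"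
  obtains \<kappa>' where "\<kappa>' \<in> mod_hom R (N\<lparr>carrier := f ` carrier M\<rparr>) A"
    "\<And>x. x \<in> carrier M \<Longrightarrow> \<kappa>' (f x) = \<kappa> x"
proof -
  interpret M: left_module R M by fact
  define \<kappa>' where "\<kappa>' = (\<lambda>y. \<kappa> (inv_into (carrier M) f y))"
  have eq: "\<kappa>' (f x) = \<kappa> x" if "x \<in> carrier M" for x
    unfolding \<kappa>'_def
    by (rule mod_hom_eq_on_fibres[OF M N A f k ker])
      (auto simp: that inv_into_into f_inv_into_f)
  have "\<kappa>' \<in> mod_hom R (N\<lparr>carrier := f ` carrier M\<rparr>) A"
  proof (rule mod_homI)
    fix y assume "y \<in> carrier (N\<lparr>carrier := f ` carrier M\<rparr>)"
    then show "\<kappa>' y \<in> carrier A" using eq mod_hom_closed[OF k] by auto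
  next
    fix y z assume "y \<in> carrier (N\<lparr>carrier := f ` carrier M\<rparr>)" "z \<in> carrier (N\<lparr>carrier := f ` carrier M\<rparr>)"
    then show "\<kappa>' (y \<oplus>\<^bsub>N\<lparr>carrier := f ` carrier M\<rparr>\<^esub> z) = \<kappa>' y \<oplus>\<^bsub>A\<^esub> \<kappa>' z"
      by (auto simp: mod_hom_add[OF f, symmetric] eq mod_hom_add[OF k])
  next
    fix a y assume "a \<in> carrier R" "y \<in> carrier (N\<lparr>carrier := f ` carrier M\<rparr>)"
    then show "\<kappa>' (a \<odot>\<^bsub>N\<lparr>carrier := f ` carrier M\<rparr>\<^esub> y) = a \<odot>\<^bsub>A\<^esub> \<kappa>' y"
      by (auto simp: mod_hom_smult[OF f, symmetric] eq mod_hom_smult[OF k])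
  qed
  then show ?thesis using eq that by blast
qed

lemma hom_to_submodule:
  "f \<in> mod_hom R K M \<Longrightarrow> (\<And>x. x \<in> carrier K \<Longrightarrow> f x \<in> H) \<Longrightarrow> f \<in> mod_hom R K (M\<lparr>carrier := H\<rparr>)"
  by (intro mod_homI) (auto simp: mod_hom_add mod_hom_smult)

text \<open>Cosets are replaced by chosen representatives, so that a quotient of \<open>M\<close> can live on the type of
  \<open>M\<close> itself.\<close>

lemma quotient_exists:
  fixes M :: "('r, 'm) module" and enc :: "'m \<Rightarrow> 'u"
  assumes M: "left_module R M" and K: "left_module R (M\<lparr>carrier := K\<rparr>)" "K \<subseteq> carrier M"
    and enc: "inj enc"
  obtains N :: "('r, 'u) module" and q where "left_module R N" "q \<in> mod_hom R M N"
    "q ` carrier M = carrier N" "\<And>x. x \<in> carrier M \<Longrightarrow> q x = \<zero>\<^bsub>N\<^esub> \<longleftrightarrow> x \<in> K"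
proof -
  interpret M: left_module R M by fact
  interpret K: left_module R "M\<lparr>carrier := K\<rparr>" by fact
  have K0: "\<zero>\<^bsub>M\<^esub> \<in> K" using K.M.zero_closed by simp
  have Kadd: "x \<oplus>\<^bsub>M\<^esub> y \<in> K" if "x \<in> K" "y \<in> K" for x y using K.M.a_closed that by simp
  have Ksm: "a \<odot>\<^bsub>M\<^esub> x \<in> K" if "a \<in> carrier R" "x \<in> K" for a x using K.smult_closed that by simp
  have Kneg: "\<ominus>\<^bsub>M\<^esub> x \<in> K" if "x \<in> K" for x
    using Ksm[of "\<ominus>\<^bsub>R\<^esub> \<one>\<^bsub>R\<^esub>" x] that K(2) by (simp add: M.smult_minus_one subset_iff)
  define rep where "rep x = (SOME y. y \<in> carrier M \<and> x \<ominus>\<^bsub>M\<^esub> y \<in> K)" for x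
  have rep: "rep x \<in> carrier M" "x \<ominus>\<^bsub>M\<^esub> rep x \<in> K" if x: "x \<in> carrier M" for x
  proof -
    have "\<exists>y. y \<in> carrier M \<and> x \<ominus>\<^bsub>M\<^esub> y \<in> K"
      using x K0 M.M.r_neg by (intro exI[of _ x]) (simp add: a_minus_def)
    from someI_ex[OF this] show "rep x \<in> carrier M" "x \<ominus>\<^bsub>M\<^esub> rep x \<in> K"
      by (simp_all add: rep_def)
  qed
  have rep_cong: "rep x = rep y" if "x \<in> carrier M" "y \<in> carrier M" "x \<ominus>\<^bsub>M\<^esub> y \<in> K" for x y
  proof -
    have "x \<ominus>\<^bsub>M\<^esub> z \<in> K \<longleftrightarrow> y \<ominus>\<^bsub>M\<^esub> z \<in> K" if z: "z \<in> carrier M" for z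
    proof
      assume "x \<ominus>\<^bsub>M\<^esub> z \<in> K"
      then have "\<ominus>\<^bsub>M\<^esub> (x \<ominus>\<^bsub>M\<^esub> y) \<oplus>\<^bsub>M\<^esub> (x \<ominus>\<^bsub>M\<^esub> z) \<in> K" using \<open>x \<ominus>\<^bsub>M\<^esub> y \<in> K\<close> Kadd Kneg by blast
      also have "\<ominus>\<^bsub>M\<^esub> (x \<ominus>\<^bsub>M\<^esub> y) \<oplus>\<^bsub>M\<^esub> (x \<ominus>\<^bsub>M\<^esub> z) = y \<ominus>\<^bsub>M\<^esub> z"
        using that \<open>x \<in> carrier M\<close> \<open>y \<in> carrier M\<close>
        by (simp add: a_minus_def M.M.minus_add M.M.a_ac M.M.r_neg2 M.M.r_neg1)
      finally show "y \<ominus>\<^bsub>M\<^esub> z \<in> K" .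
    next
      assume "y \<ominus>\<^bsub>M\<^esub> z \<in> K"
      then have "(x \<ominus>\<^bsub>M\<^esub> y) \<oplus>\<^bsub>M\<^esub> (y \<ominus>\<^bsub>M\<^esub> z) \<in> K" using \<open>x \<ominus>\<^bsub>M\<^esub> y \<in> K\<close> Kadd by blast
      also have "(x \<ominus>\<^bsub>M\<^esub> y) \<oplus>\<^bsub>M\<^esub> (y \<ominus>\<^bsub>M\<^esub> z) = x \<ominus>\<^bsub>M\<^esub> z"
        using that \<open>x \<in> carrier M\<close> \<open>y \<in> carrier M\<close>
        by (simp add: a_minus_def M.M.a_assoc M.M.r_neg1)
      finally show "x \<ominus>\<^bsub>M\<^esub> z \<in> K" .
    qed
    then show ?thesis unfolding rep_def by metis
  qed
  have rep_inj: "x \<ominus>\<^bsub>M\<^esub> y \<in> K" if x: "x \<in> carrier M" and y: "y \<in> carrier M" and "rep x = rep y" for x y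
  proof -
    have "(x \<ominus>\<^bsub>M\<^esub> rep x) \<oplus>\<^bsub>M\<^esub> (\<ominus>\<^bsub>M\<^esub> (y \<ominus>\<^bsub>M\<^esub> rep x)) \<in> K"
      using rep(2)[OF x] rep(2)[OF y] that(3) Kadd Kneg by metis
    also have "(x \<ominus>\<^bsub>M\<^esub> rep x) \<oplus>\<^bsub>M\<^esub> (\<ominus>\<^bsub>M\<^esub> (y \<ominus>\<^bsub>M\<^esub> rep x)) = x \<ominus>\<^bsub>M\<^esub> y"
      using x y rep(1)[OF x] M.M.a_comm[of "\<ominus>\<^bsub>M\<^esub> y" "rep x"]
      by (simp add: a_minus_def M.M.minus_add M.M.a_assoc M.M.r_neg1)
    finally show ?thesis .
  qed
  \<comment> \<open>As \<open>enc\<close> is injective, it may move the representatives to another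
    type: the reduced powers, whose elements are functions, are brought back to the type of A in
    this way.\<close>
  define q where "q = (\<lambda>x. enc (rep x))"
  define p where "p = inv_into (carrier M) q"
  have q_iff: "q x = q y \<longleftrightarrow> x \<ominus>\<^bsub>M\<^esub> y \<in> K" if "x \<in> carrier M" "y \<in> carrier M" for x y
    unfolding q_def inj_eq[OF enc] using rep_cong[OF that] rep_inj[OF that] by (rule iffI[rotated])
  have p: "p (q x) \<in> carrier M" "p (q x) \<ominus>\<^bsub>M\<^esub> x \<in> K" if "x \<in> carrier M" for x
  proof -
    show 1: "p (q x) \<in> carrier M" using that by (simp add: p_def inv_into_into)
    have "q (p (q x)) = q x" using that by (simp add: p_def f_inv_into_f)
    then show "p (q x) \<ominus>\<^bsub>M\<^esub> x \<in> K" using q_iff[OF 1 that] by simp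
  qed
  define N :: "('r, 'u) module" where "N = \<lparr>carrier = q ` carrier M, mult = undefined, one = undefined,
    zero = q \<zero>\<^bsub>M\<^esub>, add = (\<lambda>X Y. q (p X \<oplus>\<^bsub>M\<^esub> p Y)), smult = (\<lambda>a X. q (a \<odot>\<^bsub>M\<^esub> p X))\<rparr>"
  have sub4: "(a \<oplus>\<^bsub>M\<^esub> b) \<ominus>\<^bsub>M\<^esub> (x \<oplus>\<^bsub>M\<^esub> y) = (a \<ominus>\<^bsub>M\<^esub> x) \<oplus>\<^bsub>M\<^esub> (b \<ominus>\<^bsub>M\<^esub> y)"
    if "a \<in> carrier M" "b \<in> carrier M" "x \<in> carrier M" "y \<in> carrier M" for a b x y
    using that by (simp add: a_minus_def M.M.minus_add M.M.a_ac)
  have sm2: "(a \<odot>\<^bsub>M\<^esub> x) \<ominus>\<^bsub>M\<^esub> (a \<odot>\<^bsub>M\<^esub> y) = a \<odot>\<^bsub>M\<^esub> (x \<ominus>\<^bsub>M\<^esub> y)"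
    if "a \<in> carrier R" "x \<in> carrier M" "y \<in> carrier M" for a x y
    using that by (simp add: a_minus_def M.smult_r_distr M.smult_minus_one M.smult_assoc1[symmetric]
        M.R.l_minus M.R.r_minus)
  have addN: "q x \<oplus>\<^bsub>N\<^esub> q y = q (x \<oplus>\<^bsub>M\<^esub> y)" if x: "x \<in> carrier M" and y: "y \<in> carrier M" for x y
  proof -
    have "q (p (q x) \<oplus>\<^bsub>M\<^esub> p (q y)) = q (x \<oplus>\<^bsub>M\<^esub> y)"
      using p[OF x] p[OF y] x y by (subst q_iff) (auto simp: sub4 intro: Kadd)
    then show ?thesis by (simp add: N_def)
  qed
  have smN: "a \<odot>\<^bsub>N\<^esub> q x = q (a \<odot>\<^bsub>M\<^esub> x)" if x: "x \<in> carrier M" and a: "a \<in> carrier R" for x a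
  proof -
    have "q (a \<odot>\<^bsub>M\<^esub> p (q x)) = q (a \<odot>\<^bsub>M\<^esub> x)"
      using p[OF x] x a by (subst q_iff) (auto simp: sm2 intro: Ksm)
    then show ?thesis by (simp add: N_def)
  qed
  have cN: "carrier N = q ` carrier M" and zN: "\<zero>\<^bsub>N\<^esub> = q \<zero>\<^bsub>M\<^esub>" by (simp_all add: N_def)
  have "abelian_group N"
  proof (rule abelian_groupI)
    fix X assume "X \<in> carrier N"
    then obtain x where x: "x \<in> carrier M" "X = q x" by (auto simp: cN)
    show "\<exists>Y\<in>carrier N. Y \<oplus>\<^bsub>N\<^esub> X = \<zero>\<^bsub>N\<^esub>"
      by (rule bexI[of _ "q (\<ominus>\<^bsub>M\<^esub> x)"]) (use x in \<open>auto simp: cN zN addN M.M.l_neg\<close>)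
  qed (auto simp: cN zN addN M.M.a_ac)
  moreover have "left_module_axioms R N"
    by unfold_locales
      (auto simp: cN addN smN M.smult_l_distr M.smult_r_distr M.smult_assoc1)
  ultimately have "left_module R N" by (intro left_module.intro M.R.ring_axioms)
  moreover have "q \<in> mod_hom R M N" by (rule mod_homI) (auto simp: cN addN smN)
  moreover have "q x = \<zero>\<^bsub>N\<^esub> \<longleftrightarrow> x \<in> K" if "x \<in> carrier M" for x
    using q_iff[OF that M.M.zero_closed] that by (simp add: zN a_minus_def M.smult_minus_one[OF M.M.zero_closed])
  ultimately show ?thesis using that cN by simp
qed

text \<open>Schanuel's argument: the extension property depends on N alone as soon as the two
  modules map to each other over N. Since \<open>x - a (b x)\<close> lies in the kernel of
  \<open>q2\<close>, the expression \<open>g (b x) + \<kappa> (x - a (b x))\<close> makes sense on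
  all of \<open>M2\<close>, and on the kernel its terms add up to \<open>\<kappa> x\<close>. This
  links the canonical cover used by \<open>Ext1\<close> with other presentations of N.\<close>

lemma ext_transfer:
  assumes M1: "left_module R M1" and M2: "left_module R M2" and N: "left_module R N"
    and A: "left_module R A"
    and q2: "q2 \<in> mod_hom R M2 N"
    and a: "a \<in> mod_hom R M1 M2" "\<And>x. x \<in> carrier M1 \<Longrightarrow> q2 (a x) = q1 x"
    and b: "b \<in> mod_hom R M2 M1" "\<And>x. x \<in> carrier M2 \<Longrightarrow> q1 (b x) = q2 x"
    and ext: "\<And>\<kappa>. \<kappa> \<in> mod_hom R (kernel_module M1 N q1) A \<Longrightarrow>
      \<exists>g\<in>mod_hom R M1 A. \<forall>x\<in>carrier (kernel_module M1 N q1). g x = \<kappa> x"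
    and k: "\<kappa> \<in> mod_hom R (kernel_module M2 N q2) A"
  shows "\<exists>g\<in>mod_hom R M2 A. \<forall>x\<in>carrier (kernel_module M2 N q2). g x = \<kappa> x"
proof -
  interpret M2: left_module R M2 by fact
  interpret A: left_module R A by fact
  interpret N: left_module R N by fact
  have aK: "a \<in> mod_hom R (kernel_module M1 N q1) (kernel_module M2 N q2)"
    by (rule mod_hom_kernelI[OF mod_hom_kernel_restrict[OF a(1)]]) (auto simp: carrier_kernel_module a(2))
  obtain g where g: "g \<in> mod_hom R M1 A" "\<And>x. x \<in> carrier (kernel_module M1 N q1) \<Longrightarrow> g x = \<kappa> (a x)"
    using ext[OF mod_hom_comp[OF aK k]] by blast
  have ab: "(\<lambda>x. a (b x)) \<in> mod_hom R M2 M2" by (rule mod_hom_comp[OF b(1) a(1)])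
  have diff: "(\<lambda>x. x \<ominus>\<^bsub>M2\<^esub> a (b x)) \<in> mod_hom R M2 (kernel_module M2 N q2)"
  proof (rule mod_hom_kernelI[OF mod_hom_minus[OF M2 mod_hom_id ab M2]])
    fix x assume x: "x \<in> carrier M2"
    then show "q2 (x \<ominus>\<^bsub>M2\<^esub> a (b x)) = \<zero>\<^bsub>N\<^esub>"
      using mod_hom_closed[OF ab] mod_hom_closed[OF b(1)] a(2) b(2) mod_hom_diff_zero[OF M2 N q2]
      by metis
  qed
  have bK: "b x \<in> carrier (kernel_module M1 N q1)" if "x \<in> carrier (kernel_module M2 N q2)" for x
    using that b mod_hom_closed[OF b(1)] by (auto simp: carrier_kernel_module)
  show ?thesis
  proof (rule bexI[OF _ mod_hom_plus[OF A mod_hom_comp[OF b(1) g(1)] mod_hom_comp[OF diff k] M2]], rule ballI)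
    fix x assume x: "x \<in> carrier (kernel_module M2 N q2)"
    then have xM: "x \<in> carrier M2" by (simp add: carrier_kernel_module)
    have abx: "a (b x) \<in> carrier (kernel_module M2 N q2)" by (rule mod_hom_closed[OF aK bK[OF x]])
    have "g (b x) \<oplus>\<^bsub>A\<^esub> \<kappa> (x \<ominus>\<^bsub>M2\<^esub> a (b x)) = \<kappa> (a (b x)) \<oplus>\<^bsub>A\<^esub> \<kappa> (x \<ominus>\<^bsub>M2\<^esub> a (b x))"
      using g(2)[OF bK[OF x]] by simp
    also have "\<dots> = \<kappa> (a (b x) \<oplus>\<^bsub>M2\<^esub> (x \<ominus>\<^bsub>M2\<^esub> a (b x)))"
      using mod_hom_add[OF k abx mod_hom_closed[OF diff xM]] by simp
    also have "a (b x) \<oplus>\<^bsub>M2\<^esub> (x \<ominus>\<^bsub>M2\<^esub> a (b x)) = x"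
      using xM mod_hom_closed[OF ab xM] by (simp add: a_minus_def M2.M.a_ac M2.M.r_neg1 M2.M.r_neg2 M2.M.r_neg)
    finally show "g (b x) \<oplus>\<^bsub>A\<^esub> \<kappa> (x \<ominus>\<^bsub>M2\<^esub> a (b x)) = \<kappa> x" .
  qed
qed

section \<open>Finite free modules over coherent rings\<close>

abbreviation free_pow :: "('r, 'x) ring_scheme \<Rightarrow> nat \<Rightarrow> ('r, nat \<Rightarrow> 'r) module" where
  "free_pow R n \<equiv> free_module R {..<n}"

lemma reindex_finite_free:
  assumes R: "ring R" and B: "finite B"
  obtains n \<theta> \<theta>' where "\<theta> \<in> mod_hom R (free_pow R n) (free_module R B)"
    "\<theta>' \<in> mod_hom R (free_module R B) (free_pow R n)"
    "\<And>x. x \<in> carrier (free_pow R n) \<Longrightarrow> \<theta>' (\<theta> x) = x"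
    "\<And>y. y \<in> carrier (free_module R B) \<Longrightarrow> \<theta> (\<theta>' y) = y"
proof -
  obtain h where "bij_betw h {0..<card B} B" using ex_bij_betw_nat_finite[OF B] by blast
  then have h: "bij_betw h {..<card B} B" by (simp add: lessThan_atLeast0)
  define n where "n = card B"
  define k where "k = inv_into {..<n} h"
  have hB: "h i \<in> B" and kh: "k (h i) = i" if "i \<in> {..<n}" for i
    using h that by (auto simp: n_def k_def bij_betw_def)
  have kn: "k b \<in> {..<n}" and hk: "h (k b) = b" if "b \<in> B" for b
    using h that by (auto simp: n_def k_def bij_betw_def f_inv_into_f inv_into_into
        simp del: lessThan_iff)
  have FB: "left_module R (free_module R B)" and Fn: "left_module R (free_pow R n)"
    by (rule left_module_free[OF R])+
  have 1: "(\<lambda>i. free_unit R (h i)) \<in> {..<n} \<rightarrow> carrier (free_module R B)"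
    using free_unit_closed[OF R hB] by blast
  have 2: "(\<lambda>b. free_unit R (k b)) \<in> B \<rightarrow> carrier (free_pow R n)"
    using free_unit_closed[OF R kn] by blast
  note h1 = left_module.lin_ext_hom[OF FB 1] and h2 = left_module.lin_ext_hom[OF Fn 2]
  show ?thesis
  proof (rule that[OF h1 h2])
    fix x assume x: "x \<in> carrier (free_pow R n)"
    show "lin_ext R (free_pow R n) (\<lambda>b. free_unit R (k b))
        (lin_ext R (free_module R B) (\<lambda>i. free_unit R (h i)) x) = x"
      by (rule hom_free_eqI[OF Fn mod_hom_comp[OF h1 h2] mod_hom_id _ x])
        (simp add: left_module.lin_ext_unit[OF FB 1] left_module.lin_ext_unit[OF Fn 2] hB kh del: lessThan_iff)
  next
    fix x assume x: "x \<in> carrier (free_module R B)"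
    show "lin_ext R (free_module R B) (\<lambda>i. free_unit R (h i))
        (lin_ext R (free_pow R n) (\<lambda>b. free_unit R (k b)) x) = x"
      by (rule hom_free_eqI[OF FB mod_hom_comp[OF h2 h1] mod_hom_id _ x])
        (simp add: left_module.lin_ext_unit[OF FB 1] left_module.lin_ext_unit[OF Fn 2] kn hk del: lessThan_iff)
  qed
qed

lemma free_module_incl:
  assumes "B \<subseteq> C" shows "(\<lambda>f. f) \<in> mod_hom R (free_module R B) (free_module R C)"
  by (rule mod_homI) (use assms in \<open>auto simp: free_module_def\<close>)

lemma free_restrict_hom:
  assumes "ring R"
  shows "(\<lambda>f c. if c \<in> U then f c else \<zero>\<^bsub>R\<^esub>) \<in> mod_hom R (free_module R B) (free_module R U)"
proof (rule mod_homI)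
  interpret ring R by fact
  fix f assume f: "f \<in> carrier (free_module R B)"
  have "{c. (if c \<in> U then f c else \<zero>\<^bsub>R\<^esub>) \<noteq> \<zero>\<^bsub>R\<^esub>} \<subseteq> {c. f c \<noteq> \<zero>\<^bsub>R\<^esub>}" by auto
  then have "finite {c. (if c \<in> U then f c else \<zero>\<^bsub>R\<^esub>) \<noteq> \<zero>\<^bsub>R\<^esub>}"
    using free_moduleD(2)[OF f] finite_subset by blast
  then show "(\<lambda>c. if c \<in> U then f c else \<zero>\<^bsub>R\<^esub>) \<in> carrier (free_module R U)"
    using free_moduleD(1)[OF f] by (auto simp: free_module_def)
  show "(\<lambda>c. if c \<in> U then (f \<oplus>\<^bsub>free_module R B\<^esub> g) c else \<zero>\<^bsub>R\<^esub>)
      = (\<lambda>c. if c \<in> U then f c else \<zero>\<^bsub>R\<^esub>) \<oplus>\<^bsub>free_module R U\<^esub> (\<lambda>c. if c \<in> U then g c else \<zero>\<^bsub>R\<^esub>)" for g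
    by (auto simp: free_module_simps)
  show "(\<lambda>c. if c \<in> U then (a \<odot>\<^bsub>free_module R B\<^esub> f) c else \<zero>\<^bsub>R\<^esub>)
      = a \<odot>\<^bsub>free_module R U\<^esub> (\<lambda>c. if c \<in> U then f c else \<zero>\<^bsub>R\<^esub>)" if "a \<in> carrier R" for a
    using that by (auto simp: free_module_simps)
qed

text \<open>With \<open>Inl\<close> or \<open>Inr\<close> as \<open>h\<close> this is a projection
  from the free module on a disjoint sum, which serves as the direct sum of two free modules;
  \<open>case_sum\<close> assembles an element from its components.\<close>

lemma free_reindex_inj_hom:
  assumes "ring R" "inj h" "h ` B \<subseteq> C" "\<And>c. h c \<in> C \<Longrightarrow> c \<in> B"
  shows "(\<lambda>f b. f (h b)) \<in> mod_hom R (free_module R C) (free_module R B)"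
proof (rule mod_homI)
  fix f assume f: "f \<in> carrier (free_module R C)"
  have "h ` {b. f (h b) \<noteq> \<zero>\<^bsub>R\<^esub>} \<subseteq> {c. f c \<noteq> \<zero>\<^bsub>R\<^esub>}" by auto
  then have "finite {b. f (h b) \<noteq> \<zero>\<^bsub>R\<^esub>}"
    using free_moduleD(2)[OF f] inj_on_subset[OF assms(2)] finite_subset finite_imageD
    by (metis (no_types, lifting) subset_UNIV)
  then show "(\<lambda>b. f (h b)) \<in> carrier (free_module R B)"
    using free_moduleD[OF f] assms(4) by (auto simp: free_module_def)
qed (simp_all add: free_module_simps)

lemma case_sum_free_closed:
  assumes f: "f \<in> carrier (free_module R B)" and g: "g \<in> carrier (free_module R C)"
  shows "case_sum f g \<in> carrier (free_module R (Sum_Type.Plus B C))"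
proof -
  have "{c. case_sum f g c \<noteq> \<zero>\<^bsub>R\<^esub>} = Sum_Type.Plus {b. f b \<noteq> \<zero>\<^bsub>R\<^esub>} {c. g c \<noteq> \<zero>\<^bsub>R\<^esub>}"
  proof (rule Set.set_eqI)
    show "x \<in> {c. case_sum f g c \<noteq> \<zero>\<^bsub>R\<^esub>} \<longleftrightarrow> x \<in> Sum_Type.Plus {b. f b \<noteq> \<zero>\<^bsub>R\<^esub>} {c. g c \<noteq> \<zero>\<^bsub>R\<^esub>}" for x
      by (cases x) auto
  qed
  then show ?thesis
    using free_moduleD[OF f] free_moduleD[OF g]
    by (auto simp: free_module_def split: sum.splits)
qed

section \<open>Finitely generated modules as images of finite free modules\<close>

lemma image_of_finite_free:
  assumes R: "ring R" and B: "finite B" and M: "left_module R M" and f: "f \<in> mod_hom R (free_module R B) M"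
  obtains n g where "g \<in> mod_hom R (free_pow R n) M"
    "g ` carrier (free_pow R n) = f ` carrier (free_module R B)"
proof -
  obtain n \<theta> \<theta>' where th: "\<theta> \<in> mod_hom R (free_pow R n) (free_module R B)"
    "\<theta>' \<in> mod_hom R (free_module R B) (free_pow R n)"
    "\<And>y. y \<in> carrier (free_module R B) \<Longrightarrow> \<theta> (\<theta>' y) = y"
    using reindex_finite_free[OF R B] by metis
  have "(\<lambda>x. f (\<theta> x)) ` carrier (free_pow R n) = f ` carrier (free_module R B)"
    using mod_hom_closed[OF th(1)] mod_hom_closed[OF th(2)] th(3) by (force simp: image_iff)
  with mod_hom_comp[OF th(1) f] show ?thesis by (rule that)
qed

lemma finitely_generated_imageD:
  assumes "finitely_generated R K"
  obtains n g where "g \<in> mod_hom R (free_pow R n) K" "g ` carrier (free_pow R n) = carrier K"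
proof -
  have K: "left_module R K" using assms by (simp add: finitely_generated_def)
  interpret K: left_module R K by fact
  obtain S where S: "finite S" "S \<subseteq> carrier K"
    "\<And>x. x \<in> carrier K \<Longrightarrow> \<exists>c\<in>S \<rightarrow> carrier R. x = (\<Oplus>\<^bsub>K\<^esub>s\<in>S. c s \<odot>\<^bsub>K\<^esub> s)"
    using assms by (auto simp: finitely_generated_def)
  have phi: "(\<lambda>x. x) \<in> S \<rightarrow> carrier K" using S(2) by auto
  let ?L = "lin_ext R K (\<lambda>x. x)"
  have L: "?L \<in> mod_hom R (free_module R S) K" by (rule K.lin_ext_hom[OF phi])
  have "?L ` carrier (free_module R S) = carrier K"
  proof
    show "?L ` carrier (free_module R S) \<subseteq> carrier K" using mod_hom_closed[OF L] by auto
    show "carrier K \<subseteq> ?L ` carrier (free_module R S)"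
    proof
      fix x assume "x \<in> carrier K"
      then obtain c where c: "c \<in> S \<rightarrow> carrier R" "x = (\<Oplus>\<^bsub>K\<^esub>s\<in>S. c s \<odot>\<^bsub>K\<^esub> s)" using S(3) by blast
      define f where "f = (\<lambda>s. if s \<in> S then c s else \<zero>\<^bsub>R\<^esub>)"
      have supp: "{s. f s \<noteq> \<zero>\<^bsub>R\<^esub>} \<subseteq> S" by (auto simp: f_def)
      then have f: "f \<in> carrier (free_module R S)"
        using c(1) S(1) by (auto simp: free_module_def f_def intro: finite_subset)
      have "?L f = (\<Oplus>\<^bsub>K\<^esub>s\<in>S. f s \<odot>\<^bsub>K\<^esub> s)"
        by (rule K.lin_ext_eq[OF f phi S(1) supp]) simp
      also have "\<dots> = x" unfolding c(2)
        by (rule K.M.finsum_cong') (use c(1) S(2) in \<open>auto simp: f_def Pi_iff subset_iff\<close>)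
      finally show "x \<in> ?L ` carrier (free_module R S)" using f by blast
    qed
  qed
  then show ?thesis using image_of_finite_free[OF K.R.ring_axioms S(1) K L] that by metis
qed

lemma finitely_generated_imageI:
  assumes M: "left_module R M" and f: "f \<in> mod_hom R (free_pow R n) M"
  shows "finitely_generated R (M\<lparr>carrier := f ` carrier (free_pow R n)\<rparr>)"
proof -
  interpret M: left_module R M by fact
  have Fn: "left_module R (free_pow R n)" by (rule left_module_free[OF M.R.ring_axioms])
  define K where "K = M\<lparr>carrier := f ` carrier (free_pow R n)\<rparr>"
  have K: "left_module R K" unfolding K_def by (rule left_module_image[OF Fn M f])
  interpret K: left_module R K by fact
  have fK: "f \<in> mod_hom R (free_pow R n) K" unfolding K_def by (rule hom_to_submodule[OF f]) simp
  define S where "S = (\<lambda>i. f (free_unit R i)) ` {..<n}"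
  have SK: "S \<subseteq> carrier K"
    unfolding S_def using mod_hom_closed[OF fK free_unit_closed[OF M.R.ring_axioms]] by blast
  have phi: "(\<lambda>x. x) \<in> S \<rightarrow> carrier K" using SK by auto
  have FS: "left_module R (free_module R S)" by (rule left_module_free[OF M.R.ring_axioms])
  have psi: "(\<lambda>i. free_unit R (f (free_unit R i))) \<in> {..<n} \<rightarrow> carrier (free_module R S)"
    by (rule Pi_I, rule free_unit_closed[OF M.R.ring_axioms]) (auto simp: S_def)
  \<comment> \<open>Several basis elements may have the same image under \<open>f\<close>, so
    \<open>S\<close> can have fewer than n elements; \<open>?\<sigma>\<close> adds up the
    coefficients that belong to one generator.\<close>
  let ?\<sigma> = "lin_ext R (free_module R S) (\<lambda>i. free_unit R (f (free_unit R i)))"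
  let ?L = "lin_ext R K (\<lambda>x. x)"
  have s: "?\<sigma> \<in> mod_hom R (free_pow R n) (free_module R S)" by (rule left_module.lin_ext_hom[OF FS psi])
  have L: "?L \<in> mod_hom R (free_module R S) K" by (rule K.lin_ext_hom[OF phi])
  have "\<exists>c\<in>S \<rightarrow> carrier R. x = (\<Oplus>\<^bsub>K\<^esub>s\<in>S. c s \<odot>\<^bsub>K\<^esub> s)" if x: "x \<in> carrier K" for x
  proof -
    obtain y where y: "y \<in> carrier (free_pow R n)" "x = f y" using x by (auto simp: K_def)
    have "x = ?L (?\<sigma> y)" unfolding y(2)
      by (rule hom_free_eqI[OF K fK mod_hom_comp[OF s L] _ y(1)])
        (subst left_module.lin_ext_unit[OF FS psi], assumption,
         subst left_module.lin_ext_unit[OF K phi], auto simp: S_def)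
    also have "\<dots> = (\<Oplus>\<^bsub>K\<^esub>s\<in>S. ?\<sigma> y s \<odot>\<^bsub>K\<^esub> s)"
      by (rule K.lin_ext_eq[OF mod_hom_closed[OF s y(1)] phi])
        (use free_moduleD[OF mod_hom_closed[OF s y(1)]] in \<open>auto simp: S_def\<close>)
    finally show ?thesis using free_moduleD(1)[OF mod_hom_closed[OF s y(1)]] by blast
  qed
  then show ?thesis unfolding finitely_generated_def K_def[symmetric]
    using K SK by (intro conjI exI[of _ S]) (auto simp: S_def)
qed

section \<open>Coherence as finite generation of kernels\<close>

lemma left_module_regular:
  assumes "ring R" shows "left_module R (left_regular R)"
proof -
  interpret ring R by fact
  have "abelian_group (left_regular R)"
    by (rule abelian_groupI) (auto simp: left_regular_def a_ac intro: l_neg)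
  moreover have "left_module_axioms R (left_regular R)"
    by unfold_locales (auto simp: left_regular_def l_distr r_distr m_assoc)
  ultimately show ?thesis by (intro left_module.intro ring_axioms)
qed

text \<open>The images of the maps \<open>\<alpha>\<close> are the finitely generated submodules of
  M, and \<open>\<beta>\<close> is a finite system of generators for their relations. Stated for
  every \<open>\<alpha>\<close>, the condition needs no choice of a presentation.\<close>

definition coherent_module :: "('r, 'x) ring_scheme \<Rightarrow> ('r, 'm) module \<Rightarrow> bool" where
  "coherent_module R M \<longleftrightarrow> (\<forall>m. \<forall>\<alpha>\<in>mod_hom R (free_pow R m) M.
     \<exists>p. \<exists>\<beta>\<in>mod_hom R (free_pow R p) (free_pow R m).
       \<beta> ` carrier (free_pow R p) = {x \<in> carrier (free_pow R m). \<alpha> x = \<zero>\<^bsub>M\<^esub>})"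

text \<open>Coherence of R supplies finitely many relations for some presentation
  \<open>\<phi>\<close> of the image of \<open>\<alpha>\<close>, not for \<open>\<alpha>\<close>
  itself. As in Schanuel's lemma, lifts \<open>\<sigma>\<close> and \<open>\<tau>\<close> between
  the two presentations carry finite generation from the kernel of \<open>\<phi>\<close> to that of
  \<open>\<alpha>\<close>.\<close>

lemma coherent_module_regular:
  assumes "left_coherent R"
  shows "coherent_module R (left_regular R)"
  unfolding coherent_module_def
proof (intro allI ballI)
  fix m \<alpha> assume a: "\<alpha> \<in> mod_hom R (free_pow R m) (left_regular R)"
  have R: "ring R" using assms by (simp add: left_coherent_def)
  interpret R: ring R by fact
  let ?L = "left_regular R"
  have L: "left_module R ?L" by (rule left_module_regular[OF R])
  interpret L: left_module R ?L by fact
  have F: "left_module R (free_pow R k)" for k by (rule left_module_free[OF R])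
  interpret Fm: left_module R "free_pow R m" by (rule F)
  define I where "I = \<alpha> ` carrier (free_pow R m)"
  have LI: "left_module R (?L\<lparr>carrier := I\<rparr>)" unfolding I_def by (rule left_module_image[OF F L a])
  interpret LI: left_module R "?L\<lparr>carrier := I\<rparr>" by fact
  have Isub: "I \<subseteq> carrier ?L" using mod_hom_closed[OF a] by (auto simp: I_def)
  have "submodule I R ?L"
  proof (intro submodule.intro subgroup.intro submodule_axioms.intro)
    show "I \<subseteq> carrier (add_monoid ?L)" using Isub by simp
    show "\<one>\<^bsub>add_monoid ?L\<^esub> \<in> I" using LI.M.zero_closed by simp
    show "x \<otimes>\<^bsub>add_monoid ?L\<^esub> y \<in> I" if "x \<in> I" "y \<in> I" for x y
      using LI.M.a_closed that by simp
    show "inv\<^bsub>add_monoid ?L\<^esub> x \<in> I" if "x \<in> I" for x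
    proof -
      have "(\<ominus>\<^bsub>R\<^esub> \<one>\<^bsub>R\<^esub>) \<odot>\<^bsub>?L\<^esub> x \<in> I"
        using LI.smult_closed[of "\<ominus>\<^bsub>R\<^esub> \<one>\<^bsub>R\<^esub>" x] that by simp
      then show ?thesis using L.smult_minus_one[of x] that Isub by (auto simp: a_inv_def)
    qed
    show "a \<odot>\<^bsub>?L\<^esub> x \<in> I" if "a \<in> carrier R" "x \<in> I" for a x
      using LI.smult_closed that by simp
  qed
  moreover have "finitely_generated R (?L\<lparr>carrier := I\<rparr>)"
    unfolding I_def by (rule finitely_generated_imageI[OF L a])
  ultimately have "finitely_presented R (?L\<lparr>carrier := I\<rparr>)"
    using assms by (auto simp: left_coherent_def)
  then obtain n \<phi> where phi: "\<phi> \<in> mod_hom R (free_pow R n) (?L\<lparr>carrier := I\<rparr>)"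
    "\<phi> ` carrier (free_pow R n) = carrier (?L\<lparr>carrier := I\<rparr>)"
    "finitely_generated R (kernel_module (free_pow R n) (?L\<lparr>carrier := I\<rparr>) \<phi>)"
    unfolding finitely_presented_def by blast
  obtain q \<rho> where rho: "\<rho> \<in> mod_hom R (free_pow R q) (kernel_module (free_pow R n) (?L\<lparr>carrier := I\<rparr>) \<phi>)"
    "\<rho> ` carrier (free_pow R q) = carrier (kernel_module (free_pow R n) (?L\<lparr>carrier := I\<rparr>) \<phi>)"
    using finitely_generated_imageD[OF phi(3)] by metis
  have aI: "\<alpha> \<in> mod_hom R (free_pow R m) (?L\<lparr>carrier := I\<rparr>)"
    by (rule hom_to_submodule[OF a]) (simp add: I_def)
  have aI': "\<alpha> ` carrier (free_pow R m) = carrier (?L\<lparr>carrier := I\<rparr>)" by (simp add: I_def)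
  obtain \<sigma> where sig: "\<sigma> \<in> mod_hom R (free_pow R m) (free_pow R n)"
    "\<And>x. x \<in> carrier (free_pow R m) \<Longrightarrow> \<phi> (\<sigma> x) = \<alpha> x"
    using lift_free[OF F LI phi(1,2) aI] by blast
  obtain \<tau> where tau: "\<tau> \<in> mod_hom R (free_pow R n) (free_pow R m)"
    "\<And>x. x \<in> carrier (free_pow R n) \<Longrightarrow> \<alpha> (\<tau> x) = \<phi> x"
    using lift_free[OF F LI aI aI' phi(1)] by blast
  let ?F2 = "free_module R (Sum_Type.Plus {..<m} {..<q})"
  have F2: "left_module R ?F2" by (rule left_module_free[OF R])
  have l: "(\<lambda>f b. f (Inl b)) \<in> mod_hom R ?F2 (free_pow R m)"
    by (rule free_reindex_inj_hom[OF R]) auto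
  have r: "(\<lambda>f b. f (Inr b)) \<in> mod_hom R ?F2 (free_pow R q)"
    by (rule free_reindex_inj_hom[OF R]) auto
  have st: "(\<lambda>x. \<tau> (\<sigma> x)) \<in> mod_hom R (free_pow R m) (free_pow R m)" by (rule mod_hom_comp[OF sig(1) tau(1)])
  have d: "(\<lambda>x. x \<ominus>\<^bsub>free_pow R m\<^esub> \<tau> (\<sigma> x)) \<in> mod_hom R (free_pow R m) (free_pow R m)"
    by (rule mod_hom_minus[OF F mod_hom_id st F])
  note rho' = mod_hom_kernelD[OF rho(1)]
  have tr: "(\<lambda>x. \<tau> (\<rho> x)) \<in> mod_hom R (free_pow R q) (free_pow R m)"
    by (rule mod_hom_comp[OF rho'(1) tau(1)])
  \<comment> \<open>For x in the first summand, \<open>\<alpha>\<close> kills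
    \<open>x - \<tau> (\<sigma> x)\<close>; the second summand contributes the relations of
    \<open>\<phi>\<close>, moved by \<open>\<tau>\<close>. If \<open>\<alpha> x\<close> is zero,
    then \<open>\<sigma> x\<close> is such a relation, and x is the sum of the two
    contributions.\<close>
  define \<gamma> where "\<gamma> z = (\<lambda>b. z (Inl b)) \<ominus>\<^bsub>free_pow R m\<^esub> \<tau> (\<sigma> (\<lambda>b. z (Inl b))) \<oplus>\<^bsub>free_pow R m\<^esub> \<tau> (\<rho> (\<lambda>b. z (Inr b)))" for z
  have g: "\<gamma> \<in> mod_hom R ?F2 (free_pow R m)"
    unfolding \<gamma>_def by (rule mod_hom_plus[OF F mod_hom_comp[OF l d] mod_hom_comp[OF r tr] F2])
  have img: "\<gamma> ` carrier ?F2 = {x \<in> carrier (free_pow R m). \<alpha> x = \<zero>\<^bsub>?L\<^esub>}"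
  proof (intro equalityI subsetI)
    fix x assume "x \<in> \<gamma> ` carrier ?F2"
    then obtain z where z: "z \<in> carrier ?F2" "x = \<gamma> z" by auto
    define u v where "u = (\<lambda>b. z (Inl b))" and "v = (\<lambda>b. z (Inr b))"
    have u: "u \<in> carrier (free_pow R m)" unfolding u_def by (rule mod_hom_closed[OF l z(1)])
    have v: "v \<in> carrier (free_pow R q)" unfolding v_def by (rule mod_hom_closed[OF r z(1)])
    have "\<alpha> (\<gamma> z) = \<alpha> (u \<ominus>\<^bsub>free_pow R m\<^esub> \<tau> (\<sigma> u)) \<oplus>\<^bsub>?L\<^esub> \<alpha> (\<tau> (\<rho> v))"
      unfolding \<gamma>_def u_def[symmetric] v_def[symmetric]
      by (rule mod_hom_add[OF a mod_hom_closed[OF d u] mod_hom_closed[OF tr v]])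
    also have "\<alpha> (u \<ominus>\<^bsub>free_pow R m\<^esub> \<tau> (\<sigma> u)) = \<zero>\<^bsub>?L\<^esub>"
      by (rule mod_hom_diff_zero[OF F L a u mod_hom_closed[OF st u]])
        (simp add: tau(2)[OF mod_hom_closed[OF sig(1) u]] sig(2)[OF u])
    also have "\<alpha> (\<tau> (\<rho> v)) = \<zero>\<^bsub>?L\<^esub>"
      using tau(2)[OF mod_hom_closed[OF rho'(1) v]] rho'(2)[OF v] by simp
    finally show "x \<in> {x \<in> carrier (free_pow R m). \<alpha> x = \<zero>\<^bsub>?L\<^esub>}"
      using z mod_hom_closed[OF g] by simp
  next
    fix x assume "x \<in> {x \<in> carrier (free_pow R m). \<alpha> x = \<zero>\<^bsub>?L\<^esub>}"
    then have x: "x \<in> carrier (free_pow R m)" "\<alpha> x = \<zero>\<^bsub>?L\<^esub>" by auto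
    then have "\<sigma> x \<in> carrier (kernel_module (free_pow R n) (?L\<lparr>carrier := I\<rparr>) \<phi>)"
      using mod_hom_closed[OF sig(1) x(1)] sig(2)[OF x(1)] by (simp add: carrier_kernel_module)
    then obtain v where v: "v \<in> carrier (free_pow R q)" "\<rho> v = \<sigma> x" unfolding rho(2)[symmetric] by auto
    have "\<gamma> (case_sum x v) = x \<ominus>\<^bsub>free_pow R m\<^esub> \<tau> (\<sigma> x) \<oplus>\<^bsub>free_pow R m\<^esub> \<tau> (\<sigma> x)"
      by (simp add: \<gamma>_def v(2))
    also have "\<dots> = x" using x(1) mod_hom_closed[OF st x(1)]
      by (simp add: a_minus_def Fm.M.a_assoc Fm.M.l_neg)
    finally show "x \<in> \<gamma> ` carrier ?F2" using case_sum_free_closed[OF x(1) v(1)] by (metis imageI)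
  qed
  have fin: "finite (Sum_Type.Plus {..<m} {..<q})" by simp
  obtain p \<beta>
    where "\<beta> \<in> mod_hom R (free_pow R p) (free_pow R m)" "\<beta> ` carrier (free_pow R p) = \<gamma> ` carrier ?F2"
    by (rule image_of_finite_free[OF R fin F g])
  then show "\<exists>p. \<exists>\<beta>\<in>mod_hom R (free_pow R p) (free_pow R m).
       \<beta> ` carrier (free_pow R p) = {x \<in> carrier (free_pow R m). \<alpha> x = \<zero>\<^bsub>?L\<^esub>}"
    unfolding img by blast
qed

lemma free_eval_hom: "(\<lambda>f. f b) \<in> mod_hom R (free_module R B) (left_regular R)"
  by (rule mod_homI) (auto dest: free_moduleD(1) simp: left_regular_def free_module_simps)

text \<open>Coordinates are killed one at a time: the case of R itself covers the kernel of the
  coordinate at \<open>b\<close> by a finite free module, and the induction hypothesis applies to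
  \<open>\<alpha>\<close> pulled back to that module, where this coordinate has become zero.\<close>

lemma coherent_module_free:
  assumes coh: "left_coherent R" and "finite B"
  shows "coherent_module R (free_module R B)"
  using assms(2)
proof induction
  case empty
  interpret ring R using coh by (simp add: left_coherent_def)
  have "carrier (free_module R {}) = {\<zero>\<^bsub>free_module R {}\<^esub>}" by (auto simp: free_module_def)
  then have "(\<lambda>x. x) ` carrier (free_pow R m) = {x \<in> carrier (free_pow R m). \<alpha> x = \<zero>\<^bsub>free_module R {}\<^esub>}"
    if "\<alpha> \<in> mod_hom R (free_pow R m) (free_module R {})" for m \<alpha>
    using mod_hom_closed[OF that] by auto
  then show ?case
    unfolding coherent_module_def by (intro allI ballI exI) (rule bexI[OF _ mod_hom_id])
next
  case (insert b B)
  show ?case unfolding coherent_module_def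
  proof (intro allI ballI)
    fix m \<alpha> assume a: "\<alpha> \<in> mod_hom R (free_pow R m) (free_module R (insert b B))"
    let ?Z = "\<zero>\<^bsub>free_module R (insert b B)\<^esub>"
    have a1: "(\<lambda>x. \<alpha> x b) \<in> mod_hom R (free_pow R m) (left_regular R)"
      by (rule mod_hom_comp[OF a free_eval_hom])
    obtain p \<beta> where b: "\<beta> \<in> mod_hom R (free_pow R p) (free_pow R m)"
      "\<beta> ` carrier (free_pow R p) = {x \<in> carrier (free_pow R m). \<alpha> x b = \<zero>\<^bsub>left_regular R\<^esub>}"
      using coherent_module_regular[OF coh, unfolded coherent_module_def, rule_format, OF a1] by auto
    note ab = mod_hom_comp[OF b(1) a]
    have a2: "(\<lambda>x. \<alpha> (\<beta> x)) \<in> mod_hom R (free_pow R p) (free_module R B)"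
    proof (rule mod_homI)
      fix x assume x: "x \<in> carrier (free_pow R p)"
      have "\<alpha> (\<beta> x) b = \<zero>\<^bsub>R\<^esub>" using b(2) x by (auto simp: left_regular_def)
      moreover have "\<alpha> (\<beta> x) \<in> carrier (free_module R (insert b B))" by (rule mod_hom_closed[OF ab x])
      ultimately show "\<alpha> (\<beta> x) \<in> carrier (free_module R B)" by (auto simp: free_module_def)
    qed (use mod_hom_add[OF ab] mod_hom_smult[OF ab] in \<open>simp_all add: free_module_simps\<close>)
    obtain q \<gamma> where g: "\<gamma> \<in> mod_hom R (free_pow R q) (free_pow R p)"
      "\<gamma> ` carrier (free_pow R q) = {x \<in> carrier (free_pow R p). \<alpha> (\<beta> x) = \<zero>\<^bsub>free_module R B\<^esub>}"
      using insert.IH[unfolded coherent_module_def, rule_format, OF a2] by auto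
    have "(\<lambda>x. \<beta> (\<gamma> x)) ` carrier (free_pow R q) = {x \<in> carrier (free_pow R m). \<alpha> x = ?Z}"
    proof (intro equalityI subsetI)
      fix x assume "x \<in> (\<lambda>x. \<beta> (\<gamma> x)) ` carrier (free_pow R q)"
      then obtain z where z: "z \<in> carrier (free_pow R q)" "x = \<beta> (\<gamma> z)" by auto
      then have "\<alpha> (\<beta> (\<gamma> z)) = \<zero>\<^bsub>free_module R B\<^esub>" using g(2) by auto
      then show "x \<in> {x \<in> carrier (free_pow R m). \<alpha> x = ?Z}"
        using z mod_hom_closed[OF mod_hom_comp[OF g(1) b(1)]] by (simp add: free_module_simps)
    next
      fix x assume "x \<in> {x \<in> carrier (free_pow R m). \<alpha> x = ?Z}"
      then have x: "x \<in> carrier (free_pow R m)" "\<alpha> x = ?Z" by auto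
      then have "x \<in> \<beta> ` carrier (free_pow R p)" unfolding b(2) by (simp add: free_module_simps left_regular_def)
      then obtain y where y: "y \<in> carrier (free_pow R p)" "x = \<beta> y" by auto
      then have "y \<in> \<gamma> ` carrier (free_pow R q)" unfolding g(2) using x by (simp add: free_module_simps)
      then show "x \<in> (\<lambda>x. \<beta> (\<gamma> x)) ` carrier (free_pow R q)" using y by auto
    qed
    then show "\<exists>p. \<exists>\<beta>\<in>mod_hom R (free_pow R p) (free_pow R m).
       \<beta> ` carrier (free_pow R p) = {x \<in> carrier (free_pow R m). \<alpha> x = ?Z}"
      using mod_hom_comp[OF g(1) b(1)] by blast
  qed
qed

lemma coherent_kernel:
  assumes coh: "left_coherent R" and B: "finite B" and C: "finite C"
    and a: "\<alpha> \<in> mod_hom R (free_module R B) (free_module R C)"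
  obtains p \<beta> where "\<beta> \<in> mod_hom R (free_pow R p) (free_module R B)"
    "\<beta> ` carrier (free_pow R p) = {x \<in> carrier (free_module R B). \<alpha> x = \<zero>\<^bsub>free_module R C\<^esub>}"
proof -
  have R: "ring R" using coh by (simp add: left_coherent_def)
  obtain n \<theta> \<theta>' where th: "\<theta> \<in> mod_hom R (free_pow R n) (free_module R B)"
    "\<theta>' \<in> mod_hom R (free_module R B) (free_pow R n)"
    "\<And>y. y \<in> carrier (free_module R B) \<Longrightarrow> \<theta> (\<theta>' y) = y"
    using reindex_finite_free[OF R B] by metis
  obtain p \<beta> where b: "\<beta> \<in> mod_hom R (free_pow R p) (free_pow R n)"
    "\<beta> ` carrier (free_pow R p) = {x \<in> carrier (free_pow R n). \<alpha> (\<theta> x) = \<zero>\<^bsub>free_module R C\<^esub>}"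
    using coherent_module_free[OF coh C, unfolded coherent_module_def, rule_format, OF mod_hom_comp[OF th(1) a]]
    by auto
  have "(\<lambda>x. \<theta> (\<beta> x)) ` carrier (free_pow R p) = \<theta> ` {x \<in> carrier (free_pow R n). \<alpha> (\<theta> x) = \<zero>\<^bsub>free_module R C\<^esub>}"
    using b(2) by (metis image_image)
  also have "\<dots> = {x \<in> carrier (free_module R B). \<alpha> x = \<zero>\<^bsub>free_module R C\<^esub>}"
    using mod_hom_closed[OF th(1)] mod_hom_closed[OF th(2)] th(3) by (force simp: image_iff)
  finally show ?thesis using that[OF mod_hom_comp[OF b(1) th(1)]] by simp
qed

section \<open>Extending maps from finitely generated submodules\<close>

text \<open>A map \<open>\<kappa>\<close> that vanishes on the kernel of \<open>\<beta>\<close>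
  amounts to a map on the image of \<open>\<beta>\<close>. So maps from finitely generated
  submodules of finite free modules extend, which is the vanishing of Ext on the cokernel of
  \<open>\<beta>\<close>. Neither Ext nor a type for that cokernel appears, so the condition passes
  easily to modules on other types.\<close>

definition fp_injective :: "('r, 'x) ring_scheme \<Rightarrow> ('r, 'a) module \<Rightarrow> bool" where
  "fp_injective R A \<longleftrightarrow> left_module R A \<and>
     (\<forall>m n. \<forall>\<beta>\<in>mod_hom R (free_pow R m) (free_pow R n). \<forall>\<kappa>\<in>mod_hom R (free_pow R m) A.
        (\<forall>x\<in>carrier (free_pow R m). \<beta> x = \<zero>\<^bsub>free_pow R n\<^esub> \<longrightarrow> \<kappa> x = \<zero>\<^bsub>A\<^esub>) \<longrightarrow>
        (\<exists>g\<in>mod_hom R (free_pow R n) A. \<forall>x\<in>carrier (free_pow R m). g (\<beta> x) = \<kappa> x))"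

lemma fp_injective_module: "fp_injective R A \<Longrightarrow> left_module R A"
  by (simp add: fp_injective_def)

lemma fp_injectiveI:
  assumes "left_module R A"
    and "\<And>m n \<beta> \<kappa>. \<beta> \<in> mod_hom R (free_pow R m) (free_pow R n) \<Longrightarrow> \<kappa> \<in> mod_hom R (free_pow R m) A \<Longrightarrow>
      (\<And>x. x \<in> carrier (free_pow R m) \<Longrightarrow> \<beta> x = \<zero>\<^bsub>free_pow R n\<^esub> \<Longrightarrow> \<kappa> x = \<zero>\<^bsub>A\<^esub>) \<Longrightarrow>
      \<exists>g\<in>mod_hom R (free_pow R n) A. \<forall>x\<in>carrier (free_pow R m). g (\<beta> x) = \<kappa> x"
  shows "fp_injective R A"
  using assms unfolding fp_injective_def by blast

lemma fp_injectiveD: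
  assumes A: "fp_injective R A" and B: "finite B" and C: "finite C"
    and b: "\<beta> \<in> mod_hom R (free_module R B) (free_module R C)" and k: "\<kappa> \<in> mod_hom R (free_module R B) A"
    and ker: "\<And>x. x \<in> carrier (free_module R B) \<Longrightarrow> \<beta> x = \<zero>\<^bsub>free_module R C\<^esub> \<Longrightarrow> \<kappa> x = \<zero>\<^bsub>A\<^esub>"
  shows "\<exists>g\<in>mod_hom R (free_module R C) A. \<forall>x\<in>carrier (free_module R B). g (\<beta> x) = \<kappa> x"
proof -
  have R: "ring R" using fp_injective_module[OF A] by (simp add: left_module_def)
  have F: "left_module R (free_module R X)" for X :: "'z set" by (rule left_module_free[OF R])
  have FC: "left_module R (free_module R C)" by (rule left_module_free[OF R])
  obtain m \<theta> \<theta>' where th: "\<theta> \<in> mod_hom R (free_pow R m) (free_module R B)"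
    "\<theta>' \<in> mod_hom R (free_module R B) (free_pow R m)"
    "\<And>y. y \<in> carrier (free_module R B) \<Longrightarrow> \<theta> (\<theta>' y) = y"
    using reindex_finite_free[OF R B] by metis
  obtain n \<chi> \<chi>' where ch: "\<chi> \<in> mod_hom R (free_pow R n) (free_module R C)"
    "\<chi>' \<in> mod_hom R (free_module R C) (free_pow R n)"
    "\<And>y. y \<in> carrier (free_module R C) \<Longrightarrow> \<chi> (\<chi>' y) = y"
    using reindex_finite_free[OF R C] by metis
  have b0: "(\<lambda>x. \<chi>' (\<beta> (\<theta> x))) \<in> mod_hom R (free_pow R m) (free_pow R n)"
    by (rule mod_hom_comp[OF mod_hom_comp[OF th(1) b] ch(2)])
  have k0: "(\<lambda>x. \<kappa> (\<theta> x)) \<in> mod_hom R (free_pow R m) A" by (rule mod_hom_comp[OF th(1) k])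
  have "\<kappa> (\<theta> x) = \<zero>\<^bsub>A\<^esub>" if x: "x \<in> carrier (free_pow R m)" and z: "\<chi>' (\<beta> (\<theta> x)) = \<zero>\<^bsub>free_pow R n\<^esub>" for x
  proof -
    have "\<theta> x \<in> carrier (free_module R B)" by (rule mod_hom_closed[OF th(1) x])
    moreover have "\<beta> (\<theta> x) = \<zero>\<^bsub>free_module R C\<^esub>"
      using ch(3)[OF mod_hom_closed[OF b mod_hom_closed[OF th(1) x]]] z mod_hom_zero[OF F FC ch(1)] by simp
    ultimately show ?thesis by (rule ker)
  qed
  then obtain g where g: "g \<in> mod_hom R (free_pow R n) A"
    "\<And>x. x \<in> carrier (free_pow R m) \<Longrightarrow> g (\<chi>' (\<beta> (\<theta> x))) = \<kappa> (\<theta> x)"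
    using A[unfolded fp_injective_def, THEN conjunct2, rule_format, OF b0 k0] by auto
  show ?thesis
  proof (rule bexI[OF _ mod_hom_comp[OF ch(2) g(1)]], rule ballI)
    fix x assume x: "x \<in> carrier (free_module R B)"
    show "g (\<chi>' (\<beta> x)) = \<kappa> x" using g(2)[OF mod_hom_closed[OF th(2) x]] th(3)[OF x] by simp
  qed
qed

text \<open>The cokernel N of \<open>\<beta>\<close> is finitely presented, so maps extend from the
  kernel of its canonical cover. This cover and \<open>free_pow R n\<close> are both free, hence map
  to each other over N, and \<open>ext_transfer\<close> applies.\<close>

lemma absolutely_pure_fp_injective:
  fixes R :: "('r, 'x) ring_scheme"
  assumes AP: "absolutely_pure R A"
  shows "fp_injective R A"
proof (rule fp_injectiveI)
  show A: "left_module R A" using AP by (simp add: absolutely_pure_def)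
  then have R: "ring R" by (simp add: left_module_def)
  have F: "left_module R (free_pow R k)" for k by (rule left_module_free[OF R])
  fix m n \<beta> \<kappa>
  assume b: "\<beta> \<in> mod_hom R (free_pow R m) (free_pow R n)" and k: "\<kappa> \<in> mod_hom R (free_pow R m) A"
    and ker: "\<And>x. x \<in> carrier (free_pow R m) \<Longrightarrow> \<beta> x = \<zero>\<^bsub>free_pow R n\<^esub> \<Longrightarrow> \<kappa> x = \<zero>\<^bsub>A\<^esub>"
  let ?I = "\<beta> ` carrier (free_pow R m)"
  have I: "left_module R ((free_pow R n)\<lparr>carrier := ?I\<rparr>)" by (rule left_module_image[OF F F b])
  have Isub: "?I \<subseteq> carrier (free_pow R n)" using mod_hom_closed[OF b] by auto
  obtain N :: "('r, nat \<Rightarrow> 'r) module" and q where N: "left_module R N" and q: "q \<in> mod_hom R (free_pow R n) N"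
    "q ` carrier (free_pow R n) = carrier N"
    "\<And>x. x \<in> carrier (free_pow R n) \<Longrightarrow> q x = \<zero>\<^bsub>N\<^esub> \<longleftrightarrow> x \<in> ?I"
    using quotient_exists[OF F I Isub inj_on_id] by blast
  have ker_eq: "kernel_module (free_pow R n) N q = (free_pow R n)\<lparr>carrier := ?I\<rparr>"
  proof -
    have "a_kernel (free_pow R n) N q = ?I" using q(3) Isub by (auto simp: a_kernel_def')
    then show ?thesis by (simp add: kernel_module_def)
  qed
  have "finitely_presented R N"
    unfolding finitely_presented_def using N q(1,2) finitely_generated_imageI[OF F b]
    by (metis ker_eq)
  then have triv: "trivial_group (Ext1 R N A)" by (rule absolutely_pure_Ext1[OF AP])
  obtain \<kappa>' where k': "\<kappa>' \<in> mod_hom R (kernel_module (free_pow R n) N q) A"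
    "\<And>x. x \<in> carrier (free_pow R m) \<Longrightarrow> \<kappa>' (\<beta> x) = \<kappa> x"
    unfolding ker_eq using factor_through_image[OF F F A b k ker] by metis
  obtain a where a: "a \<in> mod_hom R (free_cover R N) (free_pow R n)"
    "\<And>x. x \<in> carrier (free_cover R N) \<Longrightarrow> q (a x) = cover_map R N x"
    using lift_free[OF F N q(1,2) cover_map_hom[OF N, unfolded free_cover_def], folded free_cover_def] by blast
  obtain b' where b': "b' \<in> mod_hom R (free_pow R n) (free_cover R N)"
    "\<And>x. x \<in> carrier (free_pow R n) \<Longrightarrow> cover_map R N (b' x) = q x"
    using lift_free[OF free_cover_module[OF N] N cover_map_hom[OF N] cover_map_onto[OF N] q(1)] by blast
  have "\<exists>g\<in>mod_hom R (free_pow R n) A. \<forall>x\<in>carrier (kernel_module (free_pow R n) N q). g x = \<kappa>' x"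
  proof (rule ext_transfer[OF free_cover_module[OF N] F N A q(1) a(1) _ b'(1)])
    show "q (a x) = cover_map R N x" if "x \<in> carrier (free_cover R N)" for x by (rule a(2)[OF that])
    show "cover_map R N (b' x) = q x" if "x \<in> carrier (free_pow R n)" for x by (rule b'(2)[OF that])
    show "\<exists>g\<in>mod_hom R (free_cover R N) A. \<forall>x\<in>carrier (kernel_module (free_cover R N) N (cover_map R N)). g x = \<kappa> x"
      if "\<kappa> \<in> mod_hom R (kernel_module (free_cover R N) N (cover_map R N)) A" for \<kappa>
      using triv that by (simp add: Ext1_trivial_iff[OF N A] syzygy_def)
  qed (rule k'(1))
  then obtain g where g: "g \<in> mod_hom R (free_pow R n) A" "\<And>x. x \<in> ?I \<Longrightarrow> g x = \<kappa>' x"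
    unfolding ker_eq by auto
  show "\<exists>g\<in>mod_hom R (free_pow R n) A. \<forall>x\<in>carrier (free_pow R m). g (\<beta> x) = \<kappa> x"
    by (rule bexI[OF _ g(1)]) (simp add: g(2) k'(2))
qed

text \<open>Through \<open>\<iota>\<close> the kernel is isomorphic to A, and the property is
  invariant under isomorphism. This is how the cycles of the coresolution inherit it.\<close>

lemma fp_injective_kernel:
  assumes A: "fp_injective R A" and X: "left_module R X" and Y: "left_module R Y"
    and i: "\<iota> \<in> mod_hom R A X" and inj: "inj_on \<iota> (carrier A)"
    and q: "q \<in> mod_hom R X Y" and img: "\<iota> ` carrier A = {x \<in> carrier X. q x = \<zero>\<^bsub>Y\<^esub>}"
  shows "fp_injective R (kernel_module X Y q)"
proof (rule fp_injectiveI)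
  let ?K = "kernel_module X Y q"
  show K: "left_module R ?K" by (rule left_module_kernel[OF X Y q])
  have lA: "left_module R A" by (rule fp_injective_module[OF A])
  interpret A: left_module R A by (rule lA)
  have iK: "\<iota> \<in> mod_hom R A ?K" by (rule mod_hom_kernelI[OF i]) (use img in auto)
  have Kimg: "carrier ?K = \<iota> ` carrier A" by (simp add: carrier_kernel_module img)
  have i0: "x = \<zero>\<^bsub>A\<^esub>" if "x \<in> carrier A" "\<iota> x = \<zero>\<^bsub>X\<^esub>" for x
    using inj_onD[OF inj _ that(1) A.M.zero_closed] that(2) mod_hom_zero[OF lA X i] by simp
  obtain \<pi> where "\<pi> \<in> mod_hom R (X\<lparr>carrier := \<iota> ` carrier A\<rparr>) A" and pi: "\<And>x. x \<in> carrier A \<Longrightarrow> \<pi> (\<iota> x) = x"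
    using factor_through_image[OF lA X lA i mod_hom_id i0] by metis
  then have p: "\<pi> \<in> mod_hom R ?K A"
    using Kimg by (simp add: kernel_module_def)
  fix m n \<beta> \<kappa>
  assume b: "\<beta> \<in> mod_hom R (free_pow R m) (free_pow R n)" and k: "\<kappa> \<in> mod_hom R (free_pow R m) ?K"
    and ker: "\<And>x. x \<in> carrier (free_pow R m) \<Longrightarrow> \<beta> x = \<zero>\<^bsub>free_pow R n\<^esub> \<Longrightarrow> \<kappa> x = \<zero>\<^bsub>?K\<^esub>"
  obtain g where g: "g \<in> mod_hom R (free_pow R n) A"
    "\<And>x. x \<in> carrier (free_pow R m) \<Longrightarrow> g (\<beta> x) = \<pi> (\<kappa> x)"
    using fp_injectiveD[OF A finite_lessThan finite_lessThan b mod_hom_comp[OF k p]] ker mod_hom_zero[OF K lA p]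
    by auto
  have "\<iota> (\<pi> x) = x" if "x \<in> carrier ?K" for x using that unfolding Kimg by (auto simp: pi)
  then show "\<exists>g\<in>mod_hom R (free_pow R n) ?K. \<forall>x\<in>carrier (free_pow R m). g (\<beta> x) = \<kappa> x"
    by (intro bexI[OF _ mod_hom_comp[OF g(1) iK]]) (simp add: g(2) mod_hom_closed[OF k])
qed

text \<open>Coherence enters here: the obstruction to lifting a map along \<open>q\<close> lives on a finitely
  generated module of relations.\<close>

lemma fp_injective_quotient:
  assumes coh: "left_coherent R" and M: "fp_injective R M" and N: "left_module R N"
    and q: "q \<in> mod_hom R M N" and onto: "q ` carrier M = carrier N"
    and K: "fp_injective R (kernel_module M N q)"
  shows "fp_injective R N"
proof (rule fp_injectiveI)
  show "left_module R N" by fact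
  interpret N: left_module R N by fact
  have R: "ring R" by (rule N.R.ring_axioms)
  have lM: "left_module R M" by (rule fp_injective_module[OF M])
  interpret M: left_module R M by (rule lM)
  have F: "left_module R (free_pow R k)" for k by (rule left_module_free[OF R])
  fix m n \<beta> \<kappa>
  assume b: "\<beta> \<in> mod_hom R (free_pow R m) (free_pow R n)" and k: "\<kappa> \<in> mod_hom R (free_pow R m) N"
    and ker: "\<And>x. x \<in> carrier (free_pow R m) \<Longrightarrow> \<beta> x = \<zero>\<^bsub>free_pow R n\<^esub> \<Longrightarrow> \<kappa> x = \<zero>\<^bsub>N\<^esub>"
  obtain l \<gamma> where g: "\<gamma> \<in> mod_hom R (free_pow R l) (free_pow R m)"
    "\<gamma> ` carrier (free_pow R l) = {x \<in> carrier (free_pow R m). \<beta> x = \<zero>\<^bsub>free_pow R n\<^esub>}"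
    by (rule coherent_kernel[OF coh finite_lessThan finite_lessThan b])
  obtain u where u: "u \<in> mod_hom R (free_pow R m) M" "\<And>x. x \<in> carrier (free_pow R m) \<Longrightarrow> q (u x) = \<kappa> x"
    using lift_free[OF lM N q onto k] by blast
  have gk: "\<gamma> x \<in> carrier (free_pow R m)" "\<beta> (\<gamma> x) = \<zero>\<^bsub>free_pow R n\<^esub>" if "x \<in> carrier (free_pow R l)" for x
    using g(2) that by auto
  have ug: "(\<lambda>x. u (\<gamma> x)) \<in> mod_hom R (free_pow R l) (kernel_module M N q)"
    by (rule mod_hom_kernelI[OF mod_hom_comp[OF g(1) u(1)]]) (simp add: u(2) gk ker)
  \<comment> \<open>On the image of \<open>\<gamma>\<close>, which is the kernel of
    \<open>\<beta>\<close>, the lift \<open>u\<close> takes values in the kernel of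
    \<open>q\<close>; there it is extended to \<open>v\<close>. Then \<open>u - v\<close> still
    lifts \<open>\<kappa>\<close> and vanishes on the kernel of \<open>\<beta>\<close>, hence
    extends along \<open>\<beta>\<close>.\<close>
  obtain v where v: "v \<in> mod_hom R (free_pow R m) (kernel_module M N q)"
    "\<And>x. x \<in> carrier (free_pow R l) \<Longrightarrow> v (\<gamma> x) = u (\<gamma> x)"
    using fp_injectiveD[OF K finite_lessThan finite_lessThan g(1) ug] mod_hom_zero[OF F lM u(1)] by auto
  note v' = mod_hom_kernelD[OF v(1)]
  have uv: "(\<lambda>x. u x \<ominus>\<^bsub>M\<^esub> v x) \<in> mod_hom R (free_pow R m) M" by (rule mod_hom_minus[OF lM u(1) v'(1) F])
  have uv0: "u x \<ominus>\<^bsub>M\<^esub> v x = \<zero>\<^bsub>M\<^esub>" if x: "x \<in> carrier (free_pow R m)" "\<beta> x = \<zero>\<^bsub>free_pow R n\<^esub>" for x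
  proof -
    have "x \<in> \<gamma> ` carrier (free_pow R l)" unfolding g(2) using x by simp
    then show ?thesis using v(2) mod_hom_closed[OF u(1) x(1)] by (auto simp: M.M.r_neg a_minus_def)
  qed
  obtain h where h: "h \<in> mod_hom R (free_pow R n) M"
    "\<And>x. x \<in> carrier (free_pow R m) \<Longrightarrow> h (\<beta> x) = u x \<ominus>\<^bsub>M\<^esub> v x"
    using fp_injectiveD[OF M finite_lessThan finite_lessThan b uv uv0] by blast
  have "q (h (\<beta> x)) = \<kappa> x" if x: "x \<in> carrier (free_pow R m)" for x
  proof -
    have "q (h (\<beta> x)) = q (u x) \<ominus>\<^bsub>N\<^esub> q (v x)"
      unfolding h(2)[OF x]
      by (rule mod_hom_diff[OF lM N q mod_hom_closed[OF u(1) x] mod_hom_closed[OF v'(1) x]])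
    also have "\<dots> = \<kappa> x" using v'(2)[OF x] u(2)[OF x] mod_hom_closed[OF k x]
      by (simp add: a_minus_def N.smult_minus_one[OF N.M.zero_closed])
    finally show ?thesis .
  qed
  then show "\<exists>g\<in>mod_hom R (free_pow R n) N. \<forall>x\<in>carrier (free_pow R m). g (\<beta> x) = \<kappa> x"
    by (intro bexI[OF _ mod_hom_comp[OF h(1) q]]) simp
qed

section \<open>Powers, eventually vanishing families, and finite parts of a map\<close>

text \<open>For \<open>\<F> = bot\<close> this is the whole power of \<open>A\<close>.\<close>

definition ev_zero_module :: "('r, 'a) module \<Rightarrow> 'j filter \<Rightarrow> ('r, 'j \<Rightarrow> 'a) module" where
  "ev_zero_module A \<F> = \<lparr>carrier = {f. range f \<subseteq> carrier A \<and> eventually (\<lambda>j. f j = \<zero>\<^bsub>A\<^esub>) \<F>},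
     mult = undefined, one = undefined,
     zero = (\<lambda>j. \<zero>\<^bsub>A\<^esub>), add = (\<lambda>f g j. f j \<oplus>\<^bsub>A\<^esub> g j), smult = (\<lambda>a f j. a \<odot>\<^bsub>A\<^esub> f j)\<rparr>"

lemma ev_zero_simps:
  "add (ev_zero_module A \<F>) = (\<lambda>f g j. f j \<oplus>\<^bsub>A\<^esub> g j)" "zero (ev_zero_module A \<F>) = (\<lambda>j. \<zero>\<^bsub>A\<^esub>)"
  "smult (ev_zero_module A \<F>) = (\<lambda>a f j. a \<odot>\<^bsub>A\<^esub> f j)"
  "f \<in> carrier (ev_zero_module A \<F>) \<longleftrightarrow> (\<forall>j. f j \<in> carrier A) \<and> eventually (\<lambda>j. f j = \<zero>\<^bsub>A\<^esub>) \<F>"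
  by (auto simp: ev_zero_module_def)

lemma left_module_ev_zero:
  assumes "left_module R A" shows "left_module R (ev_zero_module A \<F>)"
proof -
  interpret A: left_module R A by fact
  let ?E = "ev_zero_module A \<F>"
  have "abelian_group ?E"
  proof (rule abelian_groupI)
    fix f assume f: "f \<in> carrier ?E"
    have "eventually (\<lambda>j. \<ominus>\<^bsub>A\<^esub> f j = \<zero>\<^bsub>A\<^esub>) \<F>"
      using f unfolding ev_zero_simps
      by (elim conjE eventually_mono) (simp add: A.smult_minus_one)
    then show "\<exists>g\<in>carrier ?E. g \<oplus>\<^bsub>?E\<^esub> f = \<zero>\<^bsub>?E\<^esub>"
      using f by (intro bexI[of _ "\<lambda>j. \<ominus>\<^bsub>A\<^esub> f j"]) (auto simp: ev_zero_simps A.M.l_neg)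
  next
    fix f g assume "f \<in> carrier ?E" "g \<in> carrier ?E"
    then show "f \<oplus>\<^bsub>?E\<^esub> g \<in> carrier ?E"
      by (auto simp: ev_zero_simps elim: eventually_elim2)
  qed (auto simp: ev_zero_simps A.M.a_ac)
  moreover have "left_module_axioms R ?E"
    by unfold_locales
      (auto simp: ev_zero_simps A.smult_l_distr A.smult_r_distr A.smult_assoc1 elim: eventually_mono)
  ultimately show ?thesis by (intro left_module.intro A.R.ring_axioms)
qed

lemma ev_zero_proj_hom: "(\<lambda>f. f j) \<in> mod_hom R (ev_zero_module A \<F>) A"
  by (rule mod_homI) (simp_all add: ev_zero_simps)

text \<open>Extensions are chosen coordinatewise, with zero chosen wherever \<open>\<kappa>\<close>
  vanishes entirely in a coordinate. As \<open>free_pow R m\<close> has a finite basis, this happens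
  in eventually all coordinates, so the extension again takes eventually vanishing values.\<close>

lemma fp_injective_ev_zero:
  assumes A: "fp_injective R A"
  shows "fp_injective R (ev_zero_module A \<F>)"
proof (rule fp_injectiveI)
  let ?E = "ev_zero_module A \<F>"
  have lA: "left_module R A" by (rule fp_injective_module[OF A])
  interpret A: left_module R A by (rule lA)
  show "left_module R ?E" by (rule left_module_ev_zero[OF lA])
  fix m n \<beta> \<kappa>
  assume b: "\<beta> \<in> mod_hom R (free_pow R m) (free_pow R n)" and k: "\<kappa> \<in> mod_hom R (free_pow R m) ?E"
    and ker: "\<And>x. x \<in> carrier (free_pow R m) \<Longrightarrow> \<beta> x = \<zero>\<^bsub>free_pow R n\<^esub> \<Longrightarrow> \<kappa> x = \<zero>\<^bsub>?E\<^esub>"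
  have kj: "(\<lambda>x. \<kappa> x j) \<in> mod_hom R (free_pow R m) A" for j
    by (rule mod_hom_comp[OF k ev_zero_proj_hom])
  have ex: "\<exists>g. g \<in> mod_hom R (free_pow R n) A \<and> (\<forall>x\<in>carrier (free_pow R m). g (\<beta> x) = \<kappa> x j) \<and>
      ((\<forall>x\<in>carrier (free_pow R m). \<kappa> x j = \<zero>\<^bsub>A\<^esub>) \<longrightarrow> g = (\<lambda>x. \<zero>\<^bsub>A\<^esub>))" for j
  proof (cases "\<forall>x\<in>carrier (free_pow R m). \<kappa> x j = \<zero>\<^bsub>A\<^esub>")
    case True
    then show ?thesis using mod_hom_const_zero[OF lA] by (intro exI[of _ "\<lambda>x. \<zero>\<^bsub>A\<^esub>"]) auto
  next
    case False
    obtain g where "g \<in> mod_hom R (free_pow R n) A" "\<And>x. x \<in> carrier (free_pow R m) \<Longrightarrow> g (\<beta> x) = \<kappa> x j"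
      using fp_injectiveD[OF A finite_lessThan finite_lessThan b kj[of j]] ker by (auto simp: ev_zero_simps)
    then show ?thesis using False by blast
  qed
  obtain g where g0: "\<forall>j. g j \<in> mod_hom R (free_pow R n) A \<and>
      (\<forall>x\<in>carrier (free_pow R m). g j (\<beta> x) = \<kappa> x j) \<and>
      ((\<forall>x\<in>carrier (free_pow R m). \<kappa> x j = \<zero>\<^bsub>A\<^esub>) \<longrightarrow> g j = (\<lambda>x. \<zero>\<^bsub>A\<^esub>))"
    using choice[OF allI[OF ex]] by (rule exE)
  have g: "\<And>j. g j \<in> mod_hom R (free_pow R n) A"
    "\<And>j x. x \<in> carrier (free_pow R m) \<Longrightarrow> g j (\<beta> x) = \<kappa> x j"
    "\<And>j. (\<forall>x\<in>carrier (free_pow R m). \<kappa> x j = \<zero>\<^bsub>A\<^esub>) \<Longrightarrow> g j = (\<lambda>x. \<zero>\<^bsub>A\<^esub>)"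
    using g0 by simp_all
  have "eventually (\<lambda>j. \<forall>i\<in>{..<m}. \<kappa> (free_unit R i) j = \<zero>\<^bsub>A\<^esub>) \<F>"
    using mod_hom_closed[OF k free_unit_closed[OF A.R.ring_axioms]]
    by (intro eventually_ball_finite) (auto simp: ev_zero_simps)
  then have ev: "eventually (\<lambda>j. g j = (\<lambda>x. \<zero>\<^bsub>A\<^esub>)) \<F>"
  proof (rule eventually_mono)
    fix j assume j: "\<forall>i\<in>{..<m}. \<kappa> (free_unit R i) j = \<zero>\<^bsub>A\<^esub>"
    have "\<kappa> x j = \<zero>\<^bsub>A\<^esub>" if x: "x \<in> carrier (free_pow R m)" for x
      by (rule hom_free_eqI[OF lA kj mod_hom_const_zero[OF lA] _ x]) (use j in auto)
    then show "g j = (\<lambda>x. \<zero>\<^bsub>A\<^esub>)" using g(3) by blast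
  qed
  have "(\<lambda>x j. g j x) \<in> mod_hom R (free_pow R n) ?E"
  proof (rule mod_homI)
    fix x assume x: "x \<in> carrier (free_pow R n)"
    show "(\<lambda>j. g j x) \<in> carrier ?E"
      unfolding ev_zero_simps using mod_hom_closed[OF g(1) x] ev by (auto elim: eventually_mono)
  qed (simp_all add: ev_zero_simps mod_hom_add[OF g(1)] mod_hom_smult[OF g(1)])
  then show "\<exists>g\<in>mod_hom R (free_pow R n) ?E. \<forall>x\<in>carrier (free_pow R m). g (\<beta> x) = \<kappa> x"
    by (rule bexI[rotated]) (simp add: g(2))
qed

text \<open>P is a direct summand of a free module, and the elements of \<open>S\<close> involve
  only finitely many of its basis elements, the set \<open>B\<close>. Linear relations within
  \<open>S\<close> can thus be tested in a finite free module, and \<open>\<phi>\<close> respects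
  them because it is linear on \<open>Z\<close>.\<close>

lemma local_extension:
  fixes R :: "('r, 'x) ring_scheme" and P :: "('r, 'p) module"
  assumes A: "fp_injective R A" and P: "projective R P" and Z: "left_module R (P\<lparr>carrier := Z\<rparr>)"
    and phi: "\<phi> \<in> mod_hom R (P\<lparr>carrier := Z\<rparr>) A" and S: "finite S" "S \<subseteq> Z" and ZP: "Z \<subseteq> carrier P"
  obtains h where "h \<in> mod_hom R P A" "\<And>s. s \<in> S \<Longrightarrow> h s = \<phi> s"
proof -
  have lP: "left_module R P" using P by (simp add: projective_def)
  have lA: "left_module R A" by (rule fp_injective_module[OF A])
  interpret P: left_module R P by (rule lP)
  interpret A: left_module R A by (rule lA)
  interpret Z: left_module R "P\<lparr>carrier := Z\<rparr>" by (rule Z)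
  have R: "ring R" by (rule P.R.ring_axioms)
  obtain i where i: "i \<in> mod_hom R P (free_cover R P)" "\<And>x. x \<in> carrier P \<Longrightarrow> cover_map R P (i x) = x"
    using projective_lift[OF P free_cover_module[OF lP] lP cover_map_hom[OF lP] mod_hom_id cover_map_onto[OF lP]]
    by blast
  define B where "B = (\<Union>s\<in>S. {b. i s b \<noteq> \<zero>\<^bsub>R\<^esub>})"
  have SP: "s \<in> carrier P" if "s \<in> S" for s using that S ZP by auto
  have iP': "i s \<in> carrier (free_module R (carrier P))" if "s \<in> S" for s
    using mod_hom_closed[OF i(1) SP[OF that]] by (simp add: free_cover_def)
  have B: "finite B" unfolding B_def using S(1) free_moduleD(2)[OF iP'] by auto
  have iB: "i s \<in> carrier (free_module R B)" if "s \<in> S" for s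
    using iP'[OF that] that by (auto simp: free_module_def B_def)
  have FB: "left_module R (free_module R B)" by (rule left_module_free[OF R])
  have iP: "i \<in> S \<rightarrow> carrier (free_module R B)" using iB by auto
  have phiP: "\<phi> \<in> S \<rightarrow> carrier A" using mod_hom_closed[OF phi] S by auto
  have idP: "(\<lambda>s. s) \<in> S \<rightarrow> carrier (P\<lparr>carrier := Z\<rparr>)" using S by auto
  let ?i = "lin_ext R (free_module R B) i" and ?p = "lin_ext R A \<phi>"
    and ?z = "lin_ext R (P\<lparr>carrier := Z\<rparr>) (\<lambda>s. s)"
  have hi: "?i \<in> mod_hom R (free_module R S) (free_module R B)" by (rule left_module.lin_ext_hom[OF FB iP])
  have hp: "?p \<in> mod_hom R (free_module R S) A" by (rule left_module.lin_ext_hom[OF lA phiP])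
  have hz: "?z \<in> mod_hom R (free_module R S) (P\<lparr>carrier := Z\<rparr>)" by (rule left_module.lin_ext_hom[OF Z idP])
  have hz': "?z \<in> mod_hom R (free_module R S) P"
    by (rule mod_homI) (use mod_hom_closed[OF hz] mod_hom_add[OF hz] mod_hom_smult[OF hz] ZP in auto)
  have 1: "?p x = \<phi> (?z x)" if "x \<in> carrier (free_module R S)" for x
    by (rule hom_free_eqI[OF lA hp mod_hom_comp[OF hz phi] _ that])
      (simp add: left_module.lin_ext_unit[OF lA phiP] left_module.lin_ext_unit[OF Z idP])
  have hi': "?i \<in> mod_hom R (free_module R S) (free_cover R P)"
    unfolding free_cover_def
    by (rule mod_hom_comp[OF hi free_module_incl]) (use free_moduleD(4)[OF iP'] in \<open>auto simp: B_def\<close>)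
  have 2: "cover_map R P (?i x) = ?z x" if "x \<in> carrier (free_module R S)" for x
    by (rule hom_free_eqI[OF lP mod_hom_comp[OF hi' cover_map_hom[OF lP]] hz' _ that])
      (simp add: left_module.lin_ext_unit[OF FB iP] left_module.lin_ext_unit[OF Z idP] i(2) SP)
  have p0: "?p x = \<zero>\<^bsub>A\<^esub>" if x: "x \<in> carrier (free_module R S)" "?i x = \<zero>\<^bsub>free_module R B\<^esub>" for x
  proof -
    have "?z x = \<zero>\<^bsub>P\<^esub>"
      using 2[OF x(1)] x(2) mod_hom_zero[OF free_cover_module[OF lP] lP cover_map_hom[OF lP]]
      by (simp add: free_cover_def free_module_simps)
    then show ?thesis using 1[OF x(1)] mod_hom_zero[OF Z lA phi] by simp
  qed
  obtain g where g: "g \<in> mod_hom R (free_module R B) A"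
    "\<And>x. x \<in> carrier (free_module R S) \<Longrightarrow> g (?i x) = ?p x"
    using fp_injectiveD[OF A S(1) B hi hp p0] by blast
  \<comment> \<open>Restriction to the coordinates in \<open>B\<close> makes \<open>g\<close>
    applicable to all of P and leaves every \<open>i s\<close> with \<open>s\<close> in
    \<open>S\<close> unchanged.\<close>
  let ?r = "\<lambda>f c. if c \<in> B then f c else \<zero>\<^bsub>R\<^esub>"
  have r: "?r \<in> mod_hom R (free_cover R P) (free_module R B)"
    unfolding free_cover_def by (rule free_restrict_hom[OF R])
  show ?thesis
  proof (rule that[OF mod_hom_comp[OF i(1) mod_hom_comp[OF r g(1)]]])
    fix s assume s: "s \<in> S"
    have "?r (i s) = i s" using free_moduleD(4)[OF iB[OF s]] by (intro ext) (metis (full_types))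
    also have "i s = ?i (free_unit R s)" by (simp add: left_module.lin_ext_unit[OF FB iP s])
    finally show "g (?r (i s)) = \<phi> s"
      using g(2)[OF free_unit_closed[OF R s]] left_module.lin_ext_unit[OF lA phiP s] by simp
  qed
qed

section \<open>Null homotopies\<close>

lemma minus_self_zero:
  assumes "left_module R M" "x \<in> carrier M"
  shows "x \<ominus>\<^bsub>M\<^esub> x = \<zero>\<^bsub>M\<^esub>" "x \<ominus>\<^bsub>M\<^esub> \<zero>\<^bsub>M\<^esub> = x"
proof -
  interpret left_module R M by fact
  show "x \<ominus>\<^bsub>M\<^esub> x = \<zero>\<^bsub>M\<^esub>" "x \<ominus>\<^bsub>M\<^esub> \<zero>\<^bsub>M\<^esub> = x"
    using assms(2) smult_minus_one[of "\<zero>\<^bsub>M\<^esub>"] by (simp_all add: a_minus_def M.r_neg)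
qed

lemma minus_minus_cancel:
  assumes "left_module R M" "x \<in> carrier M" "y \<in> carrier M"
  shows "x \<ominus>\<^bsub>M\<^esub> (x \<ominus>\<^bsub>M\<^esub> y) = y" "y \<oplus>\<^bsub>M\<^esub> (x \<ominus>\<^bsub>M\<^esub> y) = x" "(x \<ominus>\<^bsub>M\<^esub> y) \<oplus>\<^bsub>M\<^esub> y = x"
proof -
  interpret left_module R M by fact
  show "x \<ominus>\<^bsub>M\<^esub> (x \<ominus>\<^bsub>M\<^esub> y) = y"
    using assms(2,3) by (simp add: a_minus_def M.minus_add M.r_neg2 M.r_neg1)
  show "y \<oplus>\<^bsub>M\<^esub> (x \<ominus>\<^bsub>M\<^esub> y) = x"
    using assms(2,3) by (simp add: a_minus_def M.a_comm[of x] M.r_neg2)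
  show "(x \<ominus>\<^bsub>M\<^esub> y) \<oplus>\<^bsub>M\<^esub> y = x"
    using assms(2,3) by (simp add: a_minus_def M.a_assoc M.l_neg)
qed

text \<open>One degree of a null homotopy. Both conditions on \<open>t\<close> concern the kernel of
  \<open>e'\<close>, which contains the image of \<open>e\<close> and is finitely generated by
  coherence; a map found there extends because X is \<open>fp_injective\<close>. On a free cover of
  this kernel \<open>f\<close> lifts along \<open>\<delta>\<close>, and the lift is corrected by a
  map into the kernel of \<open>\<delta>\<close> so as to match \<open>h\<close> on the image of
  \<open>e\<close>.\<close>

lemma finite_free_extension:
  assumes coh: "left_coherent R" and fin: "finite U'" "finite U" "finite U''"
    and X: "fp_injective R X" and Y: "left_module R Y" and d: "\<delta> \<in> mod_hom R X Y"
    and K: "fp_injective R (kernel_module X Y \<delta>)"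
    and e: "e \<in> mod_hom R (free_module R U') (free_module R U)"
    and e': "e' \<in> mod_hom R (free_module R U) (free_module R U'')"
    and ee: "\<And>x. x \<in> carrier (free_module R U') \<Longrightarrow> e' (e x) = \<zero>\<^bsub>free_module R U''\<^esub>"
    and h: "h \<in> mod_hom R (free_module R U') X"
    and h0: "\<And>x. x \<in> carrier (free_module R U') \<Longrightarrow> e x = \<zero>\<^bsub>free_module R U\<^esub> \<Longrightarrow> h x = \<zero>\<^bsub>X\<^esub>"
    and f: "f \<in> mod_hom R (free_module R U) Y"
    and comm: "\<And>x. x \<in> carrier (free_module R U') \<Longrightarrow> \<delta> (h x) = f (e x)"
    and img: "\<And>x. x \<in> carrier (free_module R U) \<Longrightarrow> e' x = \<zero>\<^bsub>free_module R U''\<^esub> \<Longrightarrow> f x \<in> \<delta> ` carrier X"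
  shows "\<exists>t\<in>mod_hom R (free_module R U) X. (\<forall>x\<in>carrier (free_module R U'). t (e x) = h x) \<and>
    (\<forall>x\<in>carrier (free_module R U). e' x = \<zero>\<^bsub>free_module R U''\<^esub> \<longrightarrow> \<delta> (t x) = f x)"
proof -
  have R: "ring R" using coh by (simp add: left_coherent_def)
  have lX: "left_module R X" by (rule fp_injective_module[OF X])
  interpret X: left_module R X by (rule lX)
  interpret Y: left_module R Y by (rule Y)
  have F': "left_module R (free_module R U')" and FU: "left_module R (free_module R U)"
    by (rule left_module_free[OF R])+
  have Fp: "left_module R (free_pow R k)" for k by (rule left_module_free[OF R])
  interpret FU: left_module R "free_module R U" by (rule FU)
  interpret F': left_module R "free_module R U'" by (rule F')
  obtain p \<beta> where b: "\<beta> \<in> mod_hom R (free_pow R p) (free_module R U)"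
    and b_img: "\<beta> ` carrier (free_pow R p) = {x \<in> carrier (free_module R U). e' x = \<zero>\<^bsub>free_module R U''\<^esub>}"
    by (rule coherent_kernel[OF coh fin(2,3) e'])
  obtain q \<gamma> where g: "\<gamma> \<in> mod_hom R (free_pow R q) (free_pow R p)"
    and g_img: "\<gamma> ` carrier (free_pow R q) = {x \<in> carrier (free_pow R p). \<beta> x = \<zero>\<^bsub>free_module R U\<^esub>}"
    by (rule coherent_kernel[OF coh finite_lessThan fin(2) b])
  interpret Fp: left_module R "free_pow R p" by (rule Fp)
  interpret Fq: left_module R "free_pow R q" by (rule Fp)
  let ?I = "(free_module R U)\<lparr>carrier := \<beta> ` carrier (free_pow R p)\<rparr>"
  have I: "left_module R ?I" by (rule left_module_image[OF Fp FU b])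
  have bI: "\<beta> \<in> mod_hom R (free_pow R p) ?I" by (rule hom_to_submodule[OF b]) simp
  have eI: "e \<in> mod_hom R (free_module R U') ?I"
    by (rule hom_to_submodule[OF e]) (simp add: b_img ee mod_hom_closed[OF e])
  have onto1: "\<beta> ` carrier (free_pow R p) = carrier ?I" by simp
  obtain \<sigma> where s: "\<sigma> \<in> mod_hom R (free_module R U') (free_pow R p)"
    and s_eq: "\<And>x. x \<in> carrier (free_module R U') \<Longrightarrow> \<beta> (\<sigma> x) = e x"
    using lift_free[OF Fp I bI onto1 eI] by blast
  let ?D = "Y\<lparr>carrier := \<delta> ` carrier X\<rparr>"
  have D: "left_module R ?D" by (rule left_module_image[OF lX Y d])
  have dD: "\<delta> \<in> mod_hom R X ?D" by (rule hom_to_submodule[OF d]) simp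
  have bk: "\<beta> x \<in> carrier (free_module R U)" "e' (\<beta> x) = \<zero>\<^bsub>free_module R U''\<^esub>" if "x \<in> carrier (free_pow R p)" for x
    using b_img that by auto
  have fbD: "(\<lambda>x. f (\<beta> x)) \<in> mod_hom R (free_pow R p) ?D"
    by (rule hom_to_submodule[OF mod_hom_comp[OF b f]]) (simp add: img bk)
  have onto2: "\<delta> ` carrier X = carrier ?D" by simp
  obtain u where u: "u \<in> mod_hom R (free_pow R p) X"
    and u_eq: "\<And>x. x \<in> carrier (free_pow R p) \<Longrightarrow> \<delta> (u x) = f (\<beta> x)"
    using lift_free[OF lX D dD onto2 fbD] by blast
  \<comment> \<open>\<open>t\<close> will be defined by \<open>t (\<beta> x) = u x \<ominus> v x\<close>. This dictates \<open>v\<close> on the kernel of \<open>\<beta>\<close>, the image of \<open>\<gamma>\<close>,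
    and on the image of \<open>\<sigma>\<close>; there it takes values in the kernel of \<open>\<delta>\<close>, so that it extends.\<close>
  let ?W = "free_module R (Sum_Type.Plus {..<q} U')"
  have W: "left_module R ?W" by (rule left_module_free[OF R])
  have finW: "finite (Sum_Type.Plus {..<q} U')" using fin(1) by simp
  have l: "(\<lambda>z b. z (Inl b)) \<in> mod_hom R ?W (free_pow R q)"
    by (rule free_reindex_inj_hom[OF R]) auto
  have r: "(\<lambda>z b. z (Inr b)) \<in> mod_hom R ?W (free_module R U')"
    by (rule free_reindex_inj_hom[OF R]) auto
  define w where "w z = \<gamma> (\<lambda>b. z (Inl b)) \<oplus>\<^bsub>free_pow R p\<^esub> \<sigma> (\<lambda>b. z (Inr b))" for z
  have w: "w \<in> mod_hom R ?W (free_pow R p)"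
    unfolding w_def by (rule mod_hom_plus[OF Fp mod_hom_comp[OF l g] mod_hom_comp[OF r s] W])
  define k where "k z = u (w z) \<ominus>\<^bsub>X\<^esub> h (\<lambda>b. z (Inr b))" for z
  have k: "k \<in> mod_hom R ?W X"
    unfolding k_def by (rule mod_hom_minus[OF lX mod_hom_comp[OF w u] mod_hom_comp[OF r h] W])
  have bw: "\<beta> (w z) = e (\<lambda>b. z (Inr b))" if z: "z \<in> carrier ?W" for z
  proof -
    have zl: "(\<lambda>b. z (Inl b)) \<in> carrier (free_pow R q)" and zr: "(\<lambda>b. z (Inr b)) \<in> carrier (free_module R U')"
      using mod_hom_closed[OF l z] mod_hom_closed[OF r z] by auto
    have "\<beta> (w z) = \<beta> (\<gamma> (\<lambda>b. z (Inl b))) \<oplus>\<^bsub>free_module R U\<^esub> \<beta> (\<sigma> (\<lambda>b. z (Inr b)))"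
      unfolding w_def by (rule mod_hom_add[OF b mod_hom_closed[OF g zl] mod_hom_closed[OF s zr]])
    moreover have "\<beta> (\<gamma> (\<lambda>b. z (Inl b))) = \<zero>\<^bsub>free_module R U\<^esub>" using g_img zl by auto
    ultimately show ?thesis using s_eq[OF zr] mod_hom_closed[OF e zr] by simp
  qed
  have kK: "k \<in> mod_hom R ?W (kernel_module X Y \<delta>)"
  proof (rule mod_hom_kernelI[OF k])
    fix z assume z: "z \<in> carrier ?W"
    have zr: "(\<lambda>b. z (Inr b)) \<in> carrier (free_module R U')" using mod_hom_closed[OF r z] by auto
    show "\<delta> (k z) = \<zero>\<^bsub>Y\<^esub>" unfolding k_def
      by (rule mod_hom_diff_zero[OF lX Y d mod_hom_closed[OF mod_hom_comp[OF w u] z] mod_hom_closed[OF h zr]])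
        (simp add: u_eq[OF mod_hom_closed[OF w z]] comm[OF zr] bw[OF z])
  qed
  \<comment> \<open>Consistency of the prescription: \<open>\<beta> (w z)\<close> is the value of
    \<open>e\<close> at the second component of \<open>z\<close>, so if \<open>w z\<close> is zero,
    \<open>h0\<close> makes \<open>h\<close> vanish at that component.\<close>
  have k0: "k z = \<zero>\<^bsub>X\<^esub>" if z: "z \<in> carrier ?W" "w z = \<zero>\<^bsub>free_pow R p\<^esub>" for z
  proof -
    have zr: "(\<lambda>b. z (Inr b)) \<in> carrier (free_module R U')" using mod_hom_closed[OF r z(1)] by auto
    have "h (\<lambda>b. z (Inr b)) = \<zero>\<^bsub>X\<^esub>"
      using h0[OF zr] bw[OF z(1)] z(2) mod_hom_zero[OF Fp FU b] by simp
    then show ?thesis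
      unfolding k_def z(2) using mod_hom_zero[OF Fp lX u] minus_self_zero[OF lX X.M.zero_closed] by simp
  qed
  obtain v where v: "v \<in> mod_hom R (free_pow R p) (kernel_module X Y \<delta>)"
    and v_eq: "\<And>z. z \<in> carrier ?W \<Longrightarrow> v (w z) = k z"
    using fp_injectiveD[OF K finW finite_lessThan w kK] k0 by auto
  note v' = mod_hom_kernelD[OF v]
  have uv: "(\<lambda>x. u x \<ominus>\<^bsub>X\<^esub> v x) \<in> mod_hom R (free_pow R p) X" by (rule mod_hom_minus[OF lX u v'(1) Fp])
  have v1: "u (\<gamma> y) \<ominus>\<^bsub>X\<^esub> v (\<gamma> y) = \<zero>\<^bsub>X\<^esub>" if y: "y \<in> carrier (free_pow R q)" for y
  proof -
    let ?z = "case_sum y \<zero>\<^bsub>free_module R U'\<^esub>"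
    have z: "?z \<in> carrier ?W" by (rule case_sum_free_closed[OF y F'.M.zero_closed])
    have gy: "\<gamma> y \<in> carrier (free_pow R p)" by (rule mod_hom_closed[OF g y])
    have "w ?z = \<gamma> y" unfolding w_def using gy by (simp add: mod_hom_zero[OF F' Fp s])
    moreover have "k ?z = u (\<gamma> y)"
      unfolding k_def \<open>w ?z = \<gamma> y\<close> using mod_hom_closed[OF u gy]
      by (simp add: mod_hom_zero[OF F' lX h] minus_self_zero[OF lX])
    ultimately show ?thesis using v_eq[OF z] mod_hom_closed[OF u gy] by (simp add: minus_self_zero[OF lX])
  qed
  have v2: "u (\<sigma> x) \<ominus>\<^bsub>X\<^esub> v (\<sigma> x) = h x" if x: "x \<in> carrier (free_module R U')" for x
  proof -
    let ?z = "case_sum \<zero>\<^bsub>free_pow R q\<^esub> x"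
    have z: "?z \<in> carrier ?W" by (rule case_sum_free_closed[OF Fq.M.zero_closed x])
    have sx: "\<sigma> x \<in> carrier (free_pow R p)" by (rule mod_hom_closed[OF s x])
    have "w ?z = \<sigma> x" unfolding w_def using sx by (simp add: mod_hom_zero[OF Fp Fp g])
    moreover have "k ?z = u (\<sigma> x) \<ominus>\<^bsub>X\<^esub> h x"
      unfolding k_def \<open>w ?z = \<sigma> x\<close> by simp
    ultimately show ?thesis using v_eq[OF z] mod_hom_closed[OF u sx] mod_hom_closed[OF h x]
      by (simp add: minus_minus_cancel[OF lX])
  qed
  have uv0: "u x \<ominus>\<^bsub>X\<^esub> v x = \<zero>\<^bsub>X\<^esub>" if x: "x \<in> carrier (free_pow R p)" "\<beta> x = \<zero>\<^bsub>free_module R U\<^esub>" for x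
  proof -
    have "x \<in> \<gamma> ` carrier (free_pow R q)" unfolding g_img using x by simp
    then show ?thesis using v1 by auto
  qed
  obtain t where t: "t \<in> mod_hom R (free_module R U) X"
    and t_eq: "\<And>x. x \<in> carrier (free_pow R p) \<Longrightarrow> t (\<beta> x) = u x \<ominus>\<^bsub>X\<^esub> v x"
    using fp_injectiveD[OF X finite_lessThan fin(2) b uv uv0] by blast
  show ?thesis
  proof (rule bexI[OF _ t], intro conjI ballI impI)
    fix x assume x: "x \<in> carrier (free_module R U')"
    show "t (e x) = h x" using t_eq[OF mod_hom_closed[OF s x]] s_eq[OF x] v2[OF x] by simp
  next
    fix x assume "x \<in> carrier (free_module R U)" "e' x = \<zero>\<^bsub>free_module R U''\<^esub>"
    then have "x \<in> \<beta> ` carrier (free_pow R p)" unfolding b_img by simp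
    then obtain y where y: "y \<in> carrier (free_pow R p)" "x = \<beta> y" by auto
    have "\<delta> (t x) = \<delta> (u y) \<ominus>\<^bsub>Y\<^esub> \<delta> (v y)"
      unfolding y(2) t_eq[OF y(1)]
      by (rule mod_hom_diff[OF lX Y d mod_hom_closed[OF u y(1)] mod_hom_closed[OF v'(1) y(1)]])
    also have "\<dots> = f x"
      using v'(2)[OF y(1)] u_eq[OF y(1)] mod_hom_closed[OF mod_hom_comp[OF b f] y(1)] y(2)
      by (simp add: minus_self_zero[OF Y])
    finally show "\<delta> (t x) = f x" .
  qed
qed

text \<open>The target of the homotopies. Neither terms nor cycles are assumed injective, so
  homotopies have to come from coherence and finiteness. Exactness is asked in positive degrees; in
  degree 0 the coresolution has A itself.\<close>

locale fp_injective_complex =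
  fixes R :: "('r, 'x) ring_scheme" and X :: "nat \<Rightarrow> ('r, 'u) module" and \<delta> :: "nat \<Rightarrow> 'u \<Rightarrow> 'u"
  assumes coh: "left_coherent R"
    and X: "fp_injective R (X k)"
    and \<delta>: "\<delta> k \<in> mod_hom R (X k) (X (Suc k))"
    and cycles: "fp_injective R (kernel_module (X k) (X (Suc k)) (\<delta> k))"
    and exact: "\<delta> k ` carrier (X k) = {x \<in> carrier (X (Suc k)). \<delta> (Suc k) x = \<zero>\<^bsub>X (Suc (Suc k))\<^esub>}"
begin

lemma ring: "ring R" using coh by (simp add: left_coherent_def)

lemma module_X: "left_module R (X k)" by (rule fp_injective_module[OF X])

lemma \<delta>\<delta>: "x \<in> carrier (X k) \<Longrightarrow> \<delta> (Suc k) (\<delta> k x) = \<zero>\<^bsub>X (Suc (Suc k))\<^esub>"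
  using exact[of k] by blast

text \<open>That \<open>\<delta> k (t x)\<close> equals \<open>f k x\<close> on the kernel of
  \<open>e k\<close> is what makes \<open>f k - \<delta> k t\<close> factor through
  \<open>e k\<close>. This difference prescribes the next \<open>t\<close> on the image of
  \<open>e k\<close>, and the next \<open>t\<close> is chosen to satisfy the same condition one
  degree up.\<close>

lemma finite_null_homotopy:
  fixes U :: "nat \<Rightarrow> 'b set"
  assumes fin: "\<And>k. finite (U k)"
    and e: "\<And>k. e k \<in> mod_hom R (free_module R (U k)) (free_module R (U (Suc k)))"
    and ee: "\<And>k x. x \<in> carrier (free_module R (U k)) \<Longrightarrow> e (Suc k) (e k x) = \<zero>\<^bsub>free_module R (U (Suc (Suc k)))\<^esub>"
    and f: "\<And>k. f k \<in> mod_hom R (free_module R (U k)) (X (Suc k))"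
    and comm: "\<And>k x. x \<in> carrier (free_module R (U k)) \<Longrightarrow> \<delta> (Suc k) (f k x) = f (Suc k) (e k x)"
  obtains t where "\<And>k. t k \<in> mod_hom R (free_module R (U k)) (X k)"
    "\<And>k x. x \<in> carrier (free_module R (U k)) \<Longrightarrow> f k x = \<delta> k (t k x) \<oplus>\<^bsub>X (Suc k)\<^esub> t (Suc k) (e k x)"
proof -
  have F: "left_module R (free_module R (U k))" for k by (rule left_module_free[OF ring])
  define P where "P k t \<longleftrightarrow> t \<in> mod_hom R (free_module R (U k)) (X k) \<and>
     (\<forall>x\<in>carrier (free_module R (U k)). e k x = \<zero>\<^bsub>free_module R (U (Suc k))\<^esub> \<longrightarrow> \<delta> k (t x) = f k x)" for k t
  define Q where "Q k t t' \<longleftrightarrow> (\<forall>x\<in>carrier (free_module R (U k)). f k x = \<delta> k (t x) \<oplus>\<^bsub>X (Suc k)\<^esub> t' (e k x))"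
    for k t t'
  have img: "f k x \<in> \<delta> k ` carrier (X k)"
    if "x \<in> carrier (free_module R (U k))" "e k x = \<zero>\<^bsub>free_module R (U (Suc k))\<^esub>" for k x
    unfolding exact using comm[OF that(1)] that mod_hom_closed[OF f that(1)] mod_hom_zero[OF F module_X f] by simp
  have 0: "\<exists>t. P 0 t"
  proof -
    \<comment> \<open>No degree precedes 0: with the empty basis in the role of \<open>U'\<close>,
      only the condition on the kernel of \<open>e 0\<close> remains.\<close>
    have z: "(\<lambda>x. \<zero>\<^bsub>free_module R (U 0)\<^esub>) \<in> mod_hom R (free_module R {}) (free_module R (U 0))"
      by (rule mod_hom_const_zero[OF F])
    have z': "(\<lambda>x. \<zero>\<^bsub>X 0\<^esub>) \<in> mod_hom R (free_module R {}) (X 0)"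
      by (rule mod_hom_const_zero[OF module_X])
    have "\<exists>t\<in>mod_hom R (free_module R (U 0)) (X 0).
        (\<forall>x\<in>carrier (free_module R ({} :: 'b set)). t \<zero>\<^bsub>free_module R (U 0)\<^esub> = \<zero>\<^bsub>X 0\<^esub>) \<and>
        (\<forall>x\<in>carrier (free_module R (U 0)). e 0 x = \<zero>\<^bsub>free_module R (U (Suc 0))\<^esub> \<longrightarrow> \<delta> 0 (t x) = f 0 x)"
    proof (rule finite_free_extension[OF coh finite.emptyI fin fin X module_X \<delta> cycles z e _ z' _ f])
      show "e 0 \<zero>\<^bsub>free_module R (U 0)\<^esub> = \<zero>\<^bsub>free_module R (U (Suc 0))\<^esub>" by (rule mod_hom_zero[OF F F e])
      show "\<delta> 0 \<zero>\<^bsub>X 0\<^esub> = f 0 \<zero>\<^bsub>free_module R (U 0)\<^esub>"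
        by (simp add: mod_hom_zero[OF module_X module_X \<delta>] mod_hom_zero[OF F module_X f])
    qed (rule refl, rule img)
    then show ?thesis unfolding P_def by blast
  qed
  have step: "\<exists>t'. P (Suc k) t' \<and> Q k t t'" if "P k t" for k t
  proof -
    have t: "t \<in> mod_hom R (free_module R (U k)) (X k)"
      and tk: "\<And>x. x \<in> carrier (free_module R (U k)) \<Longrightarrow> e k x = \<zero>\<^bsub>free_module R (U (Suc k))\<^esub> \<Longrightarrow> \<delta> k (t x) = f k x"
      using that by (auto simp: P_def)
    note dt = mod_hom_comp[OF t \<delta>]
    have h: "(\<lambda>x. f k x \<ominus>\<^bsub>X (Suc k)\<^esub> \<delta> k (t x)) \<in> mod_hom R (free_module R (U k)) (X (Suc k))"
      by (rule mod_hom_minus[OF module_X f dt F])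
    have h0: "f k x \<ominus>\<^bsub>X (Suc k)\<^esub> \<delta> k (t x) = \<zero>\<^bsub>X (Suc k)\<^esub>"
      if "x \<in> carrier (free_module R (U k))" "e k x = \<zero>\<^bsub>free_module R (U (Suc k))\<^esub>" for x
      using tk[OF that] minus_self_zero(1)[OF module_X mod_hom_closed[OF f that(1)]] by simp
    have hc: "\<delta> (Suc k) (f k x \<ominus>\<^bsub>X (Suc k)\<^esub> \<delta> k (t x)) = f (Suc k) (e k x)"
      if x: "x \<in> carrier (free_module R (U k))" for x
    proof -
      have "\<delta> (Suc k) (f k x \<ominus>\<^bsub>X (Suc k)\<^esub> \<delta> k (t x)) = \<delta> (Suc k) (f k x) \<ominus>\<^bsub>X (Suc (Suc k))\<^esub> \<delta> (Suc k) (\<delta> k (t x))"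
        by (rule mod_hom_diff[OF module_X module_X \<delta> mod_hom_closed[OF f x] mod_hom_closed[OF dt x]])
      then show ?thesis
        using \<delta>\<delta>[OF mod_hom_closed[OF t x]] comm[OF x] mod_hom_closed[OF mod_hom_comp[OF e f] x]
        by (simp add: minus_self_zero[OF module_X])
    qed
    obtain t' where t': "t' \<in> mod_hom R (free_module R (U (Suc k))) (X (Suc k))"
      "\<And>x. x \<in> carrier (free_module R (U k)) \<Longrightarrow> t' (e k x) = f k x \<ominus>\<^bsub>X (Suc k)\<^esub> \<delta> k (t x)"
      "\<And>x. x \<in> carrier (free_module R (U (Suc k))) \<Longrightarrow> e (Suc k) x = \<zero>\<^bsub>free_module R (U (Suc (Suc k)))\<^esub> \<Longrightarrow>
        \<delta> (Suc k) (t' x) = f (Suc k) x"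
      using finite_free_extension[OF coh fin fin fin X module_X \<delta> cycles e e ee h h0 f hc img] by blast
    have "Q k t t'"
      unfolding Q_def using t'(2) mod_hom_closed[OF f] mod_hom_closed[OF dt]
      by (simp add: minus_minus_cancel[OF module_X])
    moreover have "P (Suc k) t'" unfolding P_def using t'(1,3) by blast
    ultimately show ?thesis by blast
  qed
  obtain t where "\<And>k. P k (t k) \<and> Q k (t k) (t (Suc k))"
    using dependent_nat_choice[of P Q] 0 step by metis
  then show ?thesis using that[of t] by (auto simp: P_def Q_def)
qed

end

section \<open>From finite to arbitrary bases\<close>

lemma hom_free_support:
  fixes B :: "'b set" and C D' :: "'c set"
  assumes R: "ring R" and e: "e \<in> mod_hom R (free_module R B) (free_module R C)" and D: "D \<subseteq> B"
    and supp: "\<And>b c. b \<in> D \<Longrightarrow> e (free_unit R b) c \<noteq> \<zero>\<^bsub>R\<^esub> \<Longrightarrow> c \<in> D'"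
    and x: "x \<in> carrier (free_module R D)"
  shows "e x \<in> carrier (free_module R D')"
proof -
  have F: "left_module R (free_module R Y)" for Y :: "'c set" by (rule left_module_free[OF R])
  have phi: "(\<lambda>b. e (free_unit R b)) \<in> D \<rightarrow> carrier (free_module R (C \<inter> D'))"
  proof (rule Pi_I)
    fix b assume b: "b \<in> D"
    have "e (free_unit R b) \<in> carrier (free_module R C)"
      using b D by (intro mod_hom_closed[OF e] free_unit_closed[OF R]) auto
    then show "e (free_unit R b) \<in> carrier (free_module R (C \<inter> D'))"
      using supp[OF b] by (auto simp: free_module_def)
  qed
  let ?g = "lin_ext R (free_module R (C \<inter> D')) (\<lambda>b. e (free_unit R b))"
  have g: "?g \<in> mod_hom R (free_module R D) (free_module R (C \<inter> D'))" by (rule left_module.lin_ext_hom[OF F phi])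
  have "e x = ?g x"
    by (rule hom_free_eqI[OF F mod_hom_comp[OF free_module_incl[OF D] e]
          mod_hom_comp[OF g free_module_incl[OF Int_lower1]] _ x])
      (simp add: left_module.lin_ext_unit[OF F phi])
  then show ?thesis
    using mod_hom_closed[OF mod_hom_comp[OF g free_module_incl[OF Int_lower2]] x] by simp
qed

context fp_injective_complex
begin

text \<open>The error \<open>f'\<close> of \<open>T\<close> is a chain map vanishing on the
  subcomplex spanned by \<open>D\<close>, hence lives on the quotient of the enlarged subcomplex by
  it. This quotient is free on the finite sets \<open>U k\<close>; a null homotopy of
  \<open>f'\<close> there, pulled back along \<open>r\<close>, corrects \<open>T\<close> without
  changing it on \<open>D\<close>. Keeping \<open>T\<close> total and requiring the equation on
  \<open>D\<close> only avoids partial maps.\<close>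

lemma null_homotopy_extend:
  fixes B :: "nat \<Rightarrow> 'b set"
  assumes e: "\<And>k. e k \<in> mod_hom R (free_module R (B k)) (free_module R (B (Suc k)))"
    and ee: "\<And>k x. x \<in> carrier (free_module R (B k)) \<Longrightarrow> e (Suc k) (e k x) = \<zero>\<^bsub>free_module R (B (Suc (Suc k)))\<^esub>"
    and f: "\<And>k. f k \<in> mod_hom R (free_module R (B k)) (X (Suc k))"
    and comm: "\<And>k x. x \<in> carrier (free_module R (B k)) \<Longrightarrow> \<delta> (Suc k) (f k x) = f (Suc k) (e k x)"
    and D: "\<And>k. D k \<subseteq> B k"
    and closed: "\<And>k b c. b \<in> D k \<Longrightarrow> e k (free_unit R b) c \<noteq> \<zero>\<^bsub>R\<^esub> \<Longrightarrow> c \<in> D (Suc k)"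
    and T: "\<And>k. T k \<in> mod_hom R (free_module R (B k)) (X k)"
    and eq: "\<And>k x. x \<in> carrier (free_module R (D k)) \<Longrightarrow> f k x = \<delta> k (T k x) \<oplus>\<^bsub>X (Suc k)\<^esub> T (Suc k) (e k x)"
    and b0: "b0 \<in> B k0"
  obtains D' T' where "\<And>k. D' k \<subseteq> B k" "\<And>k. D k \<subseteq> D' k" "b0 \<in> D' k0"
    "\<And>k b c. b \<in> D' k \<Longrightarrow> e k (free_unit R b) c \<noteq> \<zero>\<^bsub>R\<^esub> \<Longrightarrow> c \<in> D' (Suc k)"
    "\<And>k. T' k \<in> mod_hom R (free_module R (B k)) (X k)"
    "\<And>k b. b \<in> D k \<Longrightarrow> T' k (free_unit R b) = T k (free_unit R b)"
    "\<And>k x. x \<in> carrier (free_module R (D' k)) \<Longrightarrow> f k x = \<delta> k (T' k x) \<oplus>\<^bsub>X (Suc k)\<^esub> T' (Suc k) (e k x)"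
proof -
  interpret R: ring R by (rule ring)
  have F: "left_module R (free_module R Y)" for Y :: "'b set" by (rule left_module_free[OF ring])
  interpret X: left_module R "X k" for k by (rule module_X)
  \<comment> \<open>The closure of \<open>b0\<close> under \<open>e\<close> is finite in each degree because elements of free modules have finite
    support. This makes the finite case applicable to the quotient by \<open>D\<close>.\<close>
  define E where "E = rec_nat (if k0 = 0 then {b0} else {})
    (\<lambda>k Ek. (\<Union>b\<in>Ek. {c. e k (free_unit R b) c \<noteq> \<zero>\<^bsub>R\<^esub>}) \<union> (if Suc k = k0 then {b0} else {}))"
  have E0: "E 0 = (if k0 = 0 then {b0} else {})" by (simp add: E_def)
  have ES: "E (Suc k) = (\<Union>b\<in>E k. {c. e k (free_unit R b) c \<noteq> \<zero>\<^bsub>R\<^esub>}) \<union> (if Suc k = k0 then {b0} else {})" for k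
    by (simp add: E_def)
  have eu: "e k (free_unit R b) \<in> carrier (free_module R (B (Suc k)))" if "b \<in> B k" for k b
    by (rule mod_hom_closed[OF e free_unit_closed[OF ring that]])
  have E: "finite (E k) \<and> E k \<subseteq> B k" for k
  proof (induction k)
    case 0
    then show ?case using b0 by (auto simp: E0)
  next
    case (Suc k)
    then have "finite {c. e k (free_unit R b) c \<noteq> \<zero>\<^bsub>R\<^esub>} \<and> {c. e k (free_unit R b) c \<noteq> \<zero>\<^bsub>R\<^esub>} \<subseteq> B (Suc k)"
      if "b \<in> E k" for b using that free_moduleD(2,3)[OF eu[of b k]] by auto
    then show ?case using Suc b0 by (auto simp: ES)
  qed
  have b0E: "b0 \<in> E k0" by (cases k0) (simp_all add: E0 ES)
  define U where "U k = E k - D k" for k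
  define D' where "D' k = D k \<union> E k" for k
  have U: "finite (U k)" "U k \<subseteq> B k" "U k \<subseteq> D' k" for k using E by (auto simp: U_def D'_def)
  have D': "D' k \<subseteq> B k" for k using D E by (auto simp: D'_def)
  have closed': "c \<in> D' (Suc k)" if "b \<in> D' k" "e k (free_unit R b) c \<noteq> \<zero>\<^bsub>R\<^esub>" for k b c
    using that closed by (auto simp: D'_def ES)
  note DB = mod_hom_closed[OF free_module_incl[OF D]] and UB = mod_hom_closed[OF free_module_incl[OF U(2)]]
    and D'B = mod_hom_closed[OF free_module_incl[OF D']] and UD' = mod_hom_closed[OF free_module_incl[OF U(3)]]
  have eD: "e k x \<in> carrier (free_module R (D (Suc k)))" if "x \<in> carrier (free_module R (D k))" for k x
    by (rule hom_free_support[OF ring e D closed that])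
  have eD': "e k x \<in> carrier (free_module R (D' (Suc k)))" if "x \<in> carrier (free_module R (D' k))" for k x
    by (rule hom_free_support[OF ring e D' closed' that])

  \<comment> \<open>In coordinates, \<open>r\<close> is the map to the quotient by the span of
    \<open>D\<close>, and \<open>s\<close> the projection to that span. \<open>e\<close> preserves
    the span of \<open>D\<close> but not that of \<open>U\<close>, so the differential of the
    quotient is \<open>e\<close> followed by \<open>r\<close>.\<close>
  define r where "r k f = (\<lambda>c. if c \<in> U k then f c else \<zero>\<^bsub>R\<^esub>)" for k f
  define s where "s k f = (\<lambda>c. if c \<in> D k then f c else \<zero>\<^bsub>R\<^esub>)" for k f
  have r: "r k \<in> mod_hom R (free_module R Y) (free_module R (U k))" for k Y
    unfolding r_def by (rule free_restrict_hom[OF ring])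
  have s: "s k \<in> mod_hom R (free_module R Y) (free_module R (D k))" for k Y
    unfolding s_def by (rule free_restrict_hom[OF ring])
  have rD: "r k x = \<zero>\<^bsub>free_module R (U k)\<^esub>" if "x \<in> carrier (free_module R (D k))" for k x
    using free_moduleD(4)[OF that] unfolding r_def free_module_simps by (intro ext) (auto simp: U_def)
  have split: "x = s k x \<oplus>\<^bsub>free_module R (B k)\<^esub> r k x" if "x \<in> carrier (free_module R (D' k))" for k x
  proof
    fix c
    have "x c \<in> carrier R" "c \<notin> D' k \<Longrightarrow> x c = \<zero>\<^bsub>R\<^esub>"
      using free_moduleD(1,4)[OF that] by auto
    then show "x c = (s k x \<oplus>\<^bsub>free_module R (B k)\<^esub> r k x) c"
      by (auto simp: free_module_simps r_def s_def U_def D'_def)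
  qed
  have hom_split: "h x = h (s k x) \<oplus>\<^bsub>M\<^esub> h (r k x)"
    if "h \<in> mod_hom R (free_module R (B k)) M" "x \<in> carrier (free_module R (D' k))" for h M k x
    using mod_hom_add[OF that(1) DB[OF mod_hom_closed[OF s that(2)]] UB[OF mod_hom_closed[OF r that(2)]]]
      split[OF that(2)] by simp

  define f' where "f' k x = f k x \<ominus>\<^bsub>X (Suc k)\<^esub> (\<delta> k (T k x) \<oplus>\<^bsub>X (Suc k)\<^esub> T (Suc k) (e k x))" for k x
  have dT: "(\<lambda>x. \<delta> k (T k x)) \<in> mod_hom R (free_module R (B k)) (X (Suc k))" for k
    by (rule mod_hom_comp[OF T \<delta>])
  have Te: "(\<lambda>x. T (Suc k) (e k x)) \<in> mod_hom R (free_module R (B k)) (X (Suc k))" for k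
    by (rule mod_hom_comp[OF e T])
  have dTe: "(\<lambda>x. \<delta> k (T k x) \<oplus>\<^bsub>X (Suc k)\<^esub> T (Suc k) (e k x)) \<in> mod_hom R (free_module R (B k)) (X (Suc k))" for k
    by (rule mod_hom_plus[OF module_X dT Te F])
  have f': "f' k \<in> mod_hom R (free_module R (B k)) (X (Suc k))" for k
    unfolding f'_def by (rule mod_hom_minus[OF module_X f dTe F])
  have f'D: "f' k x = \<zero>\<^bsub>X (Suc k)\<^esub>" if "x \<in> carrier (free_module R (D k))" for k x
    unfolding f'_def eq[OF that] by (rule minus_self_zero(1)[OF module_X mod_hom_closed[OF dTe DB[OF that]]])
  have f'r: "f' k x = f' k (r k x)" if "x \<in> carrier (free_module R (D' k))" for k x
    using hom_split[OF f' that] f'D[OF mod_hom_closed[OF s that]]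
      mod_hom_closed[OF f' UB[OF mod_hom_closed[OF r that]]] by simp
  have re: "r (Suc k) (e k x) = r (Suc k) (e k (r k x))" if "x \<in> carrier (free_module R (D' k))" for k x
  proof -
    interpret FU: left_module R "free_module R (U (Suc k))" by (rule F)
    show ?thesis
      using hom_split[OF mod_hom_comp[OF e r] that] rD[OF eD[OF mod_hom_closed[OF s that]]]
        mod_hom_closed[OF mod_hom_comp[OF e r] UB[OF mod_hom_closed[OF r that]]] by simp
  qed
  have f'_comm: "\<delta> (Suc k) (f' k x) = f' (Suc k) (e k x)" if x: "x \<in> carrier (free_module R (B k))" for k x
  proof -
    have c1: "T k x \<in> carrier (X k)" "\<delta> k (T k x) \<in> carrier (X (Suc k))"
      "T (Suc k) (e k x) \<in> carrier (X (Suc k))" "\<delta> (Suc k) (T (Suc k) (e k x)) \<in> carrier (X (Suc (Suc k)))"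
      "f k x \<in> carrier (X (Suc k))"
      by (rule mod_hom_closed[OF T x] mod_hom_closed[OF dT x] mod_hom_closed[OF Te x]
          mod_hom_closed[OF mod_hom_comp[OF Te \<delta>] x] mod_hom_closed[OF f x])+
    have "\<delta> (Suc k) (f' k x) = \<delta> (Suc k) (f k x) \<ominus>\<^bsub>X (Suc (Suc k))\<^esub>
        (\<delta> (Suc k) (\<delta> k (T k x)) \<oplus>\<^bsub>X (Suc (Suc k))\<^esub> \<delta> (Suc k) (T (Suc k) (e k x)))"
      unfolding f'_def
      by (subst mod_hom_diff[OF module_X module_X \<delta>]) (use c1 in \<open>simp_all add: mod_hom_add[OF \<delta>]\<close>)
    also have "\<dots> = f (Suc k) (e k x) \<ominus>\<^bsub>X (Suc (Suc k))\<^esub> \<delta> (Suc k) (T (Suc k) (e k x))"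
      using c1 by (simp add: comm[OF x] \<delta>\<delta>)
    also have "\<dots> = f' (Suc k) (e k x)"
      unfolding f'_def using c1 by (simp add: ee[OF x] mod_hom_zero[OF F module_X T])
    finally show ?thesis .
  qed

  define eQ where "eQ k x = r (Suc k) (e k x)" for k x
  note U_B = free_module_incl[OF U(2)]
  have eQ: "eQ k \<in> mod_hom R (free_module R (U k)) (free_module R (U (Suc k)))" for k
    unfolding eQ_def by (rule mod_hom_comp[OF mod_hom_comp[OF U_B e] r])
  have eQeQ: "eQ (Suc k) (eQ k x) = \<zero>\<^bsub>free_module R (U (Suc (Suc k)))\<^esub>"
    if x: "x \<in> carrier (free_module R (U k))" for k x
    unfolding eQ_def re[OF eD'[OF UD'[OF x]], symmetric] ee[OF UB[OF x]] by (rule mod_hom_zero[OF F F r])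
  have f'U: "f' k \<in> mod_hom R (free_module R (U k)) (X (Suc k))" for k by (rule mod_hom_comp[OF U_B f'])
  have f'Q: "\<delta> (Suc k) (f' k x) = f' (Suc k) (eQ k x)" if x: "x \<in> carrier (free_module R (U k))" for k x
    unfolding eQ_def f'_comm[OF UB[OF x]] by (rule f'r[OF eD'[OF UD'[OF x]]])
  obtain t where t: "\<And>k. t k \<in> mod_hom R (free_module R (U k)) (X k)"
    "\<And>k x. x \<in> carrier (free_module R (U k)) \<Longrightarrow> f' k x = \<delta> k (t k x) \<oplus>\<^bsub>X (Suc k)\<^esub> t (Suc k) (eQ k x)"
    by (rule finite_null_homotopy[of U eQ f', OF U(1) eQ eQeQ f'U f'Q]) (assumption+, rule that)

  define T' where "T' k x = T k x \<oplus>\<^bsub>X k\<^esub> t k (r k x)" for k x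
  have T': "T' k \<in> mod_hom R (free_module R (B k)) (X k)" for k
    unfolding T'_def by (rule mod_hom_plus[OF module_X T mod_hom_comp[OF r t(1)] F])
  show ?thesis
  proof (rule that[of D' T'])
    show "T' k (free_unit R b) = T k (free_unit R b)" if b: "b \<in> D k" for k b
    proof -
      have "free_unit R b \<in> carrier (free_module R (D k))" by (rule free_unit_closed[OF ring b])
      then show ?thesis
        using mod_hom_closed[OF T DB] by (simp add: T'_def rD mod_hom_zero[OF F module_X t(1)])
    qed
    show "f k x = \<delta> k (T' k x) \<oplus>\<^bsub>X (Suc k)\<^esub> T' (Suc k) (e k x)" if x: "x \<in> carrier (free_module R (D' k))" for k x
    proof -
      have xB: "x \<in> carrier (free_module R (B k))" by (rule D'B[OF x])
      have rx: "r k x \<in> carrier (free_module R (U k))" by (rule mod_hom_closed[OF r xB])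
      have ex: "e k x \<in> carrier (free_module R (B (Suc k)))" by (rule mod_hom_closed[OF e xB])
      have c: "T k x \<in> carrier (X k)" "t k (r k x) \<in> carrier (X k)" "\<delta> k (T k x) \<in> carrier (X (Suc k))"
        "T (Suc k) (e k x) \<in> carrier (X (Suc k))" "\<delta> k (t k (r k x)) \<in> carrier (X (Suc k))"
        "t (Suc k) (r (Suc k) (e k x)) \<in> carrier (X (Suc k))" "f k x \<in> carrier (X (Suc k))"
        by (rule mod_hom_closed[OF T xB] mod_hom_closed[OF t(1) rx] mod_hom_closed[OF dT xB]
            mod_hom_closed[OF Te xB] mod_hom_closed[OF mod_hom_comp[OF t(1) \<delta>] rx]
            mod_hom_closed[OF mod_hom_comp[OF r t(1)] ex] mod_hom_closed[OF f xB])+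
      have "f' k x = \<delta> k (t k (r k x)) \<oplus>\<^bsub>X (Suc k)\<^esub> t (Suc k) (r (Suc k) (e k x))"
        unfolding f'r[OF x] t(2)[OF rx] eQ_def re[OF x] ..
      moreover have "f k x = f' k x \<oplus>\<^bsub>X (Suc k)\<^esub> (\<delta> k (T k x) \<oplus>\<^bsub>X (Suc k)\<^esub> T (Suc k) (e k x))"
        unfolding f'_def using c by (simp add: minus_minus_cancel[OF module_X])
      ultimately show ?thesis
        unfolding T'_def using c by (simp add: mod_hom_add[OF \<delta>] X.M.a_ac)
    qed
    show "b0 \<in> D' k0" using b0E by (simp add: D'_def)
    show "D k \<subseteq> D' k" for k by (simp add: D'_def)
  qed (fact D' closed' T')+
qed

text \<open>Zorn's lemma is applied to partial homotopies in all degrees together, because adjoining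
  one basis element forces others in higher degrees to be adjoined.\<close>

lemma null_homotopy:
  fixes B :: "nat \<Rightarrow> 'b set"
  assumes e: "\<And>k. e k \<in> mod_hom R (free_module R (B k)) (free_module R (B (Suc k)))"
    and ee: "\<And>k x. x \<in> carrier (free_module R (B k)) \<Longrightarrow> e (Suc k) (e k x) = \<zero>\<^bsub>free_module R (B (Suc (Suc k)))\<^esub>"
    and f: "\<And>k. f k \<in> mod_hom R (free_module R (B k)) (X (Suc k))"
    and comm: "\<And>k x. x \<in> carrier (free_module R (B k)) \<Longrightarrow> \<delta> (Suc k) (f k x) = f (Suc k) (e k x)"
  obtains T where "\<And>k. T k \<in> mod_hom R (free_module R (B k)) (X k)"
    "\<And>k x. x \<in> carrier (free_module R (B k)) \<Longrightarrow> f k x = \<delta> k (T k x) \<oplus>\<^bsub>X (Suc k)\<^esub> T (Suc k) (e k x)"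
proof -
  interpret R: ring R by (rule ring)
  have F: "left_module R (free_module R Y)" for Y :: "'b set" by (rule left_module_free[OF ring])
  interpret X: left_module R "X k" for k by (rule module_X)
  let ?u = "free_unit R"
  have eu: "e k (?u b) \<in> carrier (free_module R (B (Suc k)))" if "b \<in> B k" for k b
    by (rule mod_hom_closed[OF e free_unit_closed[OF ring that]])
  \<comment> \<open>A partial homotopy is a graph \<open>G\<close> of values on basis elements. The homotopy equation at one basis
    element involves finitely many values, hence survives unions of chains.\<close>
  define ok where "ok G k b x \<longleftrightarrow> b \<in> B k \<and> x \<in> carrier (X k) \<and>
      (\<exists>\<sigma>. (\<forall>c. e k (?u b) c \<noteq> \<zero>\<^bsub>R\<^esub> \<longrightarrow> ((Suc k, c), \<sigma> c) \<in> G) \<and>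
        f k (?u b) = \<delta> k x \<oplus>\<^bsub>X (Suc k)\<^esub> lin_ext R (X (Suc k)) \<sigma> (e k (?u b)))"
    for G :: "((nat \<times> 'b) \<times> 'u) set" and k b x
  have ok_mono: "ok G' k b x" if "ok G k b x" "G \<subseteq> G'" for G G' k b x
    using that unfolding ok_def by (meson subsetD)
  define \<G> where "\<G> = {G. single_valued G \<and> (\<forall>k b x. ((k, b), x) \<in> G \<longrightarrow> ok G k b x)}"
  have "\<exists>M\<in>\<G>. \<forall>G\<in>\<G>. M \<subseteq> G \<longrightarrow> G = M"
  proof (rule subset_Zorn_nonempty)
    show "\<G> \<noteq> {}" by (auto simp: \<G>_def single_valued_def intro!: exI[of _ "{}"])
    fix \<C> assume ne: "\<C> \<noteq> {}" and chain: "subset.chain \<G> \<C>"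
    have "single_valued (\<Union>\<C>)"
    proof (rule single_valuedI)
      fix p x y assume "(p, x) \<in> \<Union>\<C>" "(p, y) \<in> \<Union>\<C>"
      then obtain G H where GH: "G \<in> \<C>" "H \<in> \<C>" "(p, x) \<in> G" "(p, y) \<in> H" by blast
      then have "G \<subseteq> H \<or> H \<subseteq> G" "single_valued G" "single_valued H"
        using chain by (auto simp: subset_chain_def \<G>_def)
      then show "x = y" using GH(3,4) by (meson single_valuedD subsetD)
    qed
    moreover have "ok (\<Union>\<C>) k b x" if kbx: "((k, b), x) \<in> \<Union>\<C>" for k b x
    proof -
      obtain G where G: "G \<in> \<C>" "((k, b), x) \<in> G" using kbx by blast
      then have "ok G k b x" using chain by (auto simp: subset_chain_def \<G>_def)
      then show ?thesis by (rule ok_mono) (use G in blast)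
    qed
    ultimately show "\<Union>\<C> \<in> \<G>" by (simp add: \<G>_def)
  qed
  then obtain M where M: "single_valued M" "\<And>k b x. ((k, b), x) \<in> M \<Longrightarrow> ok M k b x"
    and max: "\<And>G. G \<in> \<G> \<Longrightarrow> M \<subseteq> G \<Longrightarrow> G = M" by (auto simp: \<G>_def)
  define D where "D k = {b. \<exists>x. ((k, b), x) \<in> M}" for k
  \<comment> \<open>The value zero off \<open>D\<close> makes \<open>T\<close> total, as
    \<open>null_homotopy_extend\<close> requires.\<close>
  define \<tau> where "\<tau> k b = (if b \<in> D k then THE x. ((k, b), x) \<in> M else \<zero>\<^bsub>X k\<^esub>)" for k b
  have tau_eq: "\<tau> k b = x" if "((k, b), x) \<in> M" for k b x
    using that single_valuedD[OF M(1)] by (auto simp: \<tau>_def D_def)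
  have tau: "\<tau> k \<in> Y \<rightarrow> carrier (X k)" for k Y
  proof (rule Pi_I)
    fix b show "\<tau> k b \<in> carrier (X k)"
    proof (cases "b \<in> D k")
      case True
      then obtain x where x: "((k, b), x) \<in> M" by (auto simp: D_def)
      then show ?thesis using M(2)[OF x] tau_eq[OF x] by (simp add: ok_def)
    qed (simp add: \<tau>_def)
  qed
  define T where "T k = lin_ext R (X k) (\<tau> k)" for k
  have T: "T k \<in> mod_hom R (free_module R Y) (X k)" for k Y
    unfolding T_def by (rule left_module.lin_ext_hom[OF module_X tau])
  have Tu: "T k (?u b) = \<tau> k b" for k b
    unfolding T_def by (rule left_module.lin_ext_unit[OF module_X tau UNIV_I])
  have D: "D k \<subseteq> B k" for k using M(2) by (auto simp: D_def ok_def)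
  have closed: "c \<in> D (Suc k)" if "b \<in> D k" "e k (?u b) c \<noteq> \<zero>\<^bsub>R\<^esub>" for k b c
    using that M(2) unfolding D_def ok_def by blast
  have eq_u: "f k (?u b) = \<delta> k (T k (?u b)) \<oplus>\<^bsub>X (Suc k)\<^esub> T (Suc k) (e k (?u b))" if bD: "b \<in> D k" for k b
  proof -
    obtain x where x: "((k, b), x) \<in> M" using bD by (auto simp: D_def)
    then obtain \<sigma> where \<sigma>: "\<And>c. e k (?u b) c \<noteq> \<zero>\<^bsub>R\<^esub> \<Longrightarrow> ((Suc k, c), \<sigma> c) \<in> M"
      "f k (?u b) = \<delta> k x \<oplus>\<^bsub>X (Suc k)\<^esub> lin_ext R (X (Suc k)) \<sigma> (e k (?u b))"
      using M(2)[OF x] unfolding ok_def by blast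
    have b: "b \<in> B k" using bD D by auto
    have "lin_ext R (X (Suc k)) \<sigma> (e k (?u b)) = T (Suc k) (e k (?u b))"
      unfolding T_def lin_ext_def
    proof (rule X.M.finsum_cong'[OF refl])
      show "(\<lambda>c. e k (?u b) c \<odot>\<^bsub>X (Suc k)\<^esub> \<tau> (Suc k) c) \<in> {c. e k (?u b) c \<noteq> \<zero>\<^bsub>R\<^esub>} \<rightarrow> carrier (X (Suc k))"
        using tau[of _ UNIV] free_moduleD(1)[OF eu[OF b]] by (auto simp: Pi_iff)
      show "e k (?u b) c \<odot>\<^bsub>X (Suc k)\<^esub> \<sigma> c = e k (?u b) c \<odot>\<^bsub>X (Suc k)\<^esub> \<tau> (Suc k) c"
        if "c \<in> {c. e k (?u b) c \<noteq> \<zero>\<^bsub>R\<^esub>}" for c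
        using tau_eq[OF \<sigma>(1)] that by simp
    qed
    then show ?thesis using \<sigma>(2) by (simp add: Tu tau_eq[OF x])
  qed
  have eq: "f k x = \<delta> k (T k x) \<oplus>\<^bsub>X (Suc k)\<^esub> T (Suc k) (e k x)" if x: "x \<in> carrier (free_module R (D k))" for k x
    by (rule hom_free_eqI[OF module_X mod_hom_comp[OF free_module_incl[OF D] f]
          mod_hom_comp[OF free_module_incl[OF D] mod_hom_plus[OF module_X mod_hom_comp[OF T \<delta>] mod_hom_comp[OF e T] F]] _ x])
      (rule eq_u)
  have "B k \<subseteq> D k" for k
  proof
    fix b assume b: "b \<in> B k"
    obtain D' T' where D': "\<And>k. D' k \<subseteq> B k" "\<And>k. D k \<subseteq> D' k" "b \<in> D' k"
      and closed': "\<And>k b c. b \<in> D' k \<Longrightarrow> e k (?u b) c \<noteq> \<zero>\<^bsub>R\<^esub> \<Longrightarrow> c \<in> D' (Suc k)"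
      and T': "\<And>k. T' k \<in> mod_hom R (free_module R (B k)) (X k)"
        "\<And>k b. b \<in> D k \<Longrightarrow> T' k (?u b) = T k (?u b)"
      and eq': "\<And>k x. x \<in> carrier (free_module R (D' k)) \<Longrightarrow> f k x = \<delta> k (T' k x) \<oplus>\<^bsub>X (Suc k)\<^esub> T' (Suc k) (e k x)"
      by (rule null_homotopy_extend[of e B f D T, OF e ee f comm D closed T eq b]) (assumption+, rule that)
    \<comment> \<open>The graph of the enlarged homotopy belongs to \<open>\<G>\<close> and contains
      \<open>M\<close>, so maximality puts \<open>b\<close> into \<open>D k\<close>.\<close>
    define G where "G = {((k, b), T' k (?u b)) | k b. b \<in> D' k}"
    have "single_valued G" by (auto simp: G_def single_valued_def)
    moreover have "ok G k b x" if "((k, b), x) \<in> G" for k b x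
    proof -
      have bx: "b \<in> D' k" "x = T' k (?u b)" using that by (auto simp: G_def)
      have bB: "b \<in> B k" using bx D' by auto
      show ?thesis unfolding ok_def bx(2)
      proof (intro conjI exI[of _ "\<lambda>c. T' (Suc k) (?u c)"] allI impI)
        show "b \<in> B k" by fact
        show "T' k (?u b) \<in> carrier (X k)" by (rule mod_hom_closed[OF T'(1) free_unit_closed[OF ring bB]])
        show "((Suc k, c), T' (Suc k) (?u c)) \<in> G" if "e k (?u b) c \<noteq> \<zero>\<^bsub>R\<^esub>" for c
          using closed'[OF bx(1) that] by (auto simp: G_def)
        show "f k (?u b) = \<delta> k (T' k (?u b)) \<oplus>\<^bsub>X (Suc k)\<^esub>
            lin_ext R (X (Suc k)) (\<lambda>c. T' (Suc k) (?u c)) (e k (?u b))"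
          using eq'[OF free_unit_closed[OF ring bx(1)]] X.hom_free_eq_lin_ext[OF T'(1) eu[OF bB]] by simp
      qed
    qed
    ultimately have "G \<in> \<G>" by (simp add: \<G>_def)
    moreover have "M \<subseteq> G"
    proof
      fix z assume z: "z \<in> M"
      obtain k b x where kbx: "z = ((k, b), x)" by (metis surj_pair)
      then have "b \<in> D k" using z by (auto simp: D_def)
      then show "z \<in> G" using D'(2) T'(2) Tu tau_eq z kbx by (fastforce simp: G_def)
    qed
    ultimately have "G = M" by (rule max)
    then show "b \<in> D k" using D'(3) by (auto simp: D_def G_def)
  qed
  then have "D k = B k" for k using D by blast
  then show ?thesis using that[of T] T eq by auto
qed

end

section \<open>The coresolution\<close>

lemma mod_hom_injI:
  assumes M: "left_module R M" and N: "left_module R N" and f: "f \<in> mod_hom R M N"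
    and "\<And>x. x \<in> carrier M \<Longrightarrow> f x = \<zero>\<^bsub>N\<^esub> \<Longrightarrow> x = \<zero>\<^bsub>M\<^esub>"
  shows "inj_on f (carrier M)"
proof (rule inj_onI)
  interpret M: left_module R M by fact
  fix x y assume x: "x \<in> carrier M" and y: "y \<in> carrier M" and "f x = f y"
  then have "x \<ominus>\<^bsub>M\<^esub> y = \<zero>\<^bsub>M\<^esub>" using mod_hom_diff_zero[OF M N f] assms(4) M.M.minus_closed by blast
  then show "x = y" using minus_minus_cancel(3)[OF M x y] y by simp
qed

lemma fp_injective_trivial:
  assumes A: "left_module R A" and z: "carrier A \<subseteq> {\<zero>\<^bsub>A\<^esub>}"
  shows "fp_injective R A"
proof (rule fp_injectiveI[OF A])
  fix m n \<beta> \<kappa> assume k: "\<kappa> \<in> mod_hom R (free_pow R m) A"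
  have "\<kappa> x = \<zero>\<^bsub>A\<^esub>" if "x \<in> carrier (free_pow R m)" for x
    using mod_hom_closed[OF k that] z by blast
  then show "\<exists>g\<in>mod_hom R (free_pow R n) A. \<forall>x\<in>carrier (free_pow R m). g (\<beta> x) = \<kappa> x"
    by (intro bexI[OF _ mod_hom_const_zero[OF A]]) simp
qed

text \<open>\<open>X\<close> is the power of \<open>A\<close> indexed by the sets \<open>S\<close>, modulo the functions that vanish for all
  sufficiently large finite \<open>S \<subseteq> Z\<close>. Each finite part of \<open>\<phi>\<close> extends to \<open>P\<close>, and together these
  extensions give a map to \<open>X\<close>.\<close>

lemma fp_injective_enlargement:
  fixes R :: "('r, 'x) ring_scheme" and P :: "('r, 'p) module" and A :: "('r, 'u) module"
    and enc :: "('p set \<Rightarrow> 'u) \<Rightarrow> 'u"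
  assumes coh: "left_coherent R" and enc: "inj enc" and A: "fp_injective R A" and P: "projective R P"
    and Z: "left_module R (P\<lparr>carrier := Z\<rparr>)" and ZP: "Z \<subseteq> carrier P"
    and phi: "\<phi> \<in> mod_hom R (P\<lparr>carrier := Z\<rparr>) A"
  obtains X A' :: "('r, 'u) module" and \<iota> \<pi> g where "fp_injective R X" "fp_injective R A'"
    "\<iota> \<in> mod_hom R A X" "inj_on \<iota> (carrier A)" "\<pi> \<in> mod_hom R X A'" "\<pi> ` carrier X = carrier A'"
    "{x \<in> carrier X. \<pi> x = \<zero>\<^bsub>A'\<^esub>} = \<iota> ` carrier A"
    "g \<in> mod_hom R P X" "\<And>z. z \<in> Z \<Longrightarrow> g z = \<iota> (\<phi> z)"
proof -
  have lA: "left_module R A" by (rule fp_injective_module[OF A])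
  interpret A: left_module R A by (rule lA)
  define \<F> where "\<F> = finite_subsets_at_top Z"
  define M where "M = ev_zero_module A (bot :: 'p set filter)"
  define K where "K = carrier (ev_zero_module A \<F>)"
  have M: "fp_injective R M" unfolding M_def by (rule fp_injective_ev_zero[OF A])
  have lM: "left_module R M" by (rule fp_injective_module[OF M])
  have cM: "f \<in> carrier M \<longleftrightarrow> (\<forall>j. f j \<in> carrier A)" for f by (simp add: M_def ev_zero_simps)
  have aM: "f \<oplus>\<^bsub>M\<^esub> h = (\<lambda>j. f j \<oplus>\<^bsub>A\<^esub> h j)" and sM: "a \<odot>\<^bsub>M\<^esub> f = (\<lambda>j. a \<odot>\<^bsub>A\<^esub> f j)" for f h a
    by (simp_all add: M_def ev_zero_simps)
  have cK: "f \<in> K \<longleftrightarrow> (\<forall>j. f j \<in> carrier A) \<and> eventually (\<lambda>j. f j = \<zero>\<^bsub>A\<^esub>) \<F>" for f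
    by (simp add: K_def ev_zero_simps)
  have KM: "M\<lparr>carrier := K\<rparr> = ev_zero_module A \<F>"
    by (simp add: M_def K_def ev_zero_module_def)
  have Ksub: "K \<subseteq> carrier M" using cK cM by blast
  have lK: "left_module R (M\<lparr>carrier := K\<rparr>)" unfolding KM by (rule left_module_ev_zero[OF lA])
  obtain X :: "('r, 'u) module" and q where lX: "left_module R X" and q: "q \<in> mod_hom R M X"
    "q ` carrier M = carrier X" "\<And>x. x \<in> carrier M \<Longrightarrow> q x = \<zero>\<^bsub>X\<^esub> \<longleftrightarrow> x \<in> K"
    using quotient_exists[OF lM lK Ksub enc] by blast
  interpret X: left_module R X by (rule lX)
  have "a_kernel M X q = K" using q(3) Ksub by (auto simp: a_kernel_def')
  then have "kernel_module M X q = ev_zero_module A \<F>" by (simp add: kernel_module_def KM)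
  then have "fp_injective R (kernel_module M X q)" using fp_injective_ev_zero[OF A] by simp
  then have X: "fp_injective R X" by (rule fp_injective_quotient[OF coh M lX q(1,2)])
  define \<iota> where "\<iota> a = q (\<lambda>j. a)" for a
  have diag: "(\<lambda>a j. a) \<in> mod_hom R A M" by (rule mod_homI) (simp_all add: cM aM sM)
  have i: "\<iota> \<in> mod_hom R A X" unfolding \<iota>_def by (rule mod_hom_comp[OF diag q(1)])
  have inj: "inj_on \<iota> (carrier A)"
  proof (rule mod_hom_injI[OF lA lX i])
    fix a assume a: "a \<in> carrier A" "\<iota> a = \<zero>\<^bsub>X\<^esub>"
    then have "(\<lambda>j. a) \<in> K" using q(3)[OF mod_hom_closed[OF diag a(1)]] by (simp add: \<iota>_def)
    \<comment> \<open>The filter is proper, so a constant family that is eventually zero is zero: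
      the diagonal map to the reduced power is injective.\<close>
    then have "eventually (\<lambda>j. a = \<zero>\<^bsub>A\<^esub>) \<F>" by (simp add: cK)
    then show "a = \<zero>\<^bsub>A\<^esub>" by (simp add: \<F>_def eventually_const_iff)
  qed
  \<comment> \<open>The filter ignores every \<open>S\<close> that is not a finite subset of
    \<open>Z\<close>; there the zero map serves.\<close>
  have "\<exists>h. h \<in> mod_hom R P A \<and> (finite S \<and> S \<subseteq> Z \<longrightarrow> (\<forall>s\<in>S. h s = \<phi> s))" for S
  proof (cases "finite S \<and> S \<subseteq> Z")
    case True
    then obtain h where "h \<in> mod_hom R P A" "\<And>s. s \<in> S \<Longrightarrow> h s = \<phi> s"
      using local_extension[OF A P Z phi _ _ ZP] by metis
    then show ?thesis by blast
  qed (use mod_hom_const_zero[OF lA] in blast)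
  then obtain h where h: "\<And>S. h S \<in> mod_hom R P A"
    "\<And>S s. finite S \<Longrightarrow> S \<subseteq> Z \<Longrightarrow> s \<in> S \<Longrightarrow> h S s = \<phi> s" by metis
  define g where "g x = q (\<lambda>S. h S x)" for x
  have hM: "(\<lambda>x S. h S x) \<in> mod_hom R P M"
    by (rule mod_homI) (simp_all add: cM aM sM mod_hom_closed[OF h(1)] mod_hom_add[OF h(1)] mod_hom_smult[OF h(1)])
  have g: "g \<in> mod_hom R P X" unfolding g_def by (rule mod_hom_comp[OF hM q(1)])
  have gz: "g z = \<iota> (\<phi> z)" if z: "z \<in> Z" for z
  proof -
    have pz: "\<phi> z \<in> carrier A" using mod_hom_closed[OF phi, of z] z by simp
    have hz: "h S z \<in> carrier A" for S using mod_hom_closed[OF h(1)] z ZP by auto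
    \<comment> \<open>\<open>h S z\<close> equals \<open>\<phi> z\<close> for every finite
      \<open>S\<close> in \<open>Z\<close> that contains \<open>z\<close>. So the family of these
      values differs from the constant one by an element of \<open>K\<close>, which \<open>q\<close>
      kills.\<close>
    define c where "c = (\<lambda>S. h S z \<ominus>\<^bsub>A\<^esub> \<phi> z)"
    have "eventually (\<lambda>S. c S = \<zero>\<^bsub>A\<^esub>) \<F>"
      unfolding \<F>_def eventually_finite_subsets_at_top
      by (rule exI[of _ "{z}"]) (use z h(2) pz in \<open>auto simp: c_def minus_self_zero[OF lA]\<close>)
    then have cK': "c \<in> K" using hz pz by (simp add: cK c_def)
    then have cM': "c \<in> carrier M" using Ksub by auto
    have "(\<lambda>S. h S z) = c \<oplus>\<^bsub>M\<^esub> (\<lambda>S. \<phi> z)"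
      using hz pz by (simp add: aM c_def minus_minus_cancel[OF lA])
    then have "g z = q c \<oplus>\<^bsub>X\<^esub> \<iota> (\<phi> z)"
      using mod_hom_add[OF q(1) cM' mod_hom_closed[OF diag pz]] by (simp add: g_def \<iota>_def)
    then show ?thesis using q(3)[OF cM'] cK' mod_hom_closed[OF i pz] by simp
  qed
  let ?I = "\<iota> ` carrier A"
  have Isub: "?I \<subseteq> carrier X" using mod_hom_closed[OF i] by auto
  obtain A' :: "('r, 'u) module" and \<pi> where lA': "left_module R A'" and p: "\<pi> \<in> mod_hom R X A'"
    "\<pi> ` carrier X = carrier A'" "\<And>x. x \<in> carrier X \<Longrightarrow> \<pi> x = \<zero>\<^bsub>A'\<^esub> \<longleftrightarrow> x \<in> ?I"
    using quotient_exists[OF lX left_module_image[OF lA lX i] Isub inj_on_id] by blast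
  have ker: "{x \<in> carrier X. \<pi> x = \<zero>\<^bsub>A'\<^esub>} = ?I" using p(3) Isub by auto
  have "fp_injective R A'"
    by (rule fp_injective_quotient[OF coh X lA' p(1,2)
          fp_injective_kernel[OF A lX lA' i inj p(1) ker[symmetric]]])
  then show ?thesis using that[OF X _ i inj p(1,2) ker g gz] by blast
qed

text \<open>A map from the cycles of \<open>C k\<close> to a module A_k yields a short exact
  sequence of A_k, X_k and A_{k+1}, and a map from \<open>C k\<close> to X_k. Followed by the
  projection to A_{k+1} this map kills the cycles, so by exactness it becomes a map from the cycles
  of \<open>C (Suc k)\<close>, and the construction repeats. The spliced sequences form the
  coresolution.\<close>

lemma extend_from_cycles:
  fixes R :: "('r, 'x) ring_scheme" and C :: "nat \<Rightarrow> ('r, 'p) module" and A :: "('r, 'u) module"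
    and enc :: "('p set \<Rightarrow> 'u) \<Rightarrow> 'u"
  assumes coh: "left_coherent R" and enc: "inj enc" and C: "\<And>k. projective R (C k)"
    and d: "\<And>k. d k \<in> mod_hom R (C k) (C (Suc k))"
    and exact: "\<And>k. d k ` carrier (C k) = {x \<in> carrier (C (Suc k)). d (Suc k) x = \<zero>\<^bsub>C (Suc (Suc k))\<^esub>}"
    and A: "fp_injective R A" and phi: "\<phi> \<in> mod_hom R (kernel_module (C 0) (C 1) (d 0)) A"
  shows "\<exists>g\<in>mod_hom R (C 0) A. \<forall>x\<in>carrier (kernel_module (C 0) (C 1) (d 0)). g x = \<phi> x"
proof -
  have lC: "left_module R (C k)" for k using C[of k] by (simp add: projective_def)
  have R: "ring R" using coh by (simp add: left_coherent_def)
  define Z where "Z k = kernel_module (C k) (C (Suc k)) (d k)" for k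
  have lZ: "left_module R (Z k)" for k unfolding Z_def by (rule left_module_kernel[OF lC lC d])
  have cZ: "carrier (Z k) = {x \<in> carrier (C k). d k x = \<zero>\<^bsub>C (Suc k)\<^esub>}" for k
    by (simp add: Z_def carrier_kernel_module)
  have Z_eq: "Z k = (C k)\<lparr>carrier := carrier (Z k)\<rparr>" for k by (simp add: Z_def kernel_module_def)
  define st where "st k A \<phi> A' \<phi>' X \<iota> \<pi> g \<longleftrightarrow> fp_injective R X \<and> \<iota> \<in> mod_hom R A X \<and> inj_on \<iota> (carrier A) \<and>
      \<pi> \<in> mod_hom R X A' \<and> \<pi> ` carrier X = carrier A' \<and> {x \<in> carrier X. \<pi> x = \<zero>\<^bsub>A'\<^esub>} = \<iota> ` carrier A \<and>
      g \<in> mod_hom R (C k) X \<and> (\<forall>z\<in>carrier (Z k). g z = \<iota> (\<phi> z)) \<and>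
      (\<forall>x\<in>carrier (C k). \<phi>' (d k x) = \<pi> (g x))"
    for k and A :: "('r, 'u) module" and \<phi> :: "'p \<Rightarrow> 'u" and A' :: "('r, 'u) module" and \<phi>' :: "'p \<Rightarrow> 'u"
      and X :: "('r, 'u) module" and \<iota> \<pi> g
  define good where "good k s \<longleftrightarrow> fp_injective R (fst s) \<and> snd s \<in> mod_hom R (Z k) (fst s)"
    for k and s :: "('r, 'u) module \<times> ('p \<Rightarrow> 'u)"
  have step: "\<exists>s'. good (Suc k) s' \<and>
      (\<exists>w. st k (fst s) (snd s) (fst s') (snd s') (fst w) (fst (snd w)) (fst (snd (snd w))) (snd (snd (snd w))))"
    if s: "good k s" for k s
  proof -
    have A: "fp_injective R (fst s)" and ph: "snd s \<in> mod_hom R ((C k)\<lparr>carrier := carrier (Z k)\<rparr>) (fst s)"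
      using s Z_eq[of k] by (simp_all add: good_def)
    have Zk: "left_module R ((C k)\<lparr>carrier := carrier (Z k)\<rparr>)" using lZ[of k] Z_eq[of k] by simp
    have ZC: "carrier (Z k) \<subseteq> carrier (C k)" by (auto simp: cZ)
    obtain X A' :: "('r, 'u) module" and \<iota> \<pi> g where X: "fp_injective R X" "fp_injective R A'"
      "\<iota> \<in> mod_hom R (fst s) X" "inj_on \<iota> (carrier (fst s))" "\<pi> \<in> mod_hom R X A'" "\<pi> ` carrier X = carrier A'"
      "{x \<in> carrier X. \<pi> x = \<zero>\<^bsub>A'\<^esub>} = \<iota> ` carrier (fst s)"
      "g \<in> mod_hom R (C k) X" "\<And>z. z \<in> carrier (Z k) \<Longrightarrow> g z = \<iota> (snd s z)"
      by (rule fp_injective_enlargement[OF coh enc A C Zk ZC ph]) blast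
    have "\<pi> (g x) = \<zero>\<^bsub>A'\<^esub>" if "x \<in> carrier (C k)" "d k x = \<zero>\<^bsub>C (Suc k)\<^esub>" for x
    proof -
      have x: "x \<in> carrier (Z k)" using that by (simp add: cZ)
      have "snd s x \<in> carrier (fst s)" using mod_hom_closed[OF ph, of x] x by simp
      then show ?thesis using X(7) X(9)[OF x] by auto
    qed
    then obtain \<phi>' where ph': "\<phi>' \<in> mod_hom R ((C (Suc k))\<lparr>carrier := d k ` carrier (C k)\<rparr>) A'"
      "\<And>x. x \<in> carrier (C k) \<Longrightarrow> \<phi>' (d k x) = \<pi> (g x)"
      using factor_through_image[OF lC lC fp_injective_module[OF X(2)] d mod_hom_comp[OF X(8,5)]] by metis
    have "(C (Suc k))\<lparr>carrier := d k ` carrier (C k)\<rparr> = Z (Suc k)"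
      using Z_eq[of "Suc k"] exact[of k] by (simp add: cZ)
    then have "good (Suc k) (A', \<phi>')" using X(2) ph'(1) by (simp add: good_def)
    moreover have "st k (fst s) (snd s) A' \<phi>' X \<iota> \<pi> g" unfolding st_def using X ph'(2) by blast
    ultimately show ?thesis
      by (intro exI[of _ "(A', \<phi>')"] conjI exI[of _ "(X, \<iota>, \<pi>, g)"]) simp_all
  qed
  define Q where "Q k s s' \<longleftrightarrow> (\<exists>w. st k (fst s) (snd s) (fst s') (snd s') (fst w) (fst (snd w))
      (fst (snd (snd w))) (snd (snd (snd w))))" for k and s s' :: "('r, 'u) module \<times> ('p \<Rightarrow> 'u)"
  have "\<exists>s. s 0 = (A, \<phi>) \<and> (\<forall>k. good k (s k) \<and> Q k (s k) (s (Suc k)))"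
  proof -
    \<comment> \<open>The first value is to be \<open>(A, \<phi>)\<close>, while dependent choice
      only yields some value with the required property; so the property includes the start.\<close>
    define good' where "good' k s \<longleftrightarrow> good k s \<and> (k = 0 \<longrightarrow> s = (A, \<phi>))" for k s
    have 1: "\<exists>s. good' 0 s" using A phi by (auto simp: good'_def good_def Z_def)
    have 2: "\<exists>s'. good' (Suc k) s' \<and> Q k s s'" if "good' k s" for k s
      using step[of k s] that unfolding good'_def Q_def by auto
    have "\<exists>s. \<forall>k. good' k (s k) \<and> Q k (s k) (s (Suc k))"
      by (rule dependent_nat_choice[of good' Q, OF 1 2])
    then show ?thesis by (auto simp: good'_def)
  qed
  then obtain s where s0: "s 0 = (A, \<phi>)" and s: "\<And>k. good k (s k)" "\<And>k. Q k (s k) (s (Suc k))" by blast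
  obtain w where w: "\<forall>k. st k (fst (s k)) (snd (s k)) (fst (s (Suc k))) (snd (s (Suc k))) (fst (w k)) (fst (snd (w k)))
      (fst (snd (snd (w k)))) (snd (snd (snd (w k))))"
    using choice[OF allI[OF s(2)[unfolded Q_def]]] by (rule exE)
  define Ak where "Ak k = fst (s k)" for k
  define pk where "pk k = snd (s k)" for k
  define X where "X k = fst (w k)" for k
  define \<iota> where "\<iota> k = fst (snd (w k))" for k
  define \<pi> where "\<pi> k = fst (snd (snd (w k)))" for k
  define g where "g k = snd (snd (snd (w k)))" for k
  have st: "st k (Ak k) (pk k) (Ak (Suc k)) (pk (Suc k)) (X k) (\<iota> k) (\<pi> k) (g k)" for k
    unfolding Ak_def pk_def X_def \<iota>_def \<pi>_def g_def using w by blast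
  have A0: "Ak 0 = A" "pk 0 = \<phi>" by (simp_all add: Ak_def pk_def s0)
  have Ak: "fp_injective R (Ak k)" and pk: "pk k \<in> mod_hom R (Z k) (Ak k)" for k
    using s(1)[of k] by (simp_all add: good_def Ak_def pk_def)
  have X: "fp_injective R (X k)" and i: "\<iota> k \<in> mod_hom R (Ak k) (X k)" and inj: "inj_on (\<iota> k) (carrier (Ak k))"
    and p: "\<pi> k \<in> mod_hom R (X k) (Ak (Suc k))" and p_onto: "\<pi> k ` carrier (X k) = carrier (Ak (Suc k))"
    and ker: "{x \<in> carrier (X k). \<pi> k x = \<zero>\<^bsub>Ak (Suc k)\<^esub>} = \<iota> k ` carrier (Ak k)"
    and g: "g k \<in> mod_hom R (C k) (X k)" and gz: "\<And>z. z \<in> carrier (Z k) \<Longrightarrow> g k z = \<iota> k (pk k z)"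
    and pd: "\<And>x. x \<in> carrier (C k) \<Longrightarrow> pk (Suc k) (d k x) = \<pi> k (g k x)" for k
    using st[of k] unfolding st_def by simp_all
  have lAk: "left_module R (Ak k)" and lX: "left_module R (X k)" for k
    by (rule fp_injective_module[OF Ak] fp_injective_module[OF X])+
  have i0: "\<iota> k x = \<zero>\<^bsub>X k\<^esub> \<longleftrightarrow> x = \<zero>\<^bsub>Ak k\<^esub>" if "x \<in> carrier (Ak k)" for k x
  proof -
    interpret Ak: left_module R "Ak k" by (rule lAk)
    show ?thesis using inj_on_eq_iff[OF inj that Ak.M.zero_closed] mod_hom_zero[OF lAk lX i] by simp
  qed
  \<comment> \<open>A sits in degree 0 and \<open>X k\<close> in degree \<open>Suc k\<close>. The
    chain map thus raises the degree by one, the homotopy preserves it, and its component in degree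
    0 ends in A, where the extension is wanted.\<close>
  define Y where "Y = case_nat A X"
  define \<delta> where "\<delta> = case_nat (\<iota> 0) (\<lambda>j x. \<iota> (Suc j) (\<pi> j x))"
  have Y0: "Y 0 = Ak 0" and YS: "Y (Suc k) = X k" and D0: "\<delta> 0 = \<iota> 0" and DS: "\<delta> (Suc k) = (\<lambda>x. \<iota> (Suc k) (\<pi> k x))" for k
    by (simp_all add: Y_def \<delta>_def A0)
  have kerS: "{x \<in> carrier (X k). \<iota> (Suc k) (\<pi> k x) = \<zero>\<^bsub>X (Suc k)\<^esub>} = \<iota> k ` carrier (Ak k)" for k
    unfolding ker[symmetric] using i0 mod_hom_closed[OF p] by auto
  interpret Y: fp_injective_complex R Y \<delta>
  proof
    show "left_coherent R" by (rule coh)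
    show "fp_injective R (Y k)" for k by (cases k) (simp_all add: Y0 YS X Ak)
    show D: "\<delta> k \<in> mod_hom R (Y k) (Y (Suc k))" for k
      by (cases k) (simp_all add: Y0 YS D0 DS i mod_hom_comp[OF p i])
    show "fp_injective R (kernel_module (Y k) (Y (Suc k)) (\<delta> k))" for k
    proof (cases k)
      case 0
      have "left_module R (kernel_module (Ak 0) (X 0) (\<iota> 0))" by (rule left_module_kernel[OF lAk lX i])
      then show ?thesis unfolding 0 Y0 YS D0
        by (rule fp_injective_trivial) (auto simp: carrier_kernel_module i0)
    next
      case (Suc j)
      show ?thesis unfolding Suc YS DS
        by (rule fp_injective_kernel[OF Ak lX lX i inj mod_hom_comp[OF p i] kerS[symmetric]])
    qed
    show "\<delta> k ` carrier (Y k) = {x \<in> carrier (Y (Suc k)). \<delta> (Suc k) x = \<zero>\<^bsub>Y (Suc (Suc k))\<^esub>}" for k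
    proof (cases k)
      case 0
      then show ?thesis by (simp add: Y0 YS D0 DS kerS)
    next
      case (Suc j)
      then show ?thesis by (simp add: YS DS kerS p_onto flip: image_image)
    qed
  qed

  have "\<exists>i. i \<in> mod_hom R (C k) (free_cover R (C k)) \<and> (\<forall>x\<in>carrier (C k). cover_map R (C k) (i x) = x)" for k
    using projective_lift[OF C free_cover_module[OF lC] lC cover_map_hom[OF lC] mod_hom_id cover_map_onto[OF lC]]
    by blast
  then obtain c where c: "\<And>k. c k \<in> mod_hom R (C k) (free_cover R (C k))"
    "\<And>k x. x \<in> carrier (C k) \<Longrightarrow> cover_map R (C k) (c k x) = x" by metis
  let ?F = "\<lambda>k. free_module R (carrier (C k))" and ?m = "\<lambda>k. cover_map R (C k)"
  have m: "?m k \<in> mod_hom R (?F k) (C k)" for k using cover_map_hom[OF lC[of k]] by (simp add: free_cover_def)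
  have cF: "c k \<in> mod_hom R (C k) (?F k)" for k using c(1)[of k] by (simp add: free_cover_def)
  have lF: "left_module R (?F k)" for k by (rule left_module_free[OF R])
  have dd: "d (Suc k) (d k x) = \<zero>\<^bsub>C (Suc (Suc k))\<^esub>" if "x \<in> carrier (C k)" for k x
    using exact[of k] that by blast
  \<comment> \<open>\<open>c k\<close> is a section of the cover map, so \<open>C k\<close> is a
    direct summand of the free module on its elements. The square of \<open>e\<close> is zero
    because the cover map after \<open>c\<close> is the identity; the kernels of the cover maps,
    however, create homology.\<close>
  define e where "e k x = c (Suc k) (d k (?m k x))" for k x
  define f where "f k x = g k (?m k x)" for k x
  have e: "e k \<in> mod_hom R (?F k) (?F (Suc k))" for k
    unfolding e_def by (rule mod_hom_comp[OF mod_hom_comp[OF m d] cF])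
  have ee: "e (Suc k) (e k x) = \<zero>\<^bsub>?F (Suc (Suc k))\<^esub>" if x: "x \<in> carrier (?F k)" for k x
    unfolding e_def using mod_hom_closed[OF m x] mod_hom_closed[OF mod_hom_comp[OF m d] x]
    by (simp add: c(2) dd mod_hom_zero[OF lC lF cF])
  have f: "f k \<in> mod_hom R (?F k) (Y (Suc k))" for k
    unfolding f_def YS by (rule mod_hom_comp[OF m g])
  have comm: "\<delta> (Suc k) (f k x) = f (Suc k) (e k x)" if x: "x \<in> carrier (?F k)" for k x
  proof -
    have mx: "?m k x \<in> carrier (C k)" by (rule mod_hom_closed[OF m x])
    have dx: "d k (?m k x) \<in> carrier (Z (Suc k))" using exact[of k] mx by (auto simp: cZ)
    have "f (Suc k) (e k x) = g (Suc k) (d k (?m k x))"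
      unfolding f_def e_def using dx by (simp add: c(2) cZ)
    then show ?thesis using gz[OF dx] pd[OF mx] by (simp add: DS f_def)
  qed
  obtain T where T: "\<And>k. T k \<in> mod_hom R (?F k) (Y k)"
    "\<And>k x. x \<in> carrier (?F k) \<Longrightarrow> f k x = \<delta> k (T k x) \<oplus>\<^bsub>Y (Suc k)\<^esub> T (Suc k) (e k x)"
    by (rule Y.null_homotopy[of e "\<lambda>k. carrier (C k)" f, OF e ee f comm]) (assumption+, rule that)
  have T0: "T 0 \<in> mod_hom R (?F 0) A" using T(1)[of 0] by (simp add: Y0 A0)
  show ?thesis
  proof (rule bexI[OF _ mod_hom_comp[OF cF T0]], rule ballI)
    fix z assume "z \<in> carrier (kernel_module (C 0) (C 1) (d 0))"
    then have z: "z \<in> carrier (Z 0)" by (simp add: Z_def)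
    then have zC: "z \<in> carrier (C 0)" and dz: "d 0 z = \<zero>\<^bsub>C (Suc 0)\<^esub>" by (auto simp: cZ)
    have cz: "c 0 z \<in> carrier (?F 0)" by (rule mod_hom_closed[OF cF zC])
    have Tz: "T 0 (c 0 z) \<in> carrier A" by (rule mod_hom_closed[OF T0 cz])
    have pz: "\<phi> z \<in> carrier A" using mod_hom_closed[OF pk z] by (simp add: A0)
    interpret X0: left_module R "X 0" by (rule lX)
    \<comment> \<open>On a cycle the term of the homotopy with \<open>e\<close> disappears. What
      remains equates the images of \<open>\<phi> z\<close> and of \<open>T 0 (c 0 z)\<close> under
      the injective map \<open>\<iota> 0\<close>.\<close>
    have "e 0 (c 0 z) = \<zero>\<^bsub>?F (Suc 0)\<^esub>" by (simp add: e_def c(2)[OF zC] dz mod_hom_zero[OF lC lF cF])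
    then have "T (Suc 0) (e 0 (c 0 z)) = \<zero>\<^bsub>X 0\<^esub>" using mod_hom_zero[OF lF Y.module_X T(1)] by (simp add: YS)
    moreover have "f 0 (c 0 z) = \<iota> 0 (\<phi> z)" using gz[OF z] by (simp add: f_def c(2)[OF zC] A0)
    ultimately have "\<iota> 0 (\<phi> z) = \<iota> 0 (T 0 (c 0 z))"
      using T(2)[OF cz] mod_hom_closed[OF i, of "T 0 (c 0 z)" 0] Tz by (simp add: D0 YS A0)
    then show "T 0 (c 0 z) = \<phi> z" using inj_onD[OF inj[of 0]] Tz pz by (simp add: A0)
  qed
qed

section \<open>Dimension shifting\<close>

theorem theorem1p3:
  fixes R :: "('r, 'x) ring_scheme"
    and P :: "int \<Rightarrow> ('r, 'p) module" and d :: "int \<Rightarrow> 'p \<Rightarrow> 'p"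
    and A :: "('r, 'a) module" and n :: int
  assumes "coherent_ring R"
    and "exact_complex R P d"
    and "\<And>k. projective R (P k)"
    and "absolutely_pure R A"
  shows "trivial_group (Ext1 R (cycles P d n) A)"
proof -
  have coh: "left_coherent R" using assms(1) by (simp add: coherent_ring_def)
  have lP: "left_module R (P k)" for k using assms(3)[of k] by (simp add: projective_def)
  have d: "d k \<in> mod_hom R (P k) (P (k - 1))" for k
    using assms(2) by (simp add: exact_complex_def chain_complex_def)
  have exact: "d (k + 1) ` carrier (P (k + 1)) = {x \<in> carrier (P k). d k x = \<zero>\<^bsub>P (k - 1)\<^esub>}" for k
    using assms(2) by (simp add: exact_complex_def a_kernel_def')
  have fpA: "fp_injective R A" by (rule absolutely_pure_fp_injective[OF assms(4)])
  have lA: "left_module R A" by (rule fp_injective_module[OF fpA])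
  interpret A: left_module R A by (rule lA)

  \<comment> \<open>Powers of modules on this type can be realised on the type itself; this keeps the whole
    coresolution of \<open>A\<close> on one type.\<close>
  define enc :: "('p set \<Rightarrow> 'p set list \<Rightarrow> 'a) \<Rightarrow> 'p set list \<Rightarrow> 'a"
    where "enc f l = (case l of [] \<Rightarrow> undefined | S # l' \<Rightarrow> f S l')" for f l
  \<comment> \<open>Functions on lists absorb one more argument \<open>S\<close> as the head of the
    list; the value at the empty list is arbitrary and carries no information.\<close>
  have enc: "inj enc"
  proof (rule injI)
    fix f f' assume "enc f = enc f'"
    then have "enc f (S # l) = enc f' (S # l)" for S l by simp
    then show "f = f'" by (simp add: enc_def fun_eq_iff)
  qed
  have z: "left_module R (A\<lparr>carrier := {\<zero>\<^bsub>A\<^esub>}\<rparr>)" by (rule A.submodule_left_module) simp_all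
  \<comment> \<open>\<open>B\<close> is A modulo zero with its elements represented by constant
    functions on lists, an isomorphic copy of A on the type that has \<open>enc\<close>.\<close>
  have inj0: "inj (\<lambda>(a :: 'a) (l :: 'p set list). a)" by (simp add: inj_def fun_eq_iff)
  obtain B :: "('r, 'p set list \<Rightarrow> 'a) module" and q where lB: "left_module R B" and q: "q \<in> mod_hom R A B"
    "q ` carrier A = carrier B" "\<And>x. x \<in> carrier A \<Longrightarrow> q x = \<zero>\<^bsub>B\<^esub> \<longleftrightarrow> x \<in> {\<zero>\<^bsub>A\<^esub>}"
    using quotient_exists[OF lA z _ inj0] by blast
  have B: "fp_injective R B"
    by (rule fp_injective_quotient[OF coh fpA lB q(1,2)
          fp_injective_trivial[OF left_module_kernel[OF lA lB q(1)]]])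
      (auto simp: carrier_kernel_module q(3))
  obtain q' where "q' \<in> mod_hom R (B\<lparr>carrier := q ` carrier A\<rparr>) A" "\<And>x. x \<in> carrier A \<Longrightarrow> q' (q x) = x"
    using factor_through_image[OF lA lB lA q(1) mod_hom_id] q(3) by blast
  then have q': "q' \<in> mod_hom R B A" "\<And>x. x \<in> carrier A \<Longrightarrow> q' (q x) = x" by (simp_all add: q(2))

  let ?N = "cycles P d n" and ?P = "P (n + 1)" and ?d = "d (n + 1)"
  have N: "left_module R ?N" unfolding cycles_def by (rule left_module_kernel[OF lP lP d])
  have NP: "carrier ?N = ?d ` carrier ?P" by (simp add: cycles_def carrier_kernel_module exact)
  have dP: "?d \<in> mod_hom R ?P (P n)" using d[of "n + 1"] by simp
  have dN: "?d \<in> mod_hom R ?P ?N"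
    unfolding cycles_def by (rule mod_hom_kernelI[OF dP]) (use exact[of n] in blast)
  have K: "kernel_module ?P ?N ?d = kernel_module ?P (P n) ?d"
    by (simp add: kernel_module_def a_kernel_def' cycles_def)
  \<comment> \<open>Both \<open>?P\<close>, being projective, and the canonical free cover map onto
    \<open>?N\<close>, so each lifts along the other; this lets \<open>ext_transfer\<close> replace
    the cover in \<open>Ext1\<close> by \<open>?P\<close>.\<close>
  obtain a where a: "a \<in> mod_hom R ?P (free_cover R ?N)" "\<And>x. x \<in> carrier ?P \<Longrightarrow> cover_map R ?N (a x) = ?d x"
    using projective_lift[OF assms(3) free_cover_module[OF N] N cover_map_hom[OF N] dN cover_map_onto[OF N]] by blast
  obtain b where b: "b \<in> mod_hom R (free_cover R ?N) ?P" "\<And>x. x \<in> carrier (free_cover R ?N) \<Longrightarrow> ?d (b x) = cover_map R ?N x"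
    using lift_free[OF lP N dN NP[symmetric] cover_map_hom[OF N, unfolded free_cover_def], folded free_cover_def]
    by blast
  have ext: "\<exists>g\<in>mod_hom R ?P A. \<forall>x\<in>carrier (kernel_module ?P ?N ?d). g x = \<kappa> x"
    if k: "\<kappa> \<in> mod_hom R (kernel_module ?P ?N ?d) A" for \<kappa>
  proof -
    \<comment> \<open>Counting down from \<open>n + 1\<close> turns the degrees into natural
      numbers, and the cycles at index 0 are the kernel of \<open>?P\<close> over
      \<open>?N\<close>.\<close>
    define C where "C k = P (n + 1 - int k)" for k
    define D where "D k = d (n + 1 - int k)" for k
    have D: "D k \<in> mod_hom R (C k) (C (Suc k))" for k
      using d[of "n + 1 - int k"] by (simp add: C_def D_def algebra_simps)
    have ex: "D k ` carrier (C k) = {x \<in> carrier (C (Suc k)). D (Suc k) x = \<zero>\<^bsub>C (Suc (Suc k))\<^esub>}" for k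
      using exact[of "n - int k"] by (simp add: C_def D_def algebra_simps)
    have C: "projective R (C k)" for k unfolding C_def by (rule assms(3))
    have K': "kernel_module (C 0) (C 1) (D 0) = kernel_module ?P ?N ?d" by (simp add: C_def D_def K)
    have "(\<lambda>x. q (\<kappa> x)) \<in> mod_hom R (kernel_module (C 0) (C 1) (D 0)) B"
      unfolding K' by (rule mod_hom_comp[OF k q(1)])
    from extend_from_cycles[OF coh enc C D ex B this]
    obtain g where g: "g \<in> mod_hom R ?P B" "\<And>x. x \<in> carrier (kernel_module ?P ?N ?d) \<Longrightarrow> g x = q (\<kappa> x)"
      unfolding K' by (auto simp: C_def)
    show ?thesis
      by (rule bexI[OF _ mod_hom_comp[OF g(1) q'(1)]]) (simp add: g(2) q'(2) mod_hom_closed[OF k])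
  qed
  show ?thesis
    unfolding Ext1_trivial_iff[OF N lA]
  proof
    fix \<kappa> assume k: "\<kappa> \<in> mod_hom R (syzygy R ?N) A"
    show "\<exists>g\<in>mod_hom R (free_cover R ?N) A. \<forall>x\<in>carrier (syzygy R ?N). g x = \<kappa> x"
      using ext_transfer[OF lP free_cover_module[OF N] N lA cover_map_hom[OF N] a b ext] k
      by (simp add: syzygy_def)
  qed
qed

end
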